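(* Let $m_1,m_2,\dots$ be positive integers and let $M(z)=\sum_{i\ge1}m_iz^i/i!$ be the exponential generating function of the numbers of irreducible structures of an assembly. Suppose $G(z)=M(z)$ satisfies the Flajolet--Soria conditions FS 1, FS 2 and FS 3 stated in the context, with radius of convergence $\rho$ and parameters $\theta>0$ and $\lambda\in\mathbb{R}$. Let $\phi>0$. Let $l_1\ge l_2\ge\cdots$ be the irreducible component sizes of a random assembly on the set $[n]=\{1,\dots,n\}$, chosen from the tilted distribution with parameter $\phi$, and define $L_{jn}=l_j/n$, where this sequence is padded out with zeros. Then for each $k>0$, as $n\to\infty$, the joint distribution of $(L_{1n},\dots,L_{kn})$ converges weakly to the joint distribution of the first $k$ coordinates of the Poisson--Dirichlet process $\mathrm{PD}(\phi\theta)$.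
   Context: Assemblies: given positive integers $m_1,m_2,\dots$, an assembly of size $n$ is a partition of $[n]$ into disjoint nonempty blocks together with, on each block of size $i$, a choice of one of $m_i$ possible "irreducible" structures. Its irreducible components are its (structured) blocks, and the size of a component is the size of the block. Tilted distribution with parameter $\phi>0$: an assembly of size $n$ is chosen with probability proportional to $\phi^{K}$, where $K$ is its number of irreducible components. Flajolet--Soria conditions: let $G(z)$ be analytic near $z=0$ with power series at $0$ having real non-negative coefficients and finite (positive) radius of convergence $\rho$. For some $\theta>0$ and real $\lambda$: FS 1: $\rho$ is the unique singularity of $G(z)$ on $|z|=\rho$. FS 2: $G(z)$ is analytically continuable to an open domain $\Delta$ consisting of a disc centered at $0$ of radius exceeding $\rho$, but possibly excluding a closed wedge $|\arg(z-\rho)|\le\gamma$ with vertex at $\rho$, for some $0\le\gamma<\pi/2$. FS 3: as $z\to\rho$ in $\Delta$, $$G(z)=\theta\log\frac{1}{1-z/\rho}+\lambda+O\left(\frac{1}{(\log(1-z/\rho))^2}\right).$$ $\mathrm{PD}(\theta)$, $\theta>0$: let $U_1,U_2,\dots$ be i.i.d. uniform on $[0,1]$, $V_i=U_i^{1/\theta}$, and $G_1=1-V_1$, $G_2=V_1(1-V_2)$, $G_3=V_1V_2(1-V_3),\dots$. Then $\mathrm{PD}(\theta)$ is the law of the sequence $X_1\ge X_2\ge\cdots$ obtained by sorting $G_1,G_2,\dots$ into non-increasing order. *)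

theory Defs
  imports "HOL-Probability.Probability" "HOL-Complex_Analysis.Complex_Analysis"
begin

text \<open>
  The structures available on a block \<open>B\<close> are labelled by \<open>{..<m (card B)}\<close>.
  The value \<open>m 0\<close> is never used.
\<close>

type_synonym assembly = "nat set set \<times> (nat set \<Rightarrow> nat)"

definition assemblies :: "(nat \<Rightarrow> nat) \<Rightarrow> nat \<Rightarrow> assembly set" where
  "assemblies m n = (SIGMA P:{P. partition_on {1..n} P}. \<Pi>\<^sub>E B\<in>P. {..<m (card B)})"

definition num_components :: "assembly \<Rightarrow> nat" where
  "num_components a = card (fst a)"

definition component_sizes :: "assembly \<Rightarrow> nat list" where
  "component_sizes a = rev (sorted_list_of_multiset (image_mset card (mset_set (fst a))))"

text \<open>Indices start at \<open>0\<close>: \<open>rel_size n a j\<close> is $L_{j+1,n}$.\<close>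

definition rel_size :: "nat \<Rightarrow> assembly \<Rightarrow> nat \<Rightarrow> real" where
  "rel_size n a j =
     (if j < length (component_sizes a) then real (component_sizes a ! j) / real n else 0)"

definition tilted_assembly :: "(nat \<Rightarrow> nat) \<Rightarrow> real \<Rightarrow> nat \<Rightarrow> assembly pmf" where
  "tilted_assembly m \<phi> n = embed_pmf (\<lambda>a. if a \<in> assemblies m n
     then \<phi> ^ num_components a / (\<Sum>b\<in>assemblies m n. \<phi> ^ num_components b) else 0)"

lemma finite_assemblies: "finite (assemblies m n)"
proof -
  have "finite {P. partition_on {1..n} P}"
    by (rule finitely_many_partition_on) simp
  moreover have "finite (\<Pi>\<^sub>E B\<in>P. {..<m (card B)})" if "partition_on {1..n} P" for P
    using finite_elements[OF _ that] by (intro finite_PiE) auto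
  ultimately show ?thesis
    unfolding assemblies_def by (intro finite_SigmaI) auto
qed

lemma assemblies_nonempty:
  assumes "\<And>i. i \<ge> 1 \<Longrightarrow> m i > 0"
  shows "assemblies m n \<noteq> {}"
proof -
  define P :: "nat set set" where "P = (\<lambda>i. {i}) ` {1..n}"
  have P: "partition_on {1..n} P"
    unfolding P_def by (auto simp: partition_on_def disjoint_def)
  have "(\<lambda>B\<in>P. 0) \<in> (\<Pi>\<^sub>E B\<in>P. {..<m (card B)})"
    using assms by (auto simp: P_def)
  with P have "(P, \<lambda>B\<in>P. 0) \<in> assemblies m n"
    unfolding assemblies_def by blast
  thus ?thesis by blast
qed

lemma pmf_tilted_assembly:
  assumes "\<And>i. i \<ge> 1 \<Longrightarrow> m i > 0" and "\<phi> > 0"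
  shows "pmf (tilted_assembly m \<phi> n) a = (if a \<in> assemblies m n
     then \<phi> ^ num_components a / (\<Sum>b\<in>assemblies m n. \<phi> ^ num_components b) else 0)"
proof -
  let ?A = "assemblies m n"
  let ?Z = "\<Sum>b\<in>?A. \<phi> ^ num_components b"
  let ?f = "\<lambda>a. if a \<in> ?A then \<phi> ^ num_components a / ?Z else 0"
  have Z: "?Z > 0"
    using assms assemblies_nonempty[of m n] finite_assemblies[of m n] by (intro sum_pos) auto
  have nn: "?f a \<ge> 0" for a
    using Z assms(2) by auto
  have "(\<integral>\<^sup>+a. ennreal (?f a) \<partial>count_space UNIV) = (\<Sum>a\<in>?A. ennreal (?f a))"
    by (rule nn_integral_count_space'[OF finite_assemblies]) auto
  also have "\<dots> = ennreal (\<Sum>a\<in>?A. ?f a)"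
    by (intro sum_ennreal nn)
  also have "(\<Sum>a\<in>?A. ?f a) = 1"
    using Z by (simp flip: sum_divide_distrib)
  finally have "(\<integral>\<^sup>+a. ennreal (?f a) \<partial>count_space UNIV) = 1"
    by simp
  thus ?thesis
    unfolding tilted_assembly_def by (intro pmf_embed_pmf nn)
qed

definition egf :: "(nat \<Rightarrow> nat) \<Rightarrow> complex fps" where
  "egf m = Abs_fps (\<lambda>i. if i = 0 then 0 else of_nat (m i) / fact i)"

text \<open>
  \<open>F\<close> is a power series with radius of convergence \<open>\<rho>\<close>, and \<open>w\<close> a point with \<open>norm w = \<rho>\<close>.
  The intersection of the two discs is connected, so the local continuation is unique.
\<close>

definition boundary_singularity :: "complex fps \<Rightarrow> real \<Rightarrow> complex \<Rightarrow> bool" where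
  "boundary_singularity F \<rho> w \<longleftrightarrow>
     \<not> (\<exists>r>0. \<exists>g. g holomorphic_on ball w r \<and> (\<forall>z\<in>ball w r \<inter> ball 0 \<rho>. g z = eval_fps F z))"

text \<open>
  As \<open>Arg 0 = 0\<close>, the excluded wedge contains its vertex \<open>\<rho>\<close>; for \<open>\<gamma> = 0\<close> it is the closed
  ray from \<open>\<rho>\<close> to infinity. Since \<open>\<gamma> < pi / 2\<close>, the domain contains \<open>ball 0 \<rho>\<close>.
\<close>

definition delta_domain :: "real \<Rightarrow> complex set \<Rightarrow> bool" where
  "delta_domain \<rho> \<Delta> \<longleftrightarrow> (\<exists>R>\<rho>. \<Delta> = ball 0 R \<or>
     (\<exists>\<gamma>. 0 \<le> \<gamma> \<and> \<gamma> < pi / 2 \<and> \<Delta> = ball 0 R - {z. \<bar>Arg (z - of_real \<rho>)\<bar> \<le> \<gamma>}))"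

text \<open>
  In the last clause the principal branch \<open>Ln\<close> is the right one: if \<open>\<Delta>\<close> omits a wedge, then
  \<open>1 - z / \<rho>\<close> avoids the non-positive reals on \<open>\<Delta>\<close>; if \<open>\<Delta>\<close> is a full disc, then \<open>\<rho>\<close> is no singularity.
\<close>

definition flajolet_soria :: "complex fps \<Rightarrow> real \<Rightarrow> real \<Rightarrow> real \<Rightarrow> bool" where
  "flajolet_soria F \<rho> \<theta> lam \<longleftrightarrow>
     (\<forall>i. fps_nth F i \<in> \<real>\<^sub>\<ge>\<^sub>0) \<and> 0 < \<rho> \<and> fps_conv_radius F = ereal \<rho> \<and> 0 < \<theta> \<and>
     {w. norm w = \<rho> \<and> boundary_singularity F \<rho> w} = {of_real \<rho>} \<and>
     (\<exists>\<Delta> G. delta_domain \<rho> \<Delta> \<and> G holomorphic_on \<Delta> \<and> (\<forall>z\<in>ball 0 \<rho>. G z = eval_fps F z) \<and>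
        (\<lambda>z. G z - (of_real \<theta> * Ln (1 / (1 - z / of_real \<rho>)) + of_real lam))
          \<in> O[at (of_real \<rho>) within \<Delta>](\<lambda>z. 1 / (Ln (1 - z / of_real \<rho>))\<^sup>2))"

text \<open>
  Non-increasing rearrangement. A sequence that is not both positive and null need not have one and
  is sent to \<open>0\<close>; below this happens with probability zero only.
\<close>

definition sort_desc :: "(nat \<Rightarrow> real) \<Rightarrow> nat \<Rightarrow> real" where
  "sort_desc x = (if (\<forall>i. 0 < x i) \<and> x \<longlonglongrightarrow> 0
     then (THE y. decseq y \<and> (\<exists>p. bij p \<and> y = x \<circ> p)) else (\<lambda>_. 0))"

definition stick_breaking :: "real \<Rightarrow> (nat \<Rightarrow> real) \<Rightarrow> nat \<Rightarrow> real" where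
  "stick_breaking \<theta> u i = (\<Prod>j<i. u j powr (1 / \<theta>)) * (1 - u i powr (1 / \<theta>))"

definition iid_uniform :: "(nat \<Rightarrow> real) measure" where
  "iid_uniform = (\<Pi>\<^sub>M i\<in>UNIV. uniform_measure lborel {0..1})"

definition PD :: "real \<Rightarrow> (nat \<Rightarrow> real) measure" where
  "PD \<theta> = distr iid_uniform (\<Pi>\<^sub>M i\<in>UNIV. borel) (\<lambda>u. sort_desc (stick_breaking \<theta> u))"

lemma decseq_rearrangement_gt_iff:
  fixes x :: "nat \<Rightarrow> real"
  assumes "decseq y" "bij p" "y = x \<circ> p"
  shows "y j > t \<longleftrightarrow> (\<exists>S. finite S \<and> card S = Suc j \<and> (\<forall>i\<in>S. x i > t))"
proof
  assume t: "y j > t"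
  have "card (p ` {..j}) = Suc j"
    using assms(2) by (subst card_image) (auto simp: bij_def inj_on_def)
  moreover have "x i > t" if "i \<in> p ` {..j}" for i
    using that t assms(1,3) by (auto simp: decseq_def intro: less_le_trans)
  ultimately show "\<exists>S. finite S \<and> card S = Suc j \<and> (\<forall>i\<in>S. x i > t)"
    by (intro exI[of _ "p ` {..j}"]) auto
next
  assume "\<exists>S. finite S \<and> card S = Suc j \<and> (\<forall>i\<in>S. x i > t)"
  then obtain S where S: "finite S" "card S = Suc j" "\<forall>i\<in>S. x i > t" by blast
  have "\<not> S \<subseteq> p ` {..<j}"
  proof
    assume "S \<subseteq> p ` {..<j}"
    hence "card S \<le> card (p ` {..<j})" by (intro card_mono) auto
    also have "\<dots> \<le> j" using card_image_le[of "{..<j}" p] by simp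
    finally show False using S(2) by simp
  qed
  then obtain i where i: "i \<in> S" "i \<notin> p ` {..<j}" by blast
  obtain l where l: "i = p l" using assms(2) by (metis bij_pointE)
  have "j \<le> l" using i l by (auto simp: not_le[symmetric])
  hence "y l \<le> y j" using assms(1) by (simp add: decseq_def)
  thus "y j > t" using S(3) i(1) l assms(3) by fastforce
qed

lemma decseq_rearrangement_exists:
  fixes x :: "nat \<Rightarrow> real"
  assumes pos: "\<And>i. 0 < x i" and lim: "x \<longlonglongrightarrow> 0"
  shows "\<exists>y. decseq y \<and> (\<exists>p. bij p \<and> y = x \<circ> p)"
proof -
  define before where "before i j \<longleftrightarrow> x i > x j \<or> (x i = x j \<and> i < j)" for i j
  define r where "r j = card {i. before i j}" for j
  have fin: "finite {i. before i j}" for j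
  proof -
    have "eventually (\<lambda>i. x i < x j) sequentially"
      using order_tendstoD(2)[OF lim pos] .
    then obtain N where N: "\<And>i. i \<ge> N \<Longrightarrow> x i < x j"
      by (auto simp: eventually_sequentially)
    have "{i. before i j} \<subseteq> {..<N}"
    proof
      fix i assume "i \<in> {i. before i j}"
      hence "\<not> x i < x j" by (auto simp: before_def)
      thus "i \<in> {..<N}" using N[of i] by force
    qed
    thus ?thesis by (rule finite_subset) simp
  qed
  have trans: "before i k" if "before i j" "before j k" for i j k
    using that by (auto simp: before_def)
  have irr: "\<not> before i i" for i by (auto simp: before_def)
  have total: "before i j \<or> i = j \<or> before j i" for i j by (auto simp: before_def)
  have mono: "r i < r j" if "before i j" for i j
  proof -
    have "{k. before k i} \<subset> {k. before k j}"
      using that trans irr by blast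
    thus ?thesis unfolding r_def by (intro psubset_card_mono fin)
  qed
  have inj: "inj r"
    by (rule injI) (metis mono total less_irrefl)
  have lower: "{..<r i} \<subseteq> range r" for i
  proof -
    have sub: "r ` {k. before k i} \<subseteq> {..<r i}" using mono by auto
    have "card (r ` {k. before k i}) = card {k. before k i}"
      using inj by (intro card_image) (auto simp: inj_on_def)
    hence "card (r ` {k. before k i}) = card {..<r i}" by (simp add: r_def)
    with sub have "r ` {k. before k i} = {..<r i}" by (intro card_subset_eq) auto
    thus ?thesis by blast
  qed
  have "surj r"
  proof -
    have "infinite (range r)" using inj by (simp add: range_inj_infinite)
    hence "n \<in> range r" for n
      using lower by (metis infinite_nat_iff_unbounded lessThan_iff rangeE subsetD)
    thus ?thesis by blast
  qed
  hence bij: "bij r" using inj by (simp add: bij_def)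
  have rinv: "r (inv r n) = n" for n using \<open>surj r\<close> by (rule surj_f_inv_f)
  have "decseq (x \<circ> inv r)"
    unfolding decseq_def
  proof (intro allI impI)
    fix a b :: nat assume "a \<le> b"
    hence "\<not> before (inv r b) (inv r a)"
      using mono[of "inv r b" "inv r a"] rinv by auto
    thus "(x \<circ> inv r) b \<le> (x \<circ> inv r) a" by (auto simp: before_def)
  qed
  thus ?thesis using bij_imp_bij_inv[OF bij] by blast
qed

lemma sort_desc_eqI:
  assumes "\<And>i. 0 < x i" "x \<longlonglongrightarrow> 0" "decseq y" "bij p" "y = x \<circ> p"
  shows "sort_desc x = y"
proof -
  have "(THE y. decseq y \<and> (\<exists>p. bij p \<and> y = x \<circ> p)) = y"
  proof (rule the_equality)
    show "decseq y \<and> (\<exists>p. bij p \<and> y = x \<circ> p)" using assms by blast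
    fix z assume "decseq z \<and> (\<exists>p. bij p \<and> z = x \<circ> p)"
    then obtain q where q: "decseq z" "bij q" "z = x \<circ> q" by blast
    have "z j > t \<longleftrightarrow> y j > t" for j t
      using decseq_rearrangement_gt_iff[OF q] decseq_rearrangement_gt_iff[OF assms(3-5)] by simp
    thus "z = y" by (intro ext) (metis less_irrefl linorder_neqE)
  qed
  thus ?thesis using assms(1,2) by (simp add: sort_desc_def)
qed

lemma sort_desc_rearrangement:
  assumes "\<And>i. 0 < x i" "x \<longlonglongrightarrow> 0"
  shows "decseq (sort_desc x)" "\<exists>p. bij p \<and> sort_desc x = x \<circ> p"
proof -
  obtain y p where y: "decseq y" "bij p" "y = x \<circ> p"
    using decseq_rearrangement_exists[OF assms] by blast
  have "sort_desc x = y" by (rule sort_desc_eqI[OF assms y])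
  with y show "decseq (sort_desc x)" "\<exists>p. bij p \<and> sort_desc x = x \<circ> p" by auto
qed

lemma sort_desc_gt_iff:
  assumes "\<And>i. 0 < x i" "x \<longlonglongrightarrow> 0"
  shows "sort_desc x j > t \<longleftrightarrow> (\<exists>S. finite S \<and> card S = Suc j \<and> (\<forall>i\<in>S. x i > t))"
  using sort_desc_rearrangement[OF assms] decseq_rearrangement_gt_iff by blast

lemma sort_desc_measurable:
  "sort_desc \<in> (\<Pi>\<^sub>M i\<in>UNIV. borel) \<rightarrow>\<^sub>M (\<Pi>\<^sub>M i\<in>UNIV. borel)"
proof (rule measurable_PiM_single')
  let ?M = "\<Pi>\<^sub>M i\<in>(UNIV::nat set). (borel :: real measure)"
  let ?good = "\<lambda>x::nat \<Rightarrow> real. (\<forall>i. 0 < x i) \<and> x \<longlonglongrightarrow> 0"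
  have [measurable]: "(\<lambda>x. x i) \<in> borel_measurable ?M" for i
    by (rule measurable_component_singleton) simp
  have lim_iff: "x \<longlonglongrightarrow> 0 \<longleftrightarrow> (\<forall>k. \<exists>N. \<forall>n. N \<le> n \<longrightarrow> \<bar>x n\<bar> < inverse (real (Suc k)))"
    (is "?lhs \<longleftrightarrow> ?rhs") for x :: "nat \<Rightarrow> real"
  proof
    assume ?lhs
    show ?rhs
    proof
      fix k :: nat
      have "inverse (real (Suc k)) > 0" by simp
      from LIMSEQ_D[OF \<open>?lhs\<close> this] show "\<exists>N. \<forall>n. N \<le> n \<longrightarrow> \<bar>x n\<bar> < inverse (real (Suc k))" by simp
    qed
  next
    assume rhs: ?rhs
    show ?lhs
    proof (rule LIMSEQ_I)
      fix r :: real assume "r > 0"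
      then obtain k where k: "inverse (real (Suc k)) < r" using reals_Archimedean by blast
      obtain N where "\<forall>n. N \<le> n \<longrightarrow> \<bar>x n\<bar> < inverse (real (Suc k))" using rhs by blast
      with k have "\<forall>n\<ge>N. norm (x n - 0) < r" by force
      thus "\<exists>N. \<forall>n\<ge>N. norm (x n - 0) < r" by blast
    qed
  qed
  have good [measurable]: "Measurable.pred ?M ?good"
    unfolding lim_iff by measurable
  fix j :: nat
  show "(\<lambda>x. sort_desc x j) \<in> borel_measurable ?M"
    unfolding borel_measurable_iff_greater
  proof
    fix t :: real
    define C where "C = {S :: nat set. finite S \<and> card S = Suc j}"
    have C: "countable C"
      unfolding C_def by (rule countable_subset[OF _ countable_Collect_finite]) auto
    have eq: "sort_desc x j > t \<longleftrightarrow>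
        (?good x \<and> (\<exists>S\<in>C. \<forall>i\<in>S. x i > t)) \<or> (\<not> ?good x \<and> 0 > t)" for x
      using sort_desc_gt_iff[of x t j] by (auto simp: C_def sort_desc_def)
    have "Measurable.pred ?M (\<lambda>x. \<forall>i\<in>S. x i > t)" for S :: "nat set"
      by measurable
    hence "Measurable.pred ?M (\<lambda>x. \<exists>S\<in>C. \<forall>i\<in>S. x i > t)"
      unfolding pred_def by (intro sets.sets_Collect_countable_Ex' C)
    hence "Measurable.pred ?M (\<lambda>x. sort_desc x j > t)"
      unfolding eq by measurable
    thus "{x \<in> space ?M. t < sort_desc x j} \<in> sets ?M"
      by (rule predE)
  qed
qed auto

lemma prob_space_iid_uniform: "prob_space iid_uniform"
  unfolding iid_uniform_def
  by (intro prob_space_PiM prob_space_uniform_measure) auto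

lemma sets_iid_uniform: "sets iid_uniform = sets (\<Pi>\<^sub>M i\<in>UNIV. borel)"
  unfolding iid_uniform_def by (intro sets_PiM_cong) auto

lemma stick_breaking_measurable:
  "stick_breaking \<theta> \<in> iid_uniform \<rightarrow>\<^sub>M (\<Pi>\<^sub>M i\<in>UNIV. borel)"
proof -
  have [measurable]: "(\<lambda>u. u i) \<in> borel_measurable (\<Pi>\<^sub>M i\<in>(UNIV::nat set). (borel :: real measure))"
    for i by (rule measurable_component_singleton) simp
  have "stick_breaking \<theta> \<in> (\<Pi>\<^sub>M i\<in>UNIV. borel) \<rightarrow>\<^sub>M (\<Pi>\<^sub>M i\<in>UNIV. borel)"
    by (rule measurable_PiM_single') (auto simp: stick_breaking_def)
  thus ?thesis by (simp cong: measurable_cong_sets add: sets_iid_uniform)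
qed

lemma prob_space_PD: "prob_space (PD \<theta>)"
proof -
  have "(\<lambda>u. sort_desc (stick_breaking \<theta> u)) \<in> iid_uniform \<rightarrow>\<^sub>M (\<Pi>\<^sub>M i\<in>UNIV. borel)"
    by (rule measurable_compose[OF stick_breaking_measurable sort_desc_measurable])
  thus ?thesis
    unfolding PD_def by (rule prob_space.prob_space_distr[OF prob_space_iid_uniform])
qed

lemma AE_stick_breaking:
  assumes "\<theta> > 0"
  shows "AE u in iid_uniform. (\<forall>i. 0 < stick_breaking \<theta> u i) \<and> stick_breaking \<theta> u \<longlonglongrightarrow> 0"
proof -
  let ?U = "uniform_measure lborel {0..1::real}"
  have "AE x in lborel. x \<noteq> (0::real) \<and> x \<noteq> 1"
    by (intro AE_conjI AE_lborel_singleton)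
  hence U: "AE x in ?U. 0 < x \<and> x < 1"
    by (intro AE_uniform_measureI) (force elim: eventually_mono)+
  have "AE u in iid_uniform. 0 < u i \<and> u i < 1" for i
    unfolding iid_uniform_def
    using AE_PiM_component[of "UNIV :: nat set" "\<lambda>_. ?U" i "\<lambda>x. 0 < x \<and> x < 1"] U
    by (simp add: prob_space_uniform_measure)
  hence "AE u in iid_uniform. \<forall>i. 0 < u i \<and> u i < 1"
    by (simp add: AE_all_countable)
  thus ?thesis
  proof eventually_elim
    case (elim u)
    let ?v = "\<lambda>i. u i powr (1 / \<theta>)"
    have v: "0 < ?v i" "?v i < 1" for i
      using elim assms powr_less_mono2[of "1 / \<theta>" "u i" 1] by (auto simp: less_le)
    have pos: "0 < stick_breaking \<theta> u i" for i
      unfolding stick_breaking_def by (intro mult_pos_pos prod_pos) (use v elim in \<open>auto simp: less_le\<close>)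
    have "(\<Sum>i<n. stick_breaking \<theta> u i) = 1 - (\<Prod>i<n. ?v i)" for n
      by (induction n) (auto simp: stick_breaking_def algebra_simps)
    moreover have "0 \<le> (\<Prod>i<n. ?v i)" for n by (intro prod_nonneg) auto
    ultimately have "(\<Sum>i<n. stick_breaking \<theta> u i) \<le> 1" for n by simp
    hence "summable (stick_breaking \<theta> u)"
      using pos by (intro summableI_nonneg_bounded[where x = 1]) (auto intro: less_imp_le)
    thus ?case using pos summable_LIMSEQ_zero by blast
  qed
qed

definition weak_conv_in :: "'a topology \<Rightarrow> (nat \<Rightarrow> 'a measure) \<Rightarrow> 'a measure \<Rightarrow> bool" where
  "weak_conv_in T M N \<longleftrightarrow>
     (\<forall>f. continuous_map T euclideanreal f \<longrightarrow> bounded (f ` topspace T) \<longrightarrow>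
        (\<lambda>n. \<integral>x. f x \<partial>M n) \<longlonglongrightarrow> (\<integral>x. f x \<partial>N))"

text \<open>
  \<open>\<real>\<^sup>k\<close> is the set of functions \<open>nat \<Rightarrow> real\<close> that are \<open>undefined\<close> outside \<open>{..<k}\<close>: it underlies both
  \<open>product_topology\<close> and \<open>PiM\<close> with index set \<open>{..<k}\<close>.
\<close>

definition first_coords :: "nat \<Rightarrow> 'a measure \<Rightarrow> ('a \<Rightarrow> nat \<Rightarrow> real) \<Rightarrow> (nat \<Rightarrow> real) measure" where
  "first_coords k M X = distr M (\<Pi>\<^sub>M i\<in>{..<k}. borel) (\<lambda>\<omega>. restrict (X \<omega>) {..<k})"

end

theory Submission
  imports Defs "HOL-Real_Asymp.Real_Asymp"
begin

text \<open>
  Write \<open>\<alpha> = \<phi> \<theta>\<close>. Deleting the block of a tilted assembly that contains a given point leaves a tilted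
  assembly on the remaining points, so the block sizes form a Markov chain of size-biased picks: from \<open>n\<close>
  remaining points a block of size \<open>i\<close> is removed with probability \<open>a\<^sub>i q\<^bsub>n-i\<^esub> / (n q\<^sub>n)\<close>, where
  \<open>q\<^sub>n = \<rho>\<^sup>n [z\<^sup>n] exp (\<phi> M(z))\<close> and \<open>a\<^sub>i = \<phi> i \<rho>\<^sup>i [z\<^sup>i] M(z)\<close>.

  Singularity analysis gives \<open>a\<^sub>n \<rightarrow> \<alpha>\<close> and \<open>q\<^sub>n \<sim> C n\<^bsup>\<alpha>-1\<^esup>\<close>, hence the probability that the first pick exceeds
  \<open>x n\<close> tends to \<open>(1 - x)\<^bsup>\<alpha>\<^esup>\<close>, which is the tail of \<open>1 - U\<^bsup>1/\<alpha>\<^esup>\<close> for a uniform \<open>U\<close>.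
  If the chains for all \<open>n\<close> are driven by the same uniform variables through quantile functions, the rescaled
  picks converge pointwise to the stick-breaking sequence. Since the latter has total mass \<open>1\<close>, ranking
  preserves the limit, and dominated convergence finishes the proof.
\<close>

text \<open>The error in FS 3 is too weak for a full expansion of the coefficients, but two uses of
  o(1) suffice: directly, with exponent 0, for the limit of \<open>a\<close>, and after
  exponentiation, where exp of o(1) differs from 1 by o(1) again, with exponent \<alpha> for q.
  Hence one transfer result for all exponents \<beta> \<ge> 0.

  No local limit law is needed for the picks. A pick above x n involves \<open>a\<close> at large
  indices only, where it may be replaced by \<alpha>; what is left are partial sums of q, which an
  averaging argument controls.

  The ranked sizes obey no simple recursion, whereas the picks do. The two are linked through the
  multiset of sizes, which forgets the order of picking and determines the ranking.

  The quantile functions decrease in u, as 1 - u powr (1 / \<alpha>) does, so the coupled limit is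
  the stick-breaking sequence itself and not just a sequence with the same law.\<close>

section \<open>Coefficients of functions that are small at a boundary singularity\<close>

text \<open>The domain \<open>\<Delta>\<close> of FS 2, rescaled so that the vertex of the wedge is \<open>1\<close>.\<close>
definition slit_disc :: "real \<Rightarrow> real \<Rightarrow> complex set" where
  "slit_disc R \<gamma> = ball 0 R - {z. \<bar>Arg (z - 1)\<bar> \<le> \<gamma>}"

text \<open>Cosine decreases on [0, \<pi>], so a bound on the angle becomes an inequality between
  continuous functions that survives small displacements. All estimates of the wedge go through this
  form.\<close>

lemma norm_cos_le_Re:
  assumes "\<bar>Arg z\<bar> \<le> \<gamma>" "\<gamma> \<le> pi"
  shows "norm z * cos \<gamma> \<le> Re z"
proof -
  have "cos \<gamma> \<le> cos \<bar>Arg z\<bar>"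
    using assms by (intro cos_monotone_0_pi_le) auto
  hence "norm z * cos \<gamma> \<le> norm z * cos (Arg z)"
    by (intro mult_left_mono) auto
  also have "\<dots> = Re z"
    by (metis Re_complex_of_real Re_rcis rcis_cmod_Arg)
  finally show ?thesis .
qed

lemma Re_less_1:
  fixes z :: complex
  assumes "norm z \<le> 1" "z \<noteq> 1"
  shows "Re z < 1"
proof (rule ccontr)
  assume "\<not> Re z < 1"
  moreover have "\<bar>Re z\<bar> \<le> norm z" by (rule abs_Re_le_cmod)
  ultimately have 1: "Re z = 1" "norm z = 1" using assms(1) by linarith+
  hence "Im z = 0" by (simp add: cmod_def)
  with 1 assms(2) show False by (simp add: complex_eq_iff)
qed

text \<open>If a point w of the disc lay in the wedge, then |w - 1| cos \<gamma> would be at most Re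
  (w - 1), which is below \<kappa> |1 - z| because Re z < 1, while |w - 1| is at least (1 -
  \<kappa>) |1 - z|. The bound cos \<gamma> / 3 rules this out, since (1 - \<kappa>) cos \<gamma>
  \<ge> 2 cos \<gamma> / 3 > \<kappa>. These discs, of radius proportional to the distance from 1,
  are the room that Cauchy's inequality needs near the vertex.\<close>

lemma cball_subset_slit_disc:
  assumes "0 \<le> \<gamma>" "\<gamma> < pi / 2" "norm z \<le> 1" "z \<noteq> 1"
    and "0 \<le> \<kappa>" "\<kappa> \<le> cos \<gamma> / 3"
    and small: "norm (1 - z) * \<kappa> < R - 1"
  shows "cball z (\<kappa> * norm (1 - z)) \<subseteq> slit_disc R \<gamma>"
proof
  fix w assume w: "w \<in> cball z (\<kappa> * norm (1 - z))"
  let ?s = "norm (1 - z)"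
  have s: "?s > 0" using assms by simp
  have c: "0 < cos \<gamma>" "cos \<gamma> \<le> 1" using assms by (auto intro!: cos_gt_zero_pi)
  have wz: "norm (w - z) \<le> \<kappa> * ?s" using w by (simp add: dist_norm norm_minus_commute)
  have "norm w \<le> norm z + norm (w - z)" by (rule norm_triangle_sub)
  also have "\<dots> < 1 + (R - 1)" using wz assms(3) small by (simp add: mult.commute)
  finally have wR: "norm w < R" by simp
  have "\<not> \<bar>Arg (w - 1)\<bar> \<le> \<gamma>"
  proof
    assume "\<bar>Arg (w - 1)\<bar> \<le> \<gamma>"
    hence "norm (w - 1) * cos \<gamma> \<le> Re (w - 1)"
      using assms(2) by (intro norm_cos_le_Re) auto
    also have "\<dots> = Re (z - 1) + Re (w - z)" by simp
    also have "\<dots> < \<kappa> * ?s"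
      using Re_less_1[OF assms(3,4)] complex_Re_le_cmod[of "w - z"] wz by simp
    finally have 1: "norm (w - 1) * cos \<gamma> < \<kappa> * ?s" .
    have "?s \<le> norm (w - 1) + norm (w - z)"
      using norm_triangle_ineq4[of "w - z" "w - 1"] by (simp add: norm_minus_commute)
    hence "?s * (1 - \<kappa>) \<le> norm (w - 1)" using wz by (simp add: algebra_simps)
    hence "?s * (1 - \<kappa>) * cos \<gamma> \<le> norm (w - 1) * cos \<gamma>" using c by (intro mult_right_mono) auto
    with 1 have "?s * ((1 - \<kappa>) * cos \<gamma>) < ?s * \<kappa>" by (simp add: mult_ac)
    hence 2: "(1 - \<kappa>) * cos \<gamma> < \<kappa>" using s by simp
    have "(1 - \<kappa>) * cos \<gamma> \<ge> (2/3) * cos \<gamma>"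
      using c assms(6) by (intro mult_right_mono) linarith+
    with 2 c assms(6) show False by simp
  qed
  with wR show "w \<in> slit_disc R \<gamma>" by (simp add: slit_disc_def)
qed

lemma closed_disc_subset_slit_disc:
  assumes "1 < R" "0 \<le> \<gamma>" "\<gamma> < pi / 2"
  shows "cball 0 1 - {1} \<subseteq> slit_disc R \<gamma>"
proof
  fix z :: complex assume z: "z \<in> cball 0 1 - {1}"
  have "\<not> \<bar>Arg (z - 1)\<bar> \<le> \<gamma>"
  proof
    assume "\<bar>Arg (z - 1)\<bar> \<le> \<gamma>"
    hence "norm (z - 1) * cos \<gamma> \<le> Re (z - 1)"
      using assms by (intro norm_cos_le_Re) auto
    moreover have "0 \<le> norm (z - 1) * cos \<gamma>" using assms by (intro mult_nonneg_nonneg cos_ge_zero) auto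
    ultimately show False using Re_less_1[of z] z by simp
  qed
  thus "z \<in> slit_disc R \<gamma>" using z assms by (simp add: slit_disc_def)
qed

text \<open>\<open>Arg\<close> jumps across the negative axis, so the wedge is first rewritten as a
  cone cut out by continuous functions, which also takes in the vertex.\<close>

lemma open_slit_disc:
  assumes "0 \<le> \<gamma>" "\<gamma> < pi / 2"
  shows "open (slit_disc R \<gamma>)"
proof -
  have "{z. \<bar>Arg (z - 1)\<bar> \<le> \<gamma>} = {z. norm (z - 1) * cos \<gamma> \<le> Re (z - 1)}"
  proof safe
    fix z assume "\<bar>Arg (z - 1)\<bar> \<le> \<gamma>"
    thus "norm (z - 1) * cos \<gamma> \<le> Re (z - 1)" using assms by (intro norm_cos_le_Re) auto
  next
    fix z assume *: "norm (z - 1) * cos \<gamma> \<le> Re (z - 1)"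
    show "\<bar>Arg (z - 1)\<bar> \<le> \<gamma>"
    proof (cases "z = 1")
      case True thus ?thesis using assms by (simp add: Arg_zero)
    next
      case False
      have "Re (z - 1) = norm (z - 1) * cos (Arg (z - 1))"
        by (metis Re_complex_of_real Re_rcis rcis_cmod_Arg)
      with * False have "cos \<gamma> \<le> cos \<bar>Arg (z - 1)\<bar>" by simp
      moreover have "\<bar>Arg (z - 1)\<bar> \<le> pi" using mpi_less_Arg[of "z - 1"] Arg_le_pi[of "z - 1"] by linarith
      ultimately show ?thesis using assms cos_mono_le_eq[of \<gamma> "\<bar>Arg (z - 1)\<bar>"] by auto
    qed
  qed
  moreover have "closed {z::complex. norm (z - 1) * cos \<gamma> \<le> Re (z - 1)}"
    by (intro closed_Collect_le continuous_intros)
  ultimately show ?thesis by (simp add: slit_disc_def open_Diff)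
qed

text \<open>On the circle cnj u = r^2 / u, so 1 / |1 - u|^2 = u / ((1 - u) (u - r^2)); Cauchy's
  formula for 1 / (1 - u) at the inner point r^2 gives the value.\<close>

lemma has_integral_poisson_kernel:
  assumes "0 < r" "r < 1"
  shows "((\<lambda>t. 1 / (norm (1 - circlepath 0 r t))\<^sup>2) has_integral (1 / (1 - r\<^sup>2))) {0..1}"
proof -
  let ?c = "circlepath (0::complex) r"
  have r2: "r\<^sup>2 < r" using assms by (simp add: power2_eq_square)
  have nz: "1 - u \<noteq> 0" if "u \<in> cball 0 r" for u :: complex
    using that assms by auto
  have "((\<lambda>u. (1 / (1 - u)) / (u - of_real (r\<^sup>2))) has_contour_integral
          2 * of_real pi * \<i> * (1 / (1 - of_real (r\<^sup>2)))) ?c"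
    by (intro Cauchy_integral_circlepath_simple holomorphic_intros) (use nz r2 assms in \<open>auto simp flip: of_real_power\<close>)
  hence "((\<lambda>t. (1 / (1 - ?c t)) / (?c t - of_real (r\<^sup>2)) * vector_derivative ?c (at t))
           has_integral 2 * of_real pi * \<i> * (1 / (1 - of_real (r\<^sup>2)))) {0..1}"
    by (simp add: has_contour_integral)
  hence "((\<lambda>t. 2 * pi * \<i> * of_real (1 / (norm (1 - ?c t))\<^sup>2))
           has_integral 2 * of_real pi * \<i> * (1 / (1 - of_real (r\<^sup>2)))) {0..1}"
  proof (rule has_integral_eq[rotated])
    fix t :: real assume t: "t \<in> {0..1}"
    define u where "u = ?c t"
    have nu: "norm u = r" using assms by (simp add: u_def circlepath norm_mult)
    hence u0: "u \<noteq> 0" "1 - u \<noteq> 0" using assms by auto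
    have vd: "vector_derivative ?c (at t) = 2 * of_real pi * \<i> * u"
      unfolding vector_derivative_circlepath u_def by (simp add: circlepath mult_ac)
    have r2': "of_real (r\<^sup>2) = u * cnj u" using complex_norm_square[of u] nu by simp
    have "u - of_real (r\<^sup>2) = u * cnj (1 - u)" unfolding r2' by (simp add: algebra_simps)
    moreover have "(of_real ((norm (1 - u))\<^sup>2)::complex) = (1 - u) * cnj (1 - u)" by (rule complex_norm_square)
    moreover have "1 / v / (u * v') * (2 * of_real pi * \<i> * u) = 2 * of_real pi * \<i> * (1 / (v * v'))" for v v' :: complex
      using u0(1) by simp
    ultimately show "(1 / (1 - ?c t)) / (?c t - of_real (r\<^sup>2)) * vector_derivative ?c (at t)
       = 2 * pi * \<i> * of_real (1 / (norm (1 - ?c t))\<^sup>2)"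
      unfolding vd u_def[symmetric] of_real_divide of_real_1 of_real_mult of_real_numeral by (simp only:)
  qed
  from has_integral_mult_right[OF this, of "1 / (2 * pi * \<i>)"]
  have "((\<lambda>t. of_real (1 / (norm (1 - ?c t))\<^sup>2) :: complex) has_integral of_real (1 / (1 - r\<^sup>2))) {0..1}"
    by simp
  from has_integral_linear[OF this bounded_linear_Re] show ?thesis
    by (simp add: o_def)
qed

text \<open>Cauchy's formula with the bound integrated over the circle. Its supremum would give A /
  (1 - r)^2 instead and lose a factor of order 1 / (1 - r).\<close>

lemma taylor_coeff_bound:
  assumes f: "f holomorphic_on ball 0 1" and r: "0 < r" "r < 1"
    and bnd: "\<And>z. norm z = r \<Longrightarrow> norm (f z) \<le> A / (norm (1 - z))\<^sup>2 + C"
  shows "norm ((deriv ^^ n) f 0 / fact n) * r ^ n \<le> A / (1 - r\<^sup>2) + C"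
proof -
  let ?c = "circlepath (0::complex) r"
  have hol: "f holomorphic_on cball 0 r"
    by (rule holomorphic_on_subset[OF f]) (use r in auto)
  have "((\<lambda>u. f u / (u - 0) ^ Suc n) has_contour_integral
          (2 * pi * \<i>) / fact n * (deriv ^^ n) f 0) ?c"
    by (rule Cauchy_has_contour_integral_higher_derivative_circlepath)
       (use r hol in \<open>auto intro: holomorphic_on_imp_continuous_on holomorphic_on_subset\<close>)
  hence I: "((\<lambda>t. f (?c t) / ?c t ^ Suc n * vector_derivative ?c (at t)) has_integral
          (2 * pi * \<i>) / fact n * (deriv ^^ n) f 0) {0..1}"
    by (simp add: has_contour_integral)
  have J: "((\<lambda>t. 2 * pi / r ^ n * (A * (1 / (norm (1 - ?c t))\<^sup>2) + C)) has_integral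
          2 * pi / r ^ n * (A * (1 / (1 - r\<^sup>2)) + C * (1 - 0))) {0..1}"
    by (intro has_integral_mult_right has_integral_add has_integral_poisson_kernel r)
       (use has_integral_const_real[of C 0 1] in \<open>simp add: mult.commute\<close>)
  have "norm ((2 * pi * \<i>) / fact n * (deriv ^^ n) f 0) \<le> 2 * pi / r ^ n * (A * (1 / (1 - r\<^sup>2)) + C * (1 - 0))"
  proof (
      subst integral_unique[OF I, symmetric], subst integral_unique[OF J, symmetric], rule integral_norm_bound_integral)
    fix t :: real assume t: "t \<in> {0..1}"
    have nu: "norm (?c t) = r" using r by (simp add: circlepath norm_mult)
    have vd: "norm (vector_derivative ?c (at t)) = 2 * pi * r"
      using r by (simp add: vector_derivative_circlepath norm_mult)
    have "norm (f (?c t) / ?c t ^ Suc n * vector_derivative ?c (at t))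
        = norm (f (?c t)) / r ^ Suc n * (2 * pi * r)"
      by (simp only: norm_mult norm_divide norm_power nu vd)
    also have "\<dots> = 2 * pi / r ^ n * norm (f (?c t))" using r by (simp add: field_simps)
    also have "\<dots> \<le> 2 * pi / r ^ n * (A * (1 / (norm (1 - ?c t))\<^sup>2) + C)"
      using bnd[OF nu] r by (intro mult_left_mono) auto
    finally show "norm (f (?c t) / ?c t ^ Suc n * vector_derivative ?c (at t))
       \<le> 2 * pi / r ^ n * (A * (1 / (norm (1 - ?c t))\<^sup>2) + C)" .
  qed (use I J in blast)+
  hence "2 * pi * norm ((deriv ^^ n) f 0 / fact n) \<le> 2 * pi / r ^ n * (A / (1 - r\<^sup>2) + C)"
    by (simp add: norm_mult norm_divide)
  hence "2 * pi * norm ((deriv ^^ n) f 0 / fact n) \<le> 2 * pi * ((A / (1 - r\<^sup>2) + C) / r ^ n)"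
    by simp
  hence "norm ((deriv ^^ n) f 0 / fact n) \<le> (A / (1 - r\<^sup>2) + C) / r ^ n"
    by (rule mult_left_le_imp_le) simp
  thus ?thesis using r by (simp add: field_simps)
qed

text \<open>
  By Cauchy's inequality the second derivative is \<open>o(\<bar>1 - z\<bar>\<^bsup>-\<beta>-2\<^esup>)\<close> inside the disc. As \<open>\<beta> + 2 \<ge> 2\<close>, its mean
  over the circle of radius \<open>1 - 1 / n\<close> is controlled by the Poisson kernel, and no Hankel contour is needed.
\<close>
lemma slit_disc_coeff_littleo:
  assumes R: "1 < R" and g: "0 \<le> \<gamma>" "\<gamma> < pi / 2"
    and D: "D holomorphic_on slit_disc R \<gamma>" and b: "0 \<le> \<beta>"
    and lim: "((\<lambda>z. norm (1 - z) powr \<beta> * norm (D z)) \<longlongrightarrow> 0) (at 1 within slit_disc R \<gamma>)"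
  shows "(\<lambda>n. norm ((deriv ^^ n) D 0 / fact n) * real n powr (1 - \<beta>)) \<longlonglongrightarrow> 0"
proof -
  let ?S = "slit_disc R \<gamma>"
  define \<kappa> where "\<kappa> = cos \<gamma> / 3"
  have k: "0 < \<kappa>" "\<kappa> \<le> 1 / 3"
    using g by (auto simp: \<kappa>_def intro!: cos_gt_zero_pi)
  \<comment> \<open>The constant from Cauchy's inequality for the second derivative: 2 is
    \<open>fact 2\<close>, \<kappa>^2 comes from the squared radius, and the power of 1 - \<kappa>
    from the lower bound (1 - \<kappa>) |1 - z| for |1 - w|.\<close>
  define K where "K = 2 * (1 - \<kappa>) powr (-\<beta>) / \<kappa>\<^sup>2"
  have K: "K > 0" using k by (simp add: K_def)
  have opS: "open ?S" by (rule open_slit_disc[OF g])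
  have D2: "(deriv ^^ 2) D holomorphic_on ?S" by (rule holomorphic_higher_deriv[OF D opS])
  have ballS: "z \<in> ?S" if "norm z \<le> 1" "z \<noteq> 1" for z
    using closed_disc_subset_slit_disc[OF R g] that by auto
  have ball1: "ball 0 1 \<subseteq> ?S"
  proof
    fix z :: complex assume "z \<in> ball 0 1"
    thus "z \<in> ?S" by (intro ballS) auto
  qed
  have one: "1 \<notin> ?S" using g by (simp add: slit_disc_def Arg_zero)
  \<comment> \<open>\<open>C\<close> may depend on \<epsilon> but not on r or n: it bounds the
    second derivative away from 1, while \<epsilon> multiplies the only term that grows as r tends
    to 1.\<close>
  have main: "\<exists>C. \<forall>r n. 0 < r \<and> r < 1 \<longrightarrow>
      norm ((deriv ^^ n) ((deriv ^^ 2) D) 0 / fact n) * r ^ n \<le> \<epsilon> * K * (1 - r) powr (-\<beta> - 1) + C"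
    if eps: "\<epsilon> > 0" for \<epsilon>
  proof -
    have "eventually (\<lambda>z. norm (1 - z) powr \<beta> * norm (D z) < \<epsilon>) (at 1 within ?S)"
      by (rule order_tendstoD(2)[OF lim eps])
    then obtain \<delta> where "\<delta> > 0"
      "\<forall>z\<in>?S. z \<noteq> 1 \<and> dist z 1 < \<delta> \<longrightarrow> norm (1 - z) powr \<beta> * norm (D z) < \<epsilon>"
      by (auto simp: eventually_at)
    hence d: "\<delta> > 0"
      "\<And>z. z \<in> ?S \<Longrightarrow> norm (1 - z) < \<delta> \<Longrightarrow> norm (1 - z) powr \<beta> * norm (D z) < \<epsilon>"
      using one by (auto simp: dist_norm norm_minus_commute)
    \<comment> \<open>Half of \<delta> leaves room for the disc around z, whose points are within 2
      |1 - z| of 1; the bound R - 1 keeps that disc inside the circle of radius R.\<close>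
    define \<delta>' where "\<delta>' = min (\<delta> / 2) (R - 1)"
    have d': "\<delta>' > 0" "\<delta>' \<le> \<delta> / 2" "\<delta>' \<le> R - 1" using d(1) R by (auto simp: \<delta>'_def min_def)
    have near: "norm ((deriv ^^ 2) D z) \<le> \<epsilon> * K * norm (1 - z) powr (-\<beta>) / (norm (1 - z))\<^sup>2"
      if z: "norm z < 1" "norm (1 - z) < \<delta>'" for z
    proof -
      let ?s = "norm (1 - z)"
      have s: "?s > 0" using z(1) by auto
      have ks: "?s * \<kappa> \<le> ?s * 1" using k by (intro mult_left_mono) auto
      have sub: "cball z (\<kappa> * ?s) \<subseteq> ?S"
        by (rule cball_subset_slit_disc) (use g z k ks d' in \<open>auto simp: \<kappa>_def\<close>)
      have "norm ((deriv ^^ 2) D z) \<le> fact 2 * (\<epsilon> * ((1 - \<kappa>) * ?s) powr (-\<beta>)) / (\<kappa> * ?s) ^ 2"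
      proof (rule Cauchy_inequality)
        show "D holomorphic_on ball z (\<kappa> * ?s)"
          by (rule holomorphic_on_subset[OF D]) (use sub in auto)
        show "continuous_on (cball z (\<kappa> * ?s)) D"
          by (rule holomorphic_on_imp_continuous_on[OF holomorphic_on_subset[OF D sub]])
        show "0 < \<kappa> * ?s" using k s by simp
        fix w assume w: "norm (z - w) = \<kappa> * ?s"
        hence wS: "w \<in> ?S" using sub by (auto simp: dist_norm)
        have "norm (1 - w) \<le> ?s + \<kappa> * ?s" using norm_triangle_ineq[of "1 - z" "z - w"] w by simp
        also have "\<dots> < \<delta>" using ks z d' by (simp add: mult.commute)
        finally have w1: "norm (1 - w) < \<delta>" .
        have w2: "(1 - \<kappa>) * ?s \<le> norm (1 - w)"
          using norm_triangle_ineq4[of "1 - w" "z - w"] w by (simp add: algebra_simps)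
        have w3: "0 < (1 - \<kappa>) * ?s" using k s by simp
        have w4: "0 < norm (1 - w)" using w2 w3 by linarith
        have "norm (D w) = norm (1 - w) powr (-\<beta>) * (norm (1 - w) powr \<beta> * norm (D w))"
          using w4 by (simp add: powr_minus field_simps)
        also have "\<dots> \<le> norm (1 - w) powr (-\<beta>) * \<epsilon>"
          using d(2)[OF wS w1] by (intro mult_left_mono) auto
        also have "\<dots> \<le> ((1 - \<kappa>) * ?s) powr (-\<beta>) * \<epsilon>"
          using w2 w3 b eps by (intro mult_right_mono powr_mono2') auto
        finally show "norm (D w) \<le> \<epsilon> * ((1 - \<kappa>) * ?s) powr (-\<beta>)" by (simp add: mult.commute)
      qed
      also have "\<dots> = \<epsilon> * K * ?s powr (-\<beta>) / ?s\<^sup>2"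
        using k s by (simp add: K_def powr_mult power_mult_distrib)
      finally show ?thesis .
    qed
    have "compact (cball 0 1 - ball (1::complex) \<delta>')"
      by (intro compact_diff) auto
    moreover have "continuous_on (cball 0 1 - ball 1 \<delta>') ((deriv ^^ 2) D)"
    proof (rule continuous_on_subset[OF holomorphic_on_imp_continuous_on[OF D2]], rule subsetI)
      fix z :: complex assume z: "z \<in> cball 0 1 - ball 1 \<delta>'"
      have "z \<noteq> 1" using z d'(1) by auto
      thus "z \<in> ?S" using z by (intro ballS) auto
    qed
    ultimately have "bounded ((deriv ^^ 2) D ` (cball 0 1 - ball 1 \<delta>'))"
      by (intro compact_imp_bounded compact_continuous_image)
    then obtain C where C: "C > 0" "\<And>z. norm z \<le> 1 \<Longrightarrow> \<delta>' \<le> norm (1 - z) \<Longrightarrow> norm ((deriv ^^ 2) D z) \<le> C"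
      by (auto simp: bounded_pos dist_norm not_less)
    show ?thesis
    proof (intro exI allI impI)
      fix r :: real and n :: nat assume r: "0 < r \<and> r < 1"
      have "norm ((deriv ^^ n) ((deriv ^^ 2) D) 0 / fact n) * r ^ n \<le> (\<epsilon> * K * (1 - r) powr (-\<beta>)) / (1 - r\<^sup>2) + C"
      proof (rule taylor_coeff_bound)
        show "(deriv ^^ 2) D holomorphic_on ball 0 1"
          by (rule holomorphic_on_subset[OF D2 ball1])
        fix z :: complex assume z: "norm z = r"
        have rz: "1 - r \<le> norm (1 - z)" using norm_triangle_ineq2[of 1 z] z by simp
        show "norm ((deriv ^^ 2) D z) \<le> \<epsilon> * K * (1 - r) powr (-\<beta>) / (norm (1 - z))\<^sup>2 + C"
        proof (cases "norm (1 - z) < \<delta>'")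
          case True
          have "norm ((deriv ^^ 2) D z) \<le> \<epsilon> * K * norm (1 - z) powr (-\<beta>) / (norm (1 - z))\<^sup>2"
            using near True z r by auto
          also have "\<dots> \<le> \<epsilon> * K * (1 - r) powr (-\<beta>) / (norm (1 - z))\<^sup>2"
            using rz r b K eps by (intro divide_right_mono mult_left_mono powr_mono2') auto
          finally show ?thesis using C(1) by simp
        next
          case False
          have "0 \<le> \<epsilon> * K * (1 - r) powr (-\<beta>) / (norm (1 - z))\<^sup>2" using K eps by simp
          moreover have "norm ((deriv ^^ 2) D z) \<le> C" using C(2)[of z] False z r by auto
          ultimately show ?thesis by linarith
        qed
      qed (use r in auto)
      also have "(\<epsilon> * K * (1 - r) powr (-\<beta>)) / (1 - r\<^sup>2) \<le> (\<epsilon> * K * (1 - r) powr (-\<beta>)) / (1 - r)"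
      proof (rule divide_left_mono)
        have "r * r \<le> r * 1" using r by (intro mult_left_mono) auto
        moreover from this have "r * r < 1" using r by linarith
        ultimately show "1 - r \<le> 1 - r\<^sup>2" "0 < (1 - r\<^sup>2) * (1 - r)"
          using r by (auto simp: power2_eq_square intro!: mult_pos_pos)
        show "0 \<le> \<epsilon> * K * (1 - r) powr (-\<beta>)" using K eps by simp
      qed
      also have "\<dots> = \<epsilon> * K * (1 - r) powr (-\<beta> - 1)" using r by (simp add: powr_diff)
      finally show "norm ((deriv ^^ n) ((deriv ^^ 2) D) 0 / fact n) * r ^ n \<le> \<epsilon> * K * (1 - r) powr (-\<beta> - 1) + C"
        by simp
    qed
  qed
  show ?thesis
  proof (rule tendstoI)
    fix e :: real assume e: "e > 0"
    \<comment> \<open>A factor 8 is lost below: 2 in N (N - 1) \<ge> N^2 / 2 and 4 in (1 - 1 / N)^N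
      > 1 / 4. The choice leaves one half of e for the singular term and the other for C.\<close>
    define \<epsilon> where "\<epsilon> = e / (16 * K)"
    have eps: "\<epsilon> > 0" "8 * (\<epsilon> * K) = e / 2" using e K by (auto simp: \<epsilon>_def)
    obtain C where C: "\<And>r n. 0 < r \<Longrightarrow> r < 1 \<Longrightarrow>
      norm ((deriv ^^ n) ((deriv ^^ 2) D) 0 / fact n) * r ^ n \<le> \<epsilon> * K * (1 - r) powr (-\<beta> - 1) + C"
      using main[OF eps(1)] by blast
    have "(\<lambda>N. 8 * C * real N powr (-\<beta> - 1)) \<longlonglongrightarrow> 8 * C * 0"
      by (intro tendsto_intros tendsto_neg_powr filterlim_real_sequentially) (use b in auto)
    hence ev1: "eventually (\<lambda>N. 8 * C * real N powr (-\<beta> - 1) < e / 2) sequentially"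
      by (rule order_tendstoD(2)) (use e in simp)
    have "(\<lambda>N. (1 + (-1) / real N) ^ N) \<longlonglongrightarrow> exp (-1)"
      by (rule tendsto_exp_limit_sequentially)
    moreover have "1 / 4 < exp (- 1 :: real)"
      using exp_le by (simp add: exp_minus field_simps)
    ultimately have ev2: "eventually (\<lambda>N. 1 / 4 < (1 + (-1) / real N) ^ N) sequentially"
      by (rule order_tendstoD(1))
    show "eventually (\<lambda>n. dist (norm ((deriv ^^ n) D 0 / fact n) * real n powr (1 - \<beta>)) 0 < e) sequentially"
      using ev1 ev2 eventually_ge_at_top[of 2]
    proof eventually_elim
      case (elim N)
      define n where "n = N - 2"
      have N: "N = Suc (Suc n)" using elim by (simp add: n_def)
      define d where "d = norm ((deriv ^^ N) D 0 / fact N)"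
      define r where "r = 1 - 1 / real N"
      have r: "0 < r" "r < 1" using elim by (auto simp: r_def)
      have "real N * (real N / 2) \<le> real N * (real N - 1)" using elim by (intro mult_left_mono) auto
      hence N2: "(real N)\<^sup>2 / 2 \<le> real N * (real N - 1)" by (simp add: power2_eq_square)
      have dn: "norm ((deriv ^^ n) ((deriv ^^ 2) D) 0 / fact n) = real N * (real N - 1) * d"
      proof -
        have "(deriv ^^ n) ((deriv ^^ 2) D) = (deriv ^^ N) D"
          unfolding N by (simp add: numeral_2_eq_2 funpow_swap1)
        moreover have "fact N = real N * (real N - 1) * fact n" unfolding N by simp
        ultimately show ?thesis using elim by (simp add: d_def norm_divide del: fact_Suc)
      qed
      have d0: "d \<ge> 0" by (simp add: d_def)
      have "(real N)\<^sup>2 * d / 8 = (real N)\<^sup>2 / 2 * d * (1 / 4)" by simp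
      also have "\<dots> \<le> real N * (real N - 1) * d * r ^ N"
        using elim N2 d0 r by (intro mult_mono) (auto simp: r_def)
      also have "\<dots> \<le> real N * (real N - 1) * d * r ^ n"
        using r elim d0 by (intro mult_left_mono power_decreasing) (auto simp: N)
      also have "\<dots> \<le> \<epsilon> * K * (1 - r) powr (-\<beta> - 1) + C" using C[OF r, of n] unfolding dn .
      also have "(1 - r) powr (-\<beta> - 1) = real N powr (\<beta> + 1)"
        using elim by (simp add: r_def powr_divide powr_minus divide_simps powr_diff powr_add)
      finally have "(real N)\<^sup>2 * d \<le> 8 * (\<epsilon> * K * real N powr (\<beta> + 1) + C)" by simp
      hence "real N powr (-\<beta> - 1) * ((real N)\<^sup>2 * d) \<le> real N powr (-\<beta> - 1) * (8 * (\<epsilon> * K * real N powr (\<beta> + 1) + C))"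
        by (intro mult_left_mono) auto
      also have "real N powr (-\<beta> - 1) * ((real N)\<^sup>2 * d) = (real N powr (-\<beta> - 1) * real N powr 2) * d"
        using elim by (simp add: powr_numeral)
      also have "real N powr (-\<beta> - 1) * real N powr 2 = real N powr (1 - \<beta>)"
        by (subst powr_add[symmetric]) (rule arg_cong[where f = "(powr) (real N)"], simp)
      also have "real N powr (-\<beta> - 1) * (8 * (\<epsilon> * K * real N powr (\<beta> + 1) + C))
         = 8 * (\<epsilon> * K) * (real N powr (-\<beta> - 1) * real N powr (\<beta> + 1)) + 8 * C * real N powr (-\<beta> - 1)"
        by (simp add: algebra_simps)
      also have "real N powr (-\<beta> - 1) * real N powr (\<beta> + 1) = 1"
        by (subst powr_add[symmetric]) (use elim in simp)
      also have "8 * (\<epsilon> * K) * 1 + 8 * C * real N powr (-\<beta> - 1) < e" using elim eps(2) by linarith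
      finally have "real N powr (1 - \<beta>) * d < e" .
      thus ?case using d0 by (simp add: d_def mult.commute)
    qed
  qed
qed

section \<open>Logarithmic singularities and their exponentials\<close>

text \<open>Makes \<open>Ln (1 - z)\<close> holomorphic on the whole domain: a real 1 - z \<le> 0
  puts z on the axis of the wedge.\<close>

lemma slit_disc_not_nonpos:
  assumes "z \<in> slit_disc R \<gamma>" "0 \<le> \<gamma>"
  shows "1 - z \<notin> \<real>\<^sub>\<le>\<^sub>0"
proof
  assume "1 - z \<in> \<real>\<^sub>\<le>\<^sub>0"
  then obtain t where t: "1 - z = of_real t" "t \<le> 0" by (auto elim: nonpos_Reals_cases)
  have "z - 1 = of_real (-t)" using t(1) by (simp add: algebra_simps)
  hence "Arg (z - 1) = 0" using t(2) by (simp add: Arg_zero Arg_eq_0 complex_is_Real_iff del: of_real_minus)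
  thus False using assms by (simp add: slit_disc_def)
qed

section \<open>Taylor coefficients of the logarithm and of powers of 1 - z\<close>

lemma fps_nth_one_minus_X_mult_deriv:
  fixes F :: "'a::comm_ring_1 fps"
  shows "fps_nth ((1 - fps_X) * fps_deriv F) n = of_nat (Suc n) * fps_nth F (Suc n) - of_nat n * fps_nth F n"
  by (cases n) (simp_all add: algebra_simps)

text \<open>The differential equation (1 - z) f' = -1 forces n times coefficient n to be -1 for n >
  0. At n = 0 division by zero yields the correct coefficient 0.\<close>

lemma has_fps_expansion_Ln_one_minus:
  "(\<lambda>z. Ln (1 - z)) has_fps_expansion Abs_fps (\<lambda>n. - 1 / of_nat n)"
proof -
  let ?f = "\<lambda>z::complex. Ln (1 - z)"
  define L where "L = fps_expansion ?f 0"
  have ev1: "eventually (\<lambda>z::complex. z \<in> ball 0 1) (nhds 0)"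
    by (rule eventually_nhds_in_open) auto
  have "?f analytic_on {0}"
    by (intro analytic_intros) auto
  hence L: "?f has_fps_expansion L"
    unfolding L_def by (rule analytic_at_imp_has_fps_expansion_0)
  have "(\<lambda>z. (1 - z) * deriv ?f z) has_fps_expansion (1 - fps_X) * fps_deriv L"
    by (intro fps_expansion_intros L)
  moreover have "eventually (\<lambda>z. (1 - z) * deriv ?f z = -1) (nhds 0)"
    using ev1
  proof eventually_elim
    case (elim z)
    hence z: "norm z < 1" by simp
    have nn: "1 - z \<notin> \<real>\<^sub>\<le>\<^sub>0"
      using z complex_Re_le_cmod[of z] by (auto simp: complex_nonpos_Reals_iff)
    have "(?f has_field_derivative (-1 / (1 - z))) (at z)"
      using nn by (auto intro!: derivative_eq_intros simp: field_simps)
    from DERIV_imp_deriv[OF this] show ?case using z by auto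
  qed
  ultimately have "(\<lambda>z. - 1) has_fps_expansion (1 - fps_X) * fps_deriv L"
    by (rule iffD1[OF has_fps_expansion_cong[OF _ refl], rotated])
  hence eq: "(1 - fps_X) * fps_deriv L = - 1"
    by (intro fps_expansion_unique_complex[where f = "\<lambda>_. -1"]) (auto intro: fps_expansion_intros)
  have rec: "of_nat (Suc n) * fps_nth L (Suc n) - of_nat n * fps_nth L n = (if n = 0 then - 1 else 0)" for n
    using fps_nth_one_minus_X_mult_deriv[of L n] unfolding eq by (cases n) simp_all
  have "of_nat (Suc n) * fps_nth L (Suc n) = - 1" for n
  proof (induction n)
    case (Suc n)
    thus ?case using rec[of "Suc n"] by (simp add: eq_neg_iff_add_eq_0)
  qed (use rec[of 0] in simp)
  moreover have "fps_nth L 0 = 0"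
    using has_fps_expansion_imp_0_eq_fps_nth_0[OF L] by simp
  ultimately have "L = Abs_fps (\<lambda>n. - 1 / of_nat n)"
    by (intro fps_ext, case_tac n) (auto simp: field_simps simp del: of_nat_Suc)
  with L show ?thesis by simp
qed

text \<open>The binomial series, from (1 - z) f' = \<alpha> f, that is, from the recurrence (n + 1)
  c (n + 1) = (\<alpha> + n) c n with c 0 = 1.\<close>

lemma has_fps_expansion_one_minus_powr:
  fixes \<alpha> :: complex
  shows "(\<lambda>z. exp (- \<alpha> * Ln (1 - z))) has_fps_expansion Abs_fps (\<lambda>n. pochhammer \<alpha> n / fact n)"
proof -
  let ?f = "\<lambda>z::complex. exp (- \<alpha> * Ln (1 - z))"
  define L where "L = fps_expansion ?f 0"
  have ev1: "eventually (\<lambda>z::complex. z \<in> ball 0 1) (nhds 0)"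
    by (rule eventually_nhds_in_open) auto
  have "?f analytic_on {0}"
    by (intro analytic_intros) auto
  hence L: "?f has_fps_expansion L"
    unfolding L_def by (rule analytic_at_imp_has_fps_expansion_0)
  have "(\<lambda>z. (1 - z) * deriv ?f z) has_fps_expansion (1 - fps_X) * fps_deriv L"
    by (intro fps_expansion_intros L)
  moreover have "eventually (\<lambda>z. (1 - z) * deriv ?f z = \<alpha> * ?f z) (nhds 0)"
    using ev1
  proof eventually_elim
    case (elim z)
    hence z: "norm z < 1" by simp
    have nn: "1 - z \<notin> \<real>\<^sub>\<le>\<^sub>0"
      using z complex_Re_le_cmod[of z] by (auto simp: complex_nonpos_Reals_iff)
    have "(?f has_field_derivative (\<alpha> * ?f z / (1 - z))) (at z)"
      using nn by (auto intro!: derivative_eq_intros simp: field_simps)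
    from DERIV_imp_deriv[OF this] show ?case using z by auto
  qed
  ultimately have "(\<lambda>z. \<alpha> * ?f z) has_fps_expansion (1 - fps_X) * fps_deriv L"
    by (rule iffD1[OF has_fps_expansion_cong[OF _ refl], rotated])
  moreover have "(\<lambda>z. \<alpha> * ?f z) has_fps_expansion fps_const \<alpha> * L"
    by (intro fps_expansion_intros L)
  ultimately have eq: "(1 - fps_X) * fps_deriv L = fps_const \<alpha> * L"
    by (rule fps_expansion_unique_complex)
  have rec: "of_nat (Suc n) * fps_nth L (Suc n) = (\<alpha> + of_nat n) * fps_nth L n" for n
    using fps_nth_one_minus_X_mult_deriv[of L n] unfolding eq by (simp add: algebra_simps)
  have L0: "fps_nth L 0 = 1"
    using has_fps_expansion_imp_0_eq_fps_nth_0[OF L] by simp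
  have "fps_nth L n = pochhammer \<alpha> n / fact n" for n
  proof (induction n)
    case (Suc n)
    have "fps_nth L (Suc n) = (\<alpha> + of_nat n) * fps_nth L n / of_nat (Suc n)"
      using rec[of n] by (simp add: field_simps del: of_nat_Suc)
    thus ?case by (simp add: Suc pochhammer_Suc field_simps)
  qed (simp add: L0)
  hence "L = Abs_fps (\<lambda>n. pochhammer \<alpha> n / fact n)" by (intro fps_ext) simp
  with L show ?thesis by simp
qed

text \<open>Gauss's limit for the reciprocal Gamma function; the factor n / (\<alpha> + n) removes
  the last factor of its Pochhammer symbol of length n + 1.\<close>

lemma pochhammer_fact_asymp:
  fixes \<alpha> :: real
  assumes "\<alpha> > 0"
  shows "(\<lambda>n. pochhammer \<alpha> n / fact n * real n powr (1 - \<alpha>)) \<longlonglongrightarrow> rGamma \<alpha>"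
proof -
  have "(\<lambda>n. rGamma_series \<alpha> n * (real n / (\<alpha> + real n))) \<longlonglongrightarrow> rGamma \<alpha> * 1"
    by (intro tendsto_intros) real_asymp
  moreover have "eventually (\<lambda>n. rGamma_series \<alpha> n * (real n / (\<alpha> + real n))
      = pochhammer \<alpha> n / fact n * real n powr (1 - \<alpha>)) sequentially"
    using eventually_gt_at_top[of 0]
  proof eventually_elim
    case (elim n)
    have "\<alpha> + real n \<noteq> 0" using assms by (simp add: add_pos_nonneg pos_add_strict)
    moreover have "p * a / (f * e) * (k / a) = p / f * (k / e)" if "a \<noteq> 0" for p a f e k :: real
      using that by simp
    ultimately have "rGamma_series \<alpha> n * (real n / (\<alpha> + real n))
        = pochhammer \<alpha> n / fact n * (real n / exp (\<alpha> * ln (real n)))"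
      unfolding rGamma_series_def by (simp add: pochhammer_Suc)
    thus ?case using elim by (simp add: powr_diff powr_def[of _ \<alpha>])
  qed
  ultimately show ?thesis by (simp add: filterlim_cong)
qed

text \<open>Only the \<open>o(1)\<close> form of the expansion at \<open>1\<close> is needed.\<close>
lemma log_singularity_coeff:
  fixes g :: "complex \<Rightarrow> complex" and \<theta> lam :: real
  assumes R: "1 < R" and ga: "0 \<le> \<gamma>" "\<gamma> < pi / 2"
    and hol: "g holomorphic_on slit_disc R \<gamma>" and G: "g has_fps_expansion G"
    and lim: "((\<lambda>z. g z + of_real \<theta> * Ln (1 - z)) \<longlongrightarrow> of_real lam) (at 1 within slit_disc R \<gamma>)"
  shows "(\<lambda>n. of_nat n * fps_nth G n) \<longlonglongrightarrow> of_real \<theta>"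
proof -
  let ?E = "\<lambda>z. g z + of_real \<theta> * Ln (1 - z) - of_real lam"
  \<comment> \<open>Exponent \<beta> = 0: the coefficients of the remainder are o(1 / n), those of
    \<open>Ln (1 - z)\<close> are -1 / n, and \<open>lam\<close> enters coefficient 0 only.\<close>
  have "(\<lambda>n. norm ((deriv ^^ n) ?E 0 / fact n) * real n powr (1 - 0)) \<longlonglongrightarrow> 0"
  proof (rule slit_disc_coeff_littleo[OF R ga])
    show "?E holomorphic_on slit_disc R \<gamma>"
      by (intro holomorphic_intros hol) (use slit_disc_not_nonpos ga in auto)
    have "((\<lambda>z. norm (?E z)) \<longlongrightarrow> 0) (at 1 within slit_disc R \<gamma>)"
      using tendsto_norm[OF tendsto_diff[OF lim tendsto_const[of "of_real lam"]]] by simp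
    moreover have "eventually (\<lambda>z::complex. norm (?E z) = norm (1 - z) powr 0 * norm (?E z)) (at 1 within slit_disc R \<gamma>)"
      by (auto simp: eventually_at_filter)
    ultimately show "((\<lambda>z. norm (1 - z) powr 0 * norm (?E z)) \<longlongrightarrow> 0) (at 1 within slit_disc R \<gamma>)"
      by (rule Lim_transform_eventually)
  qed simp
  moreover have "?E has_fps_expansion G + fps_const (of_real \<theta>) * Abs_fps (\<lambda>n. - 1 / of_nat n) - fps_const (of_real lam)"
    by (intro fps_expansion_intros G has_fps_expansion_Ln_one_minus)
  note fps_nth_fps_expansion[OF this, symmetric]
  ultimately have *: "(\<lambda>n. norm (fps_nth (G + fps_const (of_real \<theta>) * Abs_fps (\<lambda>n. - 1 / of_nat n) - fps_const (of_real lam)) n)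
      * real n powr (1 - 0)) \<longlonglongrightarrow> 0" by (simp only:)
  have "(\<lambda>n. norm (of_nat n * fps_nth G n - of_real \<theta>)) \<longlonglongrightarrow> 0"
  proof (rule Lim_transform_eventually[OF *])
    show "eventually (\<lambda>n. norm (fps_nth (G + fps_const (of_real \<theta>) * Abs_fps (\<lambda>n. - 1 / of_nat n) - fps_const (of_real lam)) n)
      * real n powr (1 - 0) = norm (of_nat n * fps_nth G n - of_real \<theta>)) sequentially"
      using eventually_gt_at_top[of 0]
    proof eventually_elim
      case (elim n)
      have "of_nat n * fps_nth G n - of_real \<theta> = of_nat n * (fps_nth G n - of_real \<theta> / of_nat n)"
        using elim by (simp add: algebra_simps)
      thus ?case using elim by (simp add: norm_mult mult.commute)
    qed
  qed
  thus ?thesis by (simp add: tendsto_norm_zero_iff LIM_zero_iff)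
qed

text \<open>With E = o(1) the remainder of g, exp (\<phi> g) equals e^(\<phi> lam) (1 -
  z)^(-\<alpha>) exp (\<phi> E), so subtracting the pure power leaves o(|1 - z|^(-\<alpha>)). The
  transfer with \<beta> = \<alpha> makes the coefficients of this difference negligible against
  n^(\<alpha> - 1), the order of the binomial series.\<close>

lemma exp_log_singularity_coeff:
  fixes g :: "complex \<Rightarrow> complex" and \<theta> lam \<phi> :: real
  assumes R: "1 < R" and ga: "0 \<le> \<gamma>" "\<gamma> < pi / 2"
    and hol: "g holomorphic_on slit_disc R \<gamma>"
    and lim: "((\<lambda>z. g z + of_real \<theta> * Ln (1 - z)) \<longlongrightarrow> of_real lam) (at 1 within slit_disc R \<gamma>)"
    and pos: "0 < \<phi>" "0 < \<theta>"
    and P: "(\<lambda>z. exp (of_real \<phi> * g z)) has_fps_expansion P"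
  shows "(\<lambda>n. fps_nth P n * of_real (real n powr (1 - \<phi> * \<theta>))) \<longlonglongrightarrow> of_real (exp (\<phi> * lam) * rGamma (\<phi> * \<theta>))"
proof -
  define \<alpha> where "\<alpha> = \<phi> * \<theta>"
  have al: "\<alpha> > 0" using pos by (simp add: \<alpha>_def)
  define c where "c = exp (\<phi> * lam)"
  let ?S = "slit_disc R \<gamma>"
  let ?E = "\<lambda>z. g z + of_real \<theta> * Ln (1 - z) - of_real lam"
  let ?D = "\<lambda>z. exp (of_real \<phi> * g z) - of_real c * exp (- of_real \<alpha> * Ln (1 - z))"
  let ?h = "\<lambda>n. pochhammer \<alpha> n / fact n"
  have "(\<lambda>n. norm ((deriv ^^ n) ?D 0 / fact n) * real n powr (1 - \<alpha>)) \<longlonglongrightarrow> 0"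
  proof (rule slit_disc_coeff_littleo[OF R ga])
    show "?D holomorphic_on ?S"
      by (intro holomorphic_intros hol) (use slit_disc_not_nonpos ga in auto)
    have E0: "(?E \<longlongrightarrow> 0) (at 1 within ?S)"
      using tendsto_diff[OF lim tendsto_const[of "of_real lam"]] by simp
    have "((\<lambda>z. c * norm (exp (of_real \<phi> * ?E z) - 1)) \<longlongrightarrow> c * norm (exp (of_real \<phi> * 0) - 1 :: complex)) (at 1 within ?S)"
      by (intro tendsto_intros E0)
    hence "((\<lambda>z. c * norm (exp (of_real \<phi> * ?E z) - 1)) \<longlongrightarrow> 0) (at 1 within ?S)" by simp
    moreover have "eventually (\<lambda>z. c * norm (exp (of_real \<phi> * ?E z) - 1) = norm (1 - z) powr \<alpha> * norm (?D z)) (at 1 within ?S)"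
      unfolding eventually_at_filter
    proof (intro always_eventually allI impI)
      fix z :: complex assume z: "z \<noteq> 1"
      have e1: "exp (of_real \<phi> * g z) = of_real c * exp (- of_real \<alpha> * Ln (1 - z)) * exp (of_real \<phi> * ?E z)"
        unfolding c_def \<alpha>_def exp_of_real[symmetric] exp_add[symmetric] by (simp add: algebra_simps)
      have "?D z = of_real c * exp (- of_real \<alpha> * Ln (1 - z)) * (exp (of_real \<phi> * ?E z) - 1)"
        unfolding e1 by (simp add: algebra_simps)
      hence "norm (?D z) = c * norm (exp (- of_real \<alpha> * Ln (1 - z))) * norm (exp (of_real \<phi> * ?E z) - 1)"
        by (simp add: norm_mult c_def)
      also have "norm (exp (- of_real \<alpha> * Ln (1 - z))) = norm (1 - z) powr (-\<alpha>)"
        using z by (simp add: powr_def)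
      finally show "c * norm (exp (of_real \<phi> * ?E z) - 1) = norm (1 - z) powr \<alpha> * norm (?D z)"
        using z by (simp add: powr_minus field_simps)
    qed
    ultimately show "((\<lambda>z. norm (1 - z) powr \<alpha> * norm (?D z)) \<longlongrightarrow> 0) (at 1 within ?S)"
      by (rule Lim_transform_eventually)
  qed (use al in simp)
  moreover have "?D has_fps_expansion P - fps_const (of_real c) * Abs_fps (\<lambda>n. pochhammer (of_real \<alpha>) n / fact n)"
    by (intro fps_expansion_intros P has_fps_expansion_one_minus_powr)
  note fps_nth_fps_expansion[OF this, symmetric]
  ultimately have "(\<lambda>n. norm (fps_nth P n - of_real (c * ?h n)) * real n powr (1 - \<alpha>)) \<longlonglongrightarrow> 0"
    by (simp add: pochhammer_of_real)
  hence "(\<lambda>n. norm ((fps_nth P n - of_real (c * ?h n)) * of_real (real n powr (1 - \<alpha>)))) \<longlonglongrightarrow> 0"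
    by (simp add: norm_mult)
  hence 1: "(\<lambda>n. (fps_nth P n - of_real (c * ?h n)) * of_real (real n powr (1 - \<alpha>))) \<longlonglongrightarrow> 0"
    by (rule tendsto_norm_zero_cancel)
  have 2: "(\<lambda>n. of_real (c * (?h n * real n powr (1 - \<alpha>))) :: complex) \<longlonglongrightarrow> of_real (c * rGamma \<alpha>)"
    by (intro tendsto_intros pochhammer_fact_asymp al)
  show ?thesis
    using tendsto_add[OF 1 2] by (simp add: algebra_simps \<alpha>_def c_def)
qed

text \<open>Rescaling by \<rho> moves the vertex to 1 and keeps all angles there; the error O(1 /
  log^2) is relaxed to o(1).\<close>

lemma flajolet_soria_slit_disc:
  assumes "flajolet_soria F \<rho> \<theta> lam"
  obtains R \<gamma> g where "1 < R" "0 \<le> \<gamma>" "\<gamma> < pi / 2" "g holomorphic_on slit_disc R \<gamma>"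
    "g has_fps_expansion Abs_fps (\<lambda>n. fps_nth F n * of_real \<rho> ^ n)"
    "((\<lambda>z. g z + of_real \<theta> * Ln (1 - z)) \<longlongrightarrow> of_real lam) (at 1 within slit_disc R \<gamma>)"
proof -
  from assms have rho: "\<rho> > 0" and rad: "fps_conv_radius F = ereal \<rho>"
    and sing: "boundary_singularity F \<rho> (of_real \<rho>)"
    by (auto simp: flajolet_soria_def)
  from assms obtain \<Delta> G where D: "delta_domain \<rho> \<Delta>" and G: "G holomorphic_on \<Delta>"
    "\<And>z. z \<in> ball 0 \<rho> \<Longrightarrow> G z = eval_fps F z"
    and O: "(\<lambda>z. G z - (of_real \<theta> * Ln (1 / (1 - z / of_real \<rho>)) + of_real lam))
          \<in> O[at (of_real \<rho>) within \<Delta>](\<lambda>z. 1 / (Ln (1 - z / of_real \<rho>))\<^sup>2)"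
    unfolding flajolet_soria_def by blast
  from D obtain R0 where R0: "\<rho> < R0" and "\<Delta> = ball 0 R0 \<or>
     (\<exists>\<gamma>. 0 \<le> \<gamma> \<and> \<gamma> < pi / 2 \<and> \<Delta> = ball 0 R0 - {z. \<bar>Arg (z - of_real \<rho>)\<bar> \<le> \<gamma>})"
    by (auto simp: delta_domain_def)
  \<comment> \<open>On a full disc \<open>G\<close> would continue the series across \<rho>,
    contrary to FS 1.\<close>
  moreover have "\<Delta> \<noteq> ball 0 R0"
  proof
    assume "\<Delta> = ball 0 R0"
    moreover have "ball (of_real \<rho>) (R0 - \<rho>) \<subseteq> ball (0::complex) R0"
      using rho R0 by (subst ball_subset_ball_iff) (auto simp: dist_norm)
    ultimately have "G holomorphic_on ball (of_real \<rho>) (R0 - \<rho>)"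
      using G(1) holomorphic_on_subset by blast
    with G(2) R0 sing show False
      unfolding boundary_singularity_def by (metis IntD2 diff_gt_0_iff_gt)
  qed
  ultimately obtain \<gamma> where ga: "0 \<le> \<gamma>" "\<gamma> < pi / 2"
    and Delta: "\<Delta> = ball 0 R0 - {z. \<bar>Arg (z - of_real \<rho>)\<bar> \<le> \<gamma>}" by blast
  define R where "R = R0 / \<rho>"
  have R: "1 < R" using rho R0 by (simp add: R_def)
  define g where "g = (\<lambda>z. G (of_real \<rho> * z))"
  have mem: "of_real \<rho> * z \<in> \<Delta> \<longleftrightarrow> z \<in> slit_disc R \<gamma>" for z :: complex
  proof -
    have "of_real \<rho> * z - of_real \<rho> = of_real \<rho> * (z - 1)" by (simp add: algebra_simps)
    hence "Arg (of_real \<rho> * z - of_real \<rho>) = Arg (z - 1)" using rho by simp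
    thus ?thesis using rho by (simp add: Delta slit_disc_def R_def norm_mult field_simps)
  qed
  have hol: "g holomorphic_on slit_disc R \<gamma>"
    unfolding g_def
    by (rule holomorphic_on_compose_gen[OF _ G(1), of "\<lambda>z. of_real \<rho> * z", unfolded o_def])
       (auto intro!: holomorphic_intros simp: mem)
  have "(\<lambda>z. eval_fps F (of_real \<rho> * z)) has_fps_expansion Abs_fps (\<lambda>n. fps_nth F n * of_real \<rho> ^ n)"
  proof -
    have "fps_nth (fps_compose F (fps_const (of_real \<rho>) * fps_X)) n = fps_nth F n * of_real \<rho> ^ n" for n
      by (subst fps_compose_linear) (simp add: mult.commute)
    hence eq: "fps_compose F (fps_const (of_real \<rho>) * fps_X) = Abs_fps (\<lambda>n. fps_nth F n * of_real \<rho> ^ n)"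
      by (intro fps_ext) simp
    have "(eval_fps F \<circ> (\<lambda>z. of_real \<rho> * z)) has_fps_expansion fps_compose F (fps_const (of_real \<rho>) * fps_X)"
      by (intro has_fps_expansion_compose eval_fps_has_fps_expansion fps_expansion_intros) (auto simp: rad rho)
    thus ?thesis unfolding eq o_def .
  qed
  moreover have "eventually (\<lambda>z::complex. z \<in> ball 0 1) (nhds 0)"
    by (rule eventually_nhds_in_open) auto
  hence "eventually (\<lambda>z. eval_fps F (of_real \<rho> * z) = g z) (nhds 0)"
    by eventually_elim (use G(2) rho in \<open>auto simp: g_def norm_mult\<close>)
  ultimately have exp: "g has_fps_expansion Abs_fps (\<lambda>n. fps_nth F n * of_real \<rho> ^ n)"
    by (rule iffD1[OF has_fps_expansion_cong[OF _ refl], rotated])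
  obtain c where c: "eventually (\<lambda>z. norm (G z - (of_real \<theta> * Ln (1 / (1 - z / of_real \<rho>)) + of_real lam))
      \<le> c * norm (1 / (Ln (1 - z / of_real \<rho>))\<^sup>2)) (at (of_real \<rho>) within \<Delta>)"
    using O by (elim landau_o.bigE)
  have "((\<lambda>z. G z - (of_real \<theta> * Ln (1 / (1 - z / of_real \<rho>)) + of_real lam)) \<longlongrightarrow> 0) (at (of_real \<rho>) within \<Delta>)"
  proof (rule tendsto_norm_zero_cancel, rule Lim_null_comparison)
    \<comment> \<open>The modulus of \<open>Ln\<close> is at least that of its real part, so the
      error can be compared with the real function 1 / ln^2 at the modulus \<open>h\<close>, which
      tends to 0 from the right.\<close>
    define h where "h = (\<lambda>z::complex. norm (1 - z / of_real \<rho>))"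
    have h0: "filterlim h (at_right 0) (at (of_real \<rho>) within \<Delta>)"
      unfolding filterlim_at
    proof
      have "(h \<longlongrightarrow> norm (1 - of_real \<rho> / of_real \<rho> :: complex)) (at (of_real \<rho>) within \<Delta>)"
        unfolding h_def by (intro tendsto_intros) (use rho in auto)
      thus "(h \<longlongrightarrow> 0) (at (of_real \<rho>) within \<Delta>)" using rho by simp
      show "eventually (\<lambda>z. h z \<in> {0<..} \<and> h z \<noteq> 0) (at (of_real \<rho>) within \<Delta>)"
        unfolding eventually_at_filter using rho by (auto simp: h_def field_simps)
    qed
    have "((\<lambda>x::real. c * (1 / (ln x)\<^sup>2)) \<longlongrightarrow> 0) (at_right 0)"
      by real_asymp
    from filterlim_compose[OF this h0]
    show "((\<lambda>z. \<bar>c\<bar> * (1 / (ln (h z))\<^sup>2)) \<longlongrightarrow> 0) (at (of_real \<rho>) within \<Delta>)"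
      using tendsto_rabs_zero by (force simp: abs_mult)
    show "eventually (\<lambda>z. norm (norm (G z - (of_real \<theta> * Ln (1 / (1 - z / of_real \<rho>)) + of_real lam)))
        \<le> \<bar>c\<bar> * (1 / (ln (h z))\<^sup>2)) (at (of_real \<rho>) within \<Delta>)"
      \<comment> \<open>The ball of radius \<rho> / 2 forces \<open>h z\<close> < 1, so that ln (h
        z) is nonzero and its square may be inverted.\<close>
      using c eventually_at_ball'[of "\<rho> / 2" "of_real \<rho>" \<Delta>]
    proof (rule eventually_elim2, goal_cases)
      case (2 z)
      have "1 - z / of_real \<rho> = (of_real \<rho> - z) / of_real \<rho>"
        using rho by (simp add: field_simps)
      hence "h z = norm (of_real \<rho> - z) / \<rho>"
        using rho by (simp add: h_def norm_divide)
      hence hz: "0 < h z" "h z < 1"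
        using 2 rho by (auto simp: dist_norm norm_minus_commute)
      have "\<bar>ln (h z)\<bar> \<le> norm (Ln (1 - z / of_real \<rho>))"
        using abs_Re_le_cmod[of "Ln (1 - z / of_real \<rho>)"] hz by (simp add: h_def)
      hence "(ln (h z))\<^sup>2 \<le> (norm (Ln (1 - z / of_real \<rho>)))\<^sup>2"
        by (metis abs_ge_zero power2_abs power_mono)
      hence "1 / (norm (Ln (1 - z / of_real \<rho>)))\<^sup>2 \<le> 1 / (ln (h z))\<^sup>2"
        using hz by (intro divide_left_mono mult_pos_pos zero_less_power2[THEN iffD2]) auto
      hence "\<bar>c\<bar> * norm (1 / (Ln (1 - z / of_real \<rho>))\<^sup>2) \<le> \<bar>c\<bar> * (1 / (ln (h z))\<^sup>2)"
        by (intro mult_left_mono) (auto simp: norm_divide norm_power)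
      moreover have "c * norm (1 / (Ln (1 - z / of_real \<rho>))\<^sup>2) \<le> \<bar>c\<bar> * norm (1 / (Ln (1 - z / of_real \<rho>))\<^sup>2)"
        by (intro mult_right_mono) auto
      ultimately show ?case using 2 by simp
    qed (use rho in auto)
  qed
  moreover have "filterlim (\<lambda>z. of_real \<rho> * z) (at (of_real \<rho>) within \<Delta>) (at 1 within slit_disc R \<gamma>)"
    unfolding filterlim_at
  proof
    have "((\<lambda>z. of_real \<rho> * z) \<longlongrightarrow> of_real \<rho> * 1) (at (1::complex) within slit_disc R \<gamma>)"
      by (intro tendsto_intros)
    thus "((\<lambda>z. of_real \<rho> * z) \<longlongrightarrow> of_real \<rho>) (at (1::complex) within slit_disc R \<gamma>)" by simp
    show "eventually (\<lambda>z::complex. of_real \<rho> * z \<in> \<Delta> \<and> of_real \<rho> * z \<noteq> of_real \<rho>) (at 1 within slit_disc R \<gamma>)"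
      unfolding eventually_at_filter using rho by (auto simp: mem)
  qed
  ultimately have "((\<lambda>z. G (of_real \<rho> * z) - (of_real \<theta> * Ln (1 / (1 - (of_real \<rho> * z) / of_real \<rho>)) + of_real lam)) \<longlongrightarrow> 0)
     (at 1 within slit_disc R \<gamma>)"
    by (rule filterlim_compose)
  moreover have "eventually (\<lambda>z. G (of_real \<rho> * z) - (of_real \<theta> * Ln (1 / (1 - (of_real \<rho> * z) / of_real \<rho>)) + of_real lam)
      = g z + of_real \<theta> * Ln (1 - z) - of_real lam) (at 1 within slit_disc R \<gamma>)"
    unfolding eventually_at_filter
  proof (intro always_eventually allI impI)
    fix z assume "z \<in> slit_disc R \<gamma>"
    hence "1 - z \<notin> \<real>\<^sub>\<le>\<^sub>0" using ga by (intro slit_disc_not_nonpos)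
    hence "Ln (1 / (1 - z)) = - Ln (1 - z)" using Ln_inverse[of "1 - z"] by (simp add: inverse_eq_divide)
    thus "G (of_real \<rho> * z) - (of_real \<theta> * Ln (1 / (1 - (of_real \<rho> * z) / of_real \<rho>)) + of_real lam)
      = g z + of_real \<theta> * Ln (1 - z) - of_real lam"
      using rho by (simp add: g_def)
  qed
  ultimately have "((\<lambda>z. g z + of_real \<theta> * Ln (1 - z) - of_real lam) \<longlongrightarrow> 0) (at 1 within slit_disc R \<gamma>)"
    by (rule Lim_transform_eventually)
  hence "((\<lambda>z. g z + of_real \<theta> * Ln (1 - z)) \<longlongrightarrow> of_real lam) (at 1 within slit_disc R \<gamma>)"
    by (simp add: LIM_zero_iff)
  from that[OF R ga hol exp this] show thesis .
qed

text \<open>The sequences are abstract so that the combinatorial weights can be plugged in through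
  their recurrence. That recurrence is P' = \<phi> g' P for P = exp (\<phi> g), read
  coefficientwise, and \<open>q 0 = 1\<close> is its constant term because g 0 = 0; hence q is the
  coefficient sequence of P.\<close>

lemma tilted_coeff_asymp:
  assumes fs: "flajolet_soria (egf m) \<rho> \<theta> lam" and phi: "0 < \<phi>"
    and a: "\<And>i. a i = \<phi> * real (m i) * \<rho> ^ i / fact (i - 1)"
    and q0: "q 0 = 1" and rec: "\<And>n. real (Suc n) * q (Suc n) = (\<Sum>i\<le>n. a (Suc i) * q (n - i))"
  shows "a \<longlonglongrightarrow> \<phi> * \<theta>"
    and "(\<lambda>n. q n * real n powr (1 - \<phi> * \<theta>)) \<longlonglongrightarrow> exp (\<phi> * lam) * rGamma (\<phi> * \<theta>)"
proof -
  obtain R \<gamma> g where g: "1 < R" "0 \<le> \<gamma>" "\<gamma> < pi / 2" "g holomorphic_on slit_disc R \<gamma>"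
    "g has_fps_expansion Abs_fps (\<lambda>n. fps_nth (egf m) n * of_real \<rho> ^ n)"
    "((\<lambda>z. g z + of_real \<theta> * Ln (1 - z)) \<longlongrightarrow> of_real lam) (at 1 within slit_disc R \<gamma>)"
    using flajolet_soria_slit_disc[OF fs] by blast
  define G where "G = Abs_fps (\<lambda>n. fps_nth (egf m) n * of_real \<rho> ^ n :: complex)"
  note gG = g(5)[folded G_def]
  have theta: "\<theta> > 0" using fs by (simp add: flajolet_soria_def)
  \<comment> \<open>Index 0 is left out: \<open>a 0\<close> contains \<open>m 0\<close>, while
    \<open>egf\<close> has constant term 0.\<close>
  have aG: "of_real \<phi> * (of_nat n * fps_nth G n) = of_real (a n)" if "n > 0" for n
    using that by (cases n) (simp_all add: G_def egf_def a del: of_nat_Suc)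
  have "(\<lambda>n. of_real \<phi> * (of_nat n * fps_nth G n)) \<longlonglongrightarrow> of_real \<phi> * of_real \<theta>"
    by (intro tendsto_intros log_singularity_coeff[OF g(1-4) gG g(6)])
  moreover have "eventually (\<lambda>n. of_real \<phi> * (of_nat n * fps_nth G n) = of_real (a n)) sequentially"
    using eventually_gt_at_top[of 0] by eventually_elim (rule aG)
  ultimately have "(\<lambda>n. of_real (a n) :: complex) \<longlonglongrightarrow> of_real \<phi> * of_real \<theta>"
    by (rule Lim_transform_eventually)
  hence "(\<lambda>n. of_real (a n) :: complex) \<longlonglongrightarrow> of_real (\<phi> * \<theta>)" by simp
  thus "a \<longlonglongrightarrow> \<phi> * \<theta>" by (simp only: tendsto_of_real_iff)
  let ?F = "\<lambda>z. exp (of_real \<phi> * g z)"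
  define P where "P = fps_expansion ?F 0"
  have ana_g: "g analytic_on {0}" using gG by (rule has_fps_expansion_imp_analytic_0)
  hence P: "?F has_fps_expansion P"
    unfolding P_def by (intro analytic_at_imp_has_fps_expansion_0 analytic_intros)
  have "deriv ?F has_fps_expansion fps_deriv P" by (intro fps_expansion_intros P)
  moreover obtain S where S: "open S" "0 \<in> S" "g holomorphic_on S"
    using ana_g by (metis analytic_at)
  have "eventually (\<lambda>z. z \<in> S) (nhds 0)" using S by (intro eventually_nhds_in_open)
  hence "eventually (\<lambda>z. deriv ?F z = of_real \<phi> * deriv g z * ?F z) (nhds 0)"
  proof eventually_elim
    case (elim z)
    have "(g has_field_derivative deriv g z) (at z)"
      using S elim holomorphic_derivI by blast
    hence "(?F has_field_derivative of_real \<phi> * deriv g z * ?F z) (at z)"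
      by (auto intro!: derivative_eq_intros)
    thus ?case by (rule DERIV_imp_deriv)
  qed
  ultimately have "(\<lambda>z. of_real \<phi> * deriv g z * ?F z) has_fps_expansion fps_deriv P"
    by (rule iffD1[OF has_fps_expansion_cong[OF _ refl], rotated])
  moreover have "(\<lambda>z. of_real \<phi> * deriv g z * ?F z) has_fps_expansion fps_const (of_real \<phi>) * fps_deriv G * P"
    by (intro fps_expansion_intros P gG)
  ultimately have eq: "fps_deriv P = fps_const (of_real \<phi>) * fps_deriv G * P"
    by (rule fps_expansion_unique_complex)
  have Pq: "fps_nth P n = of_real (q n)" for n
  proof (induction n rule: less_induct)
    case (less n)
    show ?case
    proof (cases n)
      case 0
      have "g 0 = 0" using has_fps_expansion_imp_0_eq_fps_nth_0[OF gG] by (simp add: G_def egf_def)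
      thus ?thesis using has_fps_expansion_imp_0_eq_fps_nth_0[OF P] 0 q0 by simp
    next
      case (Suc k)
      have "of_nat (Suc k) * fps_nth P (Suc k) = fps_nth (fps_const (of_real \<phi>) * fps_deriv G * P) k"
        using eq by (metis Suc_eq_plus1 fps_deriv_nth)
      also have "\<dots> = (\<Sum>i\<le>k. of_real \<phi> * (of_nat (Suc i) * fps_nth G (Suc i)) * fps_nth P (k - i))"
        unfolding mult.assoc fps_mult_left_const_nth
        by (simp add: fps_mult_nth atLeast0AtMost sum_distrib_left mult.assoc)
      also have "\<dots> = (\<Sum>i\<le>k. of_real (a (Suc i)) * of_real (q (k - i)))"
        by (intro sum.cong refl) (subst aG, auto simp: less Suc)
      also have "\<dots> = of_real (\<Sum>i\<le>k. a (Suc i) * q (k - i))" by simp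
      also have "\<dots> = of_nat (Suc k) * of_real (q (Suc k))" by (simp flip: rec)
      finally show ?thesis unfolding Suc by (simp del: of_nat_Suc)
    qed
  qed
  have "(\<lambda>n. of_real (q n * real n powr (1 - \<phi> * \<theta>)) :: complex) \<longlonglongrightarrow> of_real (exp (\<phi> * lam) * rGamma (\<phi> * \<theta>))"
    using exp_log_singularity_coeff[OF g(1-4) g(6) phi theta P] by (simp add: Pq)
  thus "(\<lambda>n. q n * real n powr (1 - \<phi> * \<theta>)) \<longlonglongrightarrow> exp (\<phi> * lam) * rGamma (\<phi> * \<theta>)"
    by (simp only: tendsto_of_real_iff)
qed

section \<open>Weighted sums over set partitions\<close>

text \<open>A semiring is used because the same recursion serves real normalising constants and
  expectations in \<open>ennreal\<close>. The test function \<open>h\<close> sees only the multiset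
  of block sizes, which is all that the ranked sizes depend on.\<close>

definition partition_sum :: "(nat \<Rightarrow> 'b::comm_semiring_1) \<Rightarrow> 'a set \<Rightarrow> (nat multiset \<Rightarrow> 'b) \<Rightarrow> 'b" where
  "partition_sum c A h =
     (\<Sum>P\<in>{P. partition_on A P}. (\<Prod>B\<in>P. c (card B)) * h (image_mset card (mset_set P)))"

lemma partition_sum_empty: "partition_sum c {} h = h {#}"
  by (simp add: partition_sum_def partition_on_empty)

lemma partition_on_remove_block:
  assumes "partition_on A P" "B \<in> P"
  shows "partition_on (A - B) (P - {B})"
proof -
  have "\<Union>(P - {B}) = A - B"
    using assms by (auto simp: partition_on_def disjoint_def)
  thus ?thesis using assms by (auto simp: partition_on_def disjoint_def)
qed

lemma partition_on_add_block:
  assumes "partition_on (A - B) P" "B \<subseteq> A" "B \<noteq> {}"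
  shows "partition_on A (insert B P)" "B \<notin> P"
proof -
  show "B \<notin> P" using assms by (auto simp: partition_on_def)
  show "partition_on A (insert B P)"
    using assms by (auto simp: partition_on_def disjoint_def)
qed

text \<open>Classifies partitions by the block \<open>insert x C\<close> containing x. Its size is
  moved into the test function, so that the remaining sum has the same shape.\<close>

lemma partition_sum_insert:
  fixes c :: "nat \<Rightarrow> 'b::comm_semiring_1" and A :: "'a set"
  assumes fin: "finite A" and x: "x \<notin> A"
  shows "partition_sum c (insert x A) h =
    (\<Sum>C\<in>Pow A. c (Suc (card C)) * partition_sum c (A - C) (\<lambda>M. h (add_mset (Suc (card C)) M)))"
proof -
  let ?term = "\<lambda>P. (\<Prod>B\<in>P. c (card B)) * h (image_mset card (mset_set P))"
  let ?S = "SIGMA C:Pow A. {P. partition_on (A - C) P}"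
  have diff: "insert x A - insert x C = A - C" if "C \<subseteq> A" for C using x by auto
  have part: "partition_on (insert x A) (insert (insert x C) P)" "insert x C \<notin> P"
    if "C \<subseteq> A" "partition_on (A - C) P" for C P
    using partition_on_add_block[of "insert x A" "insert x C" P] that diff by auto
  have blk: "\<exists>!B. B \<in> P \<and> x \<in> B" if "partition_on (insert x A) P" for P
  proof -
    have "x \<in> \<Union>P" using that by (auto simp: partition_on_def)
    thus ?thesis using that by (auto simp: partition_on_def disjoint_def)
  qed
  have bij: "bij_betw (\<lambda>(C, P). insert (insert x C) P) ?S {P. partition_on (insert x A) P}"
    unfolding bij_betw_def
  proof
    show "inj_on (\<lambda>(C, P). insert (insert x C) P) ?S"
    proof (rule inj_onI, clarify)
      fix C P C' P'
      assume *: "C \<subseteq> A" "partition_on (A - C) P" "C' \<subseteq> A" "partition_on (A - C') P'"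
        "insert (insert x C) P = insert (insert x C') P'"
      have "insert x C = insert x C'"
        using blk[OF part(1)[OF *(1,2)]] *(5) by blast
      moreover have "x \<notin> C" "x \<notin> C'" using x * by auto
      ultimately have "C = C'" by (simp add: insert_ident)
      moreover from this have "P = P'"
        using part(2)[OF *(1,2)] part(2)[OF *(3,4)] *(5) by (simp add: insert_ident)
      ultimately show "C = C' \<and> P = P'" ..
    qed
    show "(\<lambda>(C, P). insert (insert x C) P) ` ?S = {P. partition_on (insert x A) P}"
    proof (rule antisym; rule subsetI)
      fix P assume "P \<in> (\<lambda>(C, P). insert (insert x C) P) ` ?S"
      thus "P \<in> {P. partition_on (insert x A) P}" by (auto intro: part(1))
    next
      fix P assume P: "P \<in> {P. partition_on (insert x A) P}"
      then obtain B where B: "B \<in> P" "x \<in> B" using blk by blast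
      have sub: "B \<subseteq> insert x A" using P B by (auto simp: partition_on_def)
      have "partition_on (insert x A - B) (P - {B})"
        using P B by (intro partition_on_remove_block) auto
      moreover have "insert x A - B = A - (B - {x})" using B x by auto
      ultimately have "(B - {x}, P - {B}) \<in> ?S" using sub by auto
      moreover have "insert (insert x (B - {x})) (P - {B}) = P"
        using insert_absorb[OF B(1)] insert_absorb[OF B(2)] by simp
      ultimately show "P \<in> (\<lambda>(C, P). insert (insert x C) P) ` ?S"
        by (intro image_eqI[where x = "(B - {x}, P - {B})"]) simp_all
    qed
  qed
  have "partition_sum c (insert x A) h = (\<Sum>(C, P)\<in>?S. ?term (insert (insert x C) P))"
    unfolding partition_sum_def by (subst sum.reindex_bij_betw[OF bij, symmetric]) (simp add: case_prod_unfold)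
  also have "\<dots> = (\<Sum>C\<in>Pow A. \<Sum>P\<in>{P. partition_on (A - C) P}. ?term (insert (insert x C) P))"
    using fin by (subst sum.Sigma) (auto intro!: finitely_many_partition_on)
  also have "\<dots> = (\<Sum>C\<in>Pow A. c (Suc (card C)) * partition_sum c (A - C) (\<lambda>M. h (add_mset (Suc (card C)) M)))"
  proof (rule sum.cong[OF refl])
    fix C assume C: "C \<in> Pow A"
    hence finC: "finite C" "x \<notin> C" using fin x by (auto intro: finite_subset)
    have "?term (insert (insert x C) P) = c (Suc (card C)) *
        ((\<Prod>B\<in>P. c (card B)) * h (add_mset (Suc (card C)) (image_mset card (mset_set P))))"
      if "partition_on (A - C) P" for P
    proof -
      have "finite P" using fin finite_elements[OF _ that] by auto
      thus ?thesis using part(2)[of C P] that C finC by (simp add: mult.assoc)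
    qed
    thus "(\<Sum>P\<in>{P. partition_on (A - C) P}. ?term (insert (insert x C) P))
       = c (Suc (card C)) * partition_sum c (A - C) (\<lambda>M. h (add_mset (Suc (card C)) M))"
      by (simp add: partition_sum_def sum_distrib_left)
  qed
  finally show ?thesis .
qed

lemma sum_Pow_card:
  fixes f :: "nat \<Rightarrow> 'b::comm_semiring_1"
  assumes "finite A"
  shows "(\<Sum>C\<in>Pow A. f (card C)) = (\<Sum>i\<le>card A. of_nat (card A choose i) * f i)"
proof -
  have "(\<Sum>C\<in>Pow A. f (card C)) = (\<Sum>i\<le>card A. \<Sum>C\<in>{C \<in> Pow A. card C = i}. f (card C))"
    using assms by (intro sum.group[symmetric]) (auto intro: card_mono)
  also have "\<dots> = (\<Sum>i\<le>card A. of_nat (card A choose i) * f i)"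
  proof (rule sum.cong[OF refl])
    fix i
    have "(\<Sum>C\<in>{C \<in> Pow A. card C = i}. f (card C)) = (\<Sum>C\<in>{C. C \<subseteq> A \<and> card C = i}. f i)"
      by (intro sum.cong) auto
    thus "(\<Sum>C\<in>{C \<in> Pow A. card C = i}. f (card C)) = of_nat (card A choose i) * f i"
      using n_subsets[OF assms, of i] by simp
  qed
  finally show ?thesis .
qed

text \<open>No bijection of ground sets is transported to partitions: after splitting off the block
  of one point on each side, the smaller sums agree by induction, and the sum over subsets depends
  on cardinalities alone.\<close>

lemma partition_sum_cong_card:
  fixes A A' :: "nat set"
  assumes "finite A" "finite A'" "card A = card A'"
  shows "partition_sum c A h = partition_sum c A' h"
  using assms
proof (induction "card A" arbitrary: A A' h rule: less_induct)
  case less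
  show ?case
  proof (cases "A = {}")
    case True
    hence "A' = {}" using less.prems by simp
    with True show ?thesis by (simp add: partition_sum_empty)
  next
    case False
    then obtain x A1 where A: "A = insert x A1" "x \<notin> A1" by (meson Set.set_insert all_not_in_conv)
    from False have "A' \<noteq> {}" using less.prems by auto
    then obtain y A2 where A': "A' = insert y A2" "y \<notin> A2" by (meson Set.set_insert all_not_in_conv)
    have fin: "finite A1" "finite A2" and card: "card A1 = card A2"
      using less.prems A A' by auto
    \<comment> \<open>The initial segment \<open>{..<card A1 - i}\<close> is the common
      representative of all ground sets of that size.\<close>
    define F where "F i = c (Suc i) * partition_sum c {..<card A1 - i} (\<lambda>M. h (add_mset (Suc i) M))" for i
    have *: "partition_sum c (insert z D) h = (\<Sum>C\<in>Pow D. F (card C))"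
      if D: "finite D" "z \<notin> D" "card D = card A1" for z :: nat and D
      unfolding partition_sum_insert[OF D(1,2)] F_def
    proof (intro sum.cong refl arg_cong2[where f = "(*)"])
      fix C assume "C \<in> Pow D"
      hence C: "C \<subseteq> D" "finite C" using D by (auto intro: finite_subset)
      hence cardC: "card (D - C) = card A1 - card C" using D by (simp add: card_Diff_subset)
      have "card (D - C) < card A" using cardC A fin by simp
      moreover have "finite (D - C)" using D by simp
      moreover have "card (D - C) = card {..<card A1 - card C}" using cardC by simp
      ultimately show "partition_sum c (D - C) (\<lambda>M. h (add_mset (Suc (card C)) M))
          = partition_sum c {..<card A1 - card C} (\<lambda>M. h (add_mset (Suc (card C)) M))"
        by (intro less.hyps) auto
    qed
    show ?thesis
      using *[OF fin(1) A(2)] *[OF fin(2) A'(2)] card fin by (simp add: A A' sum_Pow_card)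
  qed
qed

lemma partition_sum_Suc:
  fixes c :: "nat \<Rightarrow> 'b::comm_semiring_1"
  shows "partition_sum c {1..Suc n} h = (\<Sum>i\<le>n. of_nat (n choose i) *
           (c (Suc i) * partition_sum c {1..n - i} (\<lambda>M. h (add_mset (Suc i) M))))"
proof -
  have "{1..Suc n} = insert (Suc n) {1..n}" by auto
  hence "partition_sum c {1..Suc n} h = partition_sum c (insert (Suc n) {1..n}) h" by simp
  also have "\<dots> = (\<Sum>C\<in>Pow {1..n}. c (Suc (card C)) * partition_sum c ({1..n} - C) (\<lambda>M. h (add_mset (Suc (card C)) M)))"
    by (rule partition_sum_insert) auto
  also have "\<dots> = (\<Sum>C\<in>Pow {1..n}. c (Suc (card C)) * partition_sum c {1..n - card C} (\<lambda>M. h (add_mset (Suc (card C)) M)))"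
  proof (intro sum.cong refl arg_cong2[where f = "(*)"] partition_sum_cong_card)
    fix C assume "C \<in> Pow {1..n}"
    thus "card ({1..n} - C) = card {1..n - card C}"
      by (subst card_Diff_subset) (auto intro: finite_subset)
  qed auto
  also note sum_Pow_card[of "{1..n}" "\<lambda>i. c (Suc i) * partition_sum c {1..n - i} (\<lambda>M. h (add_mset (Suc i) M))",
      OF finite_atLeastAtMost]
  finally show ?thesis by simp
qed

text \<open>A partition P carries as many choices of structures as the product of
  \<open>m (card B)\<close>, so these choices and the factor \<phi> per block merge into one block
  weight.\<close>

lemma sum_assemblies:
  fixes \<phi> :: "'b::comm_semiring_1"
  shows "(\<Sum>a\<in>assemblies m n. \<phi> ^ num_components a * h (image_mset card (mset_set (fst a))))
    = partition_sum (\<lambda>i. \<phi> * of_nat (m i)) {1..n} h"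
proof -
  have fin: "finite P" if "partition_on {1..n} P" for P
    using finite_elements[OF _ that] by auto
  have "(\<Sum>a\<in>assemblies m n. \<phi> ^ num_components a * h (image_mset card (mset_set (fst a))))
     = (\<Sum>P\<in>{P. partition_on {1..n} P}. \<Sum>s\<in>(\<Pi>\<^sub>E B\<in>P. {..<m (card B)}). \<phi> ^ card P * h (image_mset card (mset_set P)))"
    unfolding assemblies_def num_components_def
    by (subst sum.Sigma) (auto intro!: finitely_many_partition_on finite_PiE fin simp: case_prod_unfold)
  also have "\<dots> = partition_sum (\<lambda>i. \<phi> * of_nat (m i)) {1..n} h"
    unfolding partition_sum_def
  proof (intro sum.cong refl)
    fix P assume "P \<in> {P. partition_on {1..n} P}"
    hence P: "finite P" using fin by auto
    show "(\<Sum>s\<in>(\<Pi>\<^sub>E B\<in>P. {..<m (card B)}). \<phi> ^ card P * h (image_mset card (mset_set P)))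
        = (\<Prod>B\<in>P. \<phi> * of_nat (m (card B))) * h (image_mset card (mset_set P))"
      using P by (simp add: card_PiE prod.distrib mult_ac)
  qed
  finally show ?thesis .
qed

section \<open>The chain of size-biased picks\<close>

abbreviation unif :: "real measure" where
  "unif \<equiv> uniform_measure lborel {0..1}"

definition shift :: "(nat \<Rightarrow> 'a) \<Rightarrow> nat \<Rightarrow> 'a" where
  "shift u i = u (Suc i)"

lemma shift_case_nat [simp]: "shift (case_nat s \<omega>) = \<omega>"
  by (simp add: shift_def fun_eq_iff)

definition tail_weight :: "(nat \<Rightarrow> nat \<Rightarrow> real) \<Rightarrow> nat \<Rightarrow> nat \<Rightarrow> real" where
  "tail_weight w n k = (\<Sum>i\<in>{k<..n}. w n i)"

text \<open>
  Quantile function of the size of the first pick: for uniform \<open>u\<close> the value \<open>i\<close> has probability \<open>w n i\<close>.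
  The alternative \<open>n \<le> k\<close> keeps the value in \<open>{1..n}\<close> for every real \<open>u\<close>.
\<close>
definition first_size :: "(nat \<Rightarrow> nat \<Rightarrow> real) \<Rightarrow> nat \<Rightarrow> real \<Rightarrow> nat" where
  "first_size w n u =
     (if n = 0 then 0 else LEAST k. 1 \<le> k \<and> (n \<le> k \<or> tail_weight w n k \<le> u))"

lemma first_size_0 [simp]: "first_size w 0 u = 0"
  by (simp add: first_size_def)

lemma first_size_bounds:
  assumes "n > 0"
  shows "1 \<le> first_size w n u" "first_size w n u \<le> n"
proof -
  let ?P = "\<lambda>k. 1 \<le> k \<and> (n \<le> k \<or> tail_weight w n k \<le> u)"
  have "?P n" using assms by simp
  from LeastI[of ?P, OF this] Least_le[of ?P, OF this]
  show "1 \<le> first_size w n u" "first_size w n u \<le> n" using assms by (auto simp: first_size_def)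
qed

lemma first_size_le: "first_size w n u \<le> n"
  using first_size_bounds(2)[of n w u] by (cases "n = 0") auto

text \<open>The recursion strips the first pick, not the last, so that what follows one step is
  again a chain, with fewer points and shifted uniforms. Once no points are left, all further values
  are 0.\<close>

primrec chain :: "(nat \<Rightarrow> nat \<Rightarrow> real) \<Rightarrow> nat \<Rightarrow> (nat \<Rightarrow> real) \<Rightarrow> nat \<Rightarrow> nat" where
  "chain w n u 0 = first_size w n (u 0)"
| "chain w n u (Suc i) = chain w (n - first_size w n (u 0)) (shift u) i"

function chain_mset :: "(nat \<Rightarrow> nat \<Rightarrow> real) \<Rightarrow> nat \<Rightarrow> (nat \<Rightarrow> real) \<Rightarrow> nat multiset" where
  "chain_mset w n u = (if n = 0 then {#} else
     add_mset (first_size w n (u 0)) (chain_mset w (n - first_size w n (u 0)) (shift u)))"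
  by pat_completeness auto
termination
proof (relation "Wellfounded.measure (\<lambda>(w, n, u). n)", goal_cases)
  case (2 w n u)
  thus ?case using first_size_bounds(1)[of n w "u 0"] by auto
qed auto

declare chain_mset.simps [simp del]

lemma chain_0 [simp]: "chain w 0 u i = 0"
  by (induction i arbitrary: u) simp_all

lemma sum_chain_le: "(\<Sum>i\<le>r. chain w n u i) \<le> n"
proof (induction r arbitrary: n u)
  case (Suc r)
  have "(\<Sum>i\<le>Suc r. chain w n u i) = first_size w n (u 0) + (\<Sum>i\<le>r. chain w (n - first_size w n (u 0)) (shift u) i)"
    by (subst sum.atMost_Suc_shift) simp
  also have "\<dots> \<le> first_size w n (u 0) + (n - first_size w n (u 0))"
    by (intro add_left_mono Suc.IH)
  also have "\<dots> = n" using first_size_le[of w n "u 0"] by simp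
  finally show ?case .
qed (simp add: first_size_le)

text \<open>The zeros after exhaustion fail P, so the indices where P holds match the elements of
  the multiset. This turns statements on the multiset into counts over the sequence of
  picks.\<close>

lemma size_filter_chain_mset:
  assumes "\<not> P 0"
  shows "finite {i. P (chain w n u i)}"
    and "size (filter_mset P (chain_mset w n u)) = card {i. P (chain w n u i)}"
proof -
  have "finite {i. P (chain w n u i)} \<and> size (filter_mset P (chain_mset w n u)) = card {i. P (chain w n u i)}"
  proof (induction n arbitrary: u rule: less_induct)
    case (less n)
    show ?case
    proof (cases "n = 0")
      case True
      thus ?thesis using assms by (simp add: chain_mset.simps)
    next
      case False
      let ?b = "first_size w n (u 0)"
      let ?A = "{i. P (chain w (n - ?b) (shift u) i)}"
      have "n - ?b < n" using False first_size_bounds(1)[of n w "u 0"] by auto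
      from less[OF this, of "shift u"]
      have IH: "finite ?A" "size (filter_mset P (chain_mset w (n - ?b) (shift u))) = card ?A" by auto
      have eq: "{i. P (chain w n u i)} = (if P ?b then {0} else {}) \<union> Suc ` ?A"
      proof (rule set_eqI)
        fix i show "i \<in> {i. P (chain w n u i)} \<longleftrightarrow> i \<in> (if P ?b then {0} else {}) \<union> Suc ` ?A"
          by (cases i) auto
      qed
      have "chain_mset w n u = add_mset ?b (chain_mset w (n - ?b) (shift u))"
        using False by (simp add: chain_mset.simps[of w n u])
      moreover have "card (Suc ` ?A) = card ?A" by (intro card_image) auto
      ultimately show ?thesis unfolding eq using IH by (auto simp: card_insert_if)
    qed
  qed
  thus "finite {i. P (chain w n u i)}"
    "size (filter_mset P (chain_mset w n u)) = card {i. P (chain w n u i)}" by auto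
qed

lemma tail_weight_antimono:
  assumes "\<And>i. 0 \<le> w n i" "k \<le> l"
  shows "tail_weight w n l \<le> tail_weight w n k"
  unfolding tail_weight_def using assms by (intro sum_mono2) auto

lemma first_size_le_iff:
  assumes w: "\<And>i. 0 \<le> w n i" and n: "n > 0"
  shows "first_size w n u \<le> k \<longleftrightarrow> 1 \<le> k \<and> (n \<le> k \<or> tail_weight w n k \<le> u)"
proof
  let ?P = "\<lambda>k. 1 \<le> k \<and> (n \<le> k \<or> tail_weight w n k \<le> u)"
  have fs: "first_size w n u = (LEAST k. ?P k)" using n by (simp add: first_size_def)
  {
    assume "first_size w n u \<le> k"
    moreover have "?P (first_size w n u)"
      unfolding fs by (rule LeastI[of ?P n]) (use n in simp)
    ultimately show "?P k" using tail_weight_antimono[of w n, OF w] by (meson order_trans)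
  next
    assume "?P k"
    thus "first_size w n u \<le> k" unfolding fs by (rule Least_le)
  }
qed

lemma first_size_measurable: "first_size w n \<in> borel \<rightarrow>\<^sub>M count_space UNIV"
proof (cases "n = 0")
  case False
  hence "first_size w n = (\<lambda>u. LEAST k. 1 \<le> k \<and> (n \<le> k \<or> tail_weight w n k \<le> u))"
    by (simp add: first_size_def fun_eq_iff)
  thus ?thesis by simp
next
  case True
  thus ?thesis by (simp add: first_size_def[abs_def])
qed

lemma prob_space_unif: "prob_space unif"
  by (rule prob_space_uniform_measure) auto

text \<open>Within [0, 1] and up to the null point u = 1, the value i is taken exactly on [t i, t (i
  - 1)), where t is the tail weight, and this interval has length w n i.\<close>

lemma nn_integral_first_size:
  fixes h :: "nat \<Rightarrow> ennreal"
  assumes w: "\<And>i. 0 \<le> w n i" and n: "n > 0" and sum: "(\<Sum>i=1..n. w n i) = 1"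
  shows "(\<integral>\<^sup>+u. h (first_size w n u) \<partial>unif) = (\<Sum>i=1..n. ennreal (w n i) * h i)"
proof -
  let ?t = "tail_weight w n"
  have t0: "?t 0 = 1" using sum by (simp add: tail_weight_def atLeastSucAtMost_greaterThanAtMost)
  have tn: "?t k = 0" if "k \<ge> n" for k using that by (simp add: tail_weight_def)
  note [measurable] = first_size_measurable[of w n]
  have set: "{u. first_size w n u = i} \<in> sets borel" for i
    using measurable_sets[OF first_size_measurable[of w n], of "{i}"] by (simp add: vimage_def)
  have em: "emeasure unif {u. first_size w n u = i} = ennreal (w n i)" if i: "i \<in> {1..n}" for i
  proof -
    \<comment> \<open>Needs u < 1 for k = 0, where the tail is 1, and u \<ge> 0 for k \<ge> n, where
      it is 0.\<close>
    have le: "first_size w n u \<le> k \<longleftrightarrow> ?t k \<le> u" if "0 \<le> u" "u < 1" for u k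
      using first_size_le_iff[of w n u k, OF w n] that tn[of k] t0
      by (cases "n \<le> k"; cases "k = 0") (use n in auto)
    have tt: "?t (i - 1) = ?t i + w n i"
    proof -
      have "{i - 1<..n} = insert i {i<..n}" using i by auto
      thus ?thesis by (simp add: tail_weight_def)
    qed
    have t1: "?t (i - 1) \<le> 1" using tail_weight_antimono[of w n 0 "i - 1", OF w] t0 by simp
    have t2: "0 \<le> ?t i" using w by (simp add: tail_weight_def sum_nonneg)
    have "emeasure unif {u. first_size w n u = i} = emeasure lborel ({0..1} \<inter> {u. first_size w n u = i})"
      using set by (subst emeasure_uniform_measure) (auto simp: divide_ennreal_def)
    also have "\<dots> = emeasure lborel {?t i..<?t (i - 1)}"
    proof (rule emeasure_eq_AE)
      have "AE u in lborel. u \<noteq> (1::real)" by (rule AE_lborel_singleton)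
      thus "AE u in lborel. u \<in> {0..1} \<inter> {u. first_size w n u = i} \<longleftrightarrow> u \<in> {?t i..<?t (i - 1)}"
      proof eventually_elim
        case (elim u)
        show ?case
        proof (cases "0 \<le> u \<and> u < 1")
          case True
          have "first_size w n u = i \<longleftrightarrow> first_size w n u \<le> i \<and> \<not> first_size w n u \<le> i - 1"
            using i by auto
          thus ?thesis using True le[of u i] le[of u "i - 1"] by auto
        next
          case False
          thus ?thesis using elim t1 t2 by auto
        qed
      qed
    qed (use set in auto)
    also have "\<dots> = ennreal (w n i)" using tt w[of i] by simp
    finally show ?thesis .
  qed
  have "(\<integral>\<^sup>+u. h (first_size w n u) \<partial>unif)
      = (\<integral>\<^sup>+u. (\<Sum>i=1..n. h i * indicator {u. first_size w n u = i} u) \<partial>unif)"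
  proof (intro nn_integral_cong)
    fix u
    have "(\<Sum>i=1..n. h i * indicator {u. first_size w n u = i} u) = (\<Sum>i=1..n. if i = first_size w n u then h i else 0)"
      by (intro sum.cong) (auto simp: indicator_def)
    also have "\<dots> = h (first_size w n u)"
      using first_size_bounds[OF n, of w u] by (subst sum.delta) auto
    finally show "h (first_size w n u) = (\<Sum>i=1..n. h i * indicator {u. first_size w n u = i} u)" by simp
  qed
  also have "\<dots> = (\<Sum>i=1..n. \<integral>\<^sup>+u. h i * indicator {u. first_size w n u = i} u \<partial>unif)"
    using set by (intro nn_integral_sum) auto
  also have "\<dots> = (\<Sum>i=1..n. ennreal (w n i) * h i)"
  proof (rule sum.cong[OF refl])
    fix i assume i: "i \<in> {1..n}"
    have "(\<integral>\<^sup>+u. h i * indicator {u. first_size w n u = i} u \<partial>unif) = h i * emeasure unif {u. first_size w n u = i}"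
      by (rule nn_integral_cmult_indicator) (simp add: set)
    thus "(\<integral>\<^sup>+u. h i * indicator {u. first_size w n u = i} u \<partial>unif) = ennreal (w n i) * h i"
      unfolding em[OF i] by (simp add: mult.commute)
  qed
  finally show ?thesis .
qed

section \<open>Measurability and law of the chain\<close>

lemma shift_measurable [measurable]:
  "shift \<in> (\<Pi>\<^sub>M i\<in>UNIV. borel :: real measure) \<rightarrow>\<^sub>M (\<Pi>\<^sub>M i\<in>UNIV. borel)"
proof (rule measurable_PiM_single')
  show "(\<lambda>u. shift u i) \<in> (\<Pi>\<^sub>M i\<in>UNIV. borel) \<rightarrow>\<^sub>M borel" for i
    unfolding shift_def by (rule measurable_component_singleton) simp
qed auto

lemma chain_mset_measurable:
  "chain_mset w n \<in> (\<Pi>\<^sub>M i\<in>UNIV. borel) \<rightarrow>\<^sub>M count_space UNIV"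
proof (induction n rule: less_induct)
  case (less n)
  let ?M = "\<Pi>\<^sub>M i\<in>(UNIV::nat set). (borel :: real measure)"
  show ?case
  proof (cases "n = 0")
    case True
    thus ?thesis by (simp add: chain_mset.simps[abs_def])
  next
    case False
    \<comment> \<open>The value at i = 0 is a dummy: n - 0 is not below n, so the induction
      hypothesis is silent there, and the first pick is never 0 when n > 0.\<close>
    define f where "f i u = (if i = 0 then {#} else add_mset i (chain_mset w (n - i) (shift u)))" for i u
    have "f i \<in> ?M \<rightarrow>\<^sub>M count_space UNIV" for i
    proof (cases "i = 0")
      case i: False
      have "chain_mset w (n - i) \<in> ?M \<rightarrow>\<^sub>M count_space UNIV"
        using less[of "n - i"] i False by auto
      from measurable_compose[OF shift_measurable this]
      have "(\<lambda>u. chain_mset w (n - i) (shift u)) \<in> ?M \<rightarrow>\<^sub>M count_space UNIV" .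
      from measurable_compose[OF this, of "add_mset i" "count_space UNIV"]
      show ?thesis using i by (simp add: f_def[abs_def])
    qed (simp add: f_def[abs_def])
    moreover have "(\<lambda>u. first_size w n (u 0)) \<in> ?M \<rightarrow>\<^sub>M count_space UNIV"
      by (rule measurable_compose[OF measurable_component_singleton[of 0 UNIV "\<lambda>_. borel"] first_size_measurable]) simp
    ultimately have "(\<lambda>u. f (first_size w n (u 0)) u) \<in> ?M \<rightarrow>\<^sub>M count_space UNIV"
      by (rule measurable_compose_countable)
    moreover have "first_size w n s \<noteq> 0" for s
      using first_size_bounds(1)[of n w s] False by auto
    hence "chain_mset w n = (\<lambda>u. f (first_size w n (u 0)) u)"
      using False by (simp add: chain_mset.simps[of w n] f_def fun_eq_iff)
    ultimately show ?thesis by simp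
  qed
qed

text \<open>An i.i.d. sequence is one variable followed by an independent copy of the sequence; this
  is the one-step analysis of the chain.\<close>

lemma nn_integral_iid_uniform_case_nat:
  assumes f: "f \<in> borel_measurable (\<Pi>\<^sub>M i\<in>(UNIV::nat set). (borel :: real measure))"
  shows "(\<integral>\<^sup>+u. f u \<partial>iid_uniform) = (\<integral>\<^sup>+s. \<integral>\<^sup>+\<omega>. f (case_nat s \<omega>) \<partial>iid_uniform \<partial>unif)"
proof -
  interpret U: prob_space unif by (rule prob_space_unif)
  interpret S: sequence_space unif ..
  have S: "S.S = iid_uniform" by (simp add: iid_uniform_def)
  interpret I: prob_space iid_uniform by (rule prob_space_iid_uniform)
  have f': "f \<in> borel_measurable iid_uniform"
    using f by (simp cong: measurable_cong_sets add: sets_iid_uniform)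
  have m: "(\<lambda>(s, \<omega>). case_nat s \<omega>) \<in> unif \<Otimes>\<^sub>M iid_uniform \<rightarrow>\<^sub>M iid_uniform"
    unfolding S[symmetric] by measurable
  have "(\<integral>\<^sup>+u. f u \<partial>iid_uniform) = (\<integral>\<^sup>+u. f u \<partial>distr (unif \<Otimes>\<^sub>M iid_uniform) iid_uniform (\<lambda>(s, \<omega>). case_nat s \<omega>))"
    using S.PiM_iter unfolding S by simp
  also have "\<dots> = (\<integral>\<^sup>+x. f (case x of (s, \<omega>) \<Rightarrow> case_nat s \<omega>) \<partial>(unif \<Otimes>\<^sub>M iid_uniform))"
    by (rule nn_integral_distr[OF m]) (use f' in simp)
  also have "\<dots> = (\<integral>\<^sup>+s. \<integral>\<^sup>+\<omega>. f (case_nat s \<omega>) \<partial>iid_uniform \<partial>unif)"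
    by (subst I.nn_integral_fst[symmetric]) (use measurable_compose[OF m f'] in auto)
  finally show ?thesis .
qed

text \<open>A one-step recursion over all test functions determines the law. \<open>L\<close> is
  abstract here and becomes the expectation over tilted assemblies; h is generalised in the
  induction because each pick is absorbed into it.\<close>

lemma nn_integral_chain_mset:
  fixes L :: "nat \<Rightarrow> (nat multiset \<Rightarrow> ennreal) \<Rightarrow> ennreal"
  assumes w: "\<And>n i. 0 \<le> w n i" and sum: "\<And>n. n > 0 \<Longrightarrow> (\<Sum>i=1..n. w n i) = 1"
    and L0: "\<And>h. L 0 h = h {#}"
    and L: "\<And>n h. n > 0 \<Longrightarrow> L n h = (\<Sum>i=1..n. ennreal (w n i) * L (n - i) (\<lambda>M. h (add_mset i M)))"
  shows "(\<integral>\<^sup>+u. h (chain_mset w n u) \<partial>iid_uniform) = L n h"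
proof (induction n arbitrary: h rule: less_induct)
  case (less n)
  interpret I: prob_space iid_uniform by (rule prob_space_iid_uniform)
  show ?case
  proof (cases "n = 0")
    case True
    thus ?thesis by (simp add: chain_mset.simps[of w 0] L0 I.emeasure_space_1)
  next
    case False
    have "(\<integral>\<^sup>+u. h (chain_mset w n u) \<partial>iid_uniform)
        = (\<integral>\<^sup>+s. \<integral>\<^sup>+\<omega>. h (chain_mset w n (case_nat s \<omega>)) \<partial>iid_uniform \<partial>unif)"
      by (rule nn_integral_iid_uniform_case_nat) (rule measurable_compose[OF chain_mset_measurable], simp)
    also have "\<dots> = (\<integral>\<^sup>+s. L (n - first_size w n s) (\<lambda>M. h (add_mset (first_size w n s) M)) \<partial>unif)"
    proof (rule nn_integral_cong)
      fix s
      have "n - first_size w n s < n" using False first_size_bounds(1)[of n w s] by auto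
      from less[OF this, of "\<lambda>M. h (add_mset (first_size w n s) M)"]
      show "(\<integral>\<^sup>+\<omega>. h (chain_mset w n (case_nat s \<omega>)) \<partial>iid_uniform)
          = L (n - first_size w n s) (\<lambda>M. h (add_mset (first_size w n s) M))"
        using False by (simp add: chain_mset.simps[of w n])
    qed
    also have "\<dots> = (\<Sum>i=1..n. ennreal (w n i) * L (n - i) (\<lambda>M. h (add_mset i M)))"
      using False by (intro nn_integral_first_size[where h = "\<lambda>i. L (n - i) (\<lambda>M. h (add_mset i M))"] w sum) auto
    also have "\<dots> = L n h" using L[of n h] False by simp
    finally show ?thesis .
  qed
qed

section \<open>Convergence of the chain to stick breaking\<close>

text \<open>The first N0 terms contribute a fixed amount, which the diverging total weight washes
  out; the later ones are within e / 2 of the limit.\<close>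

lemma weighted_cesaro:
  fixes b x :: "nat \<Rightarrow> real"
  assumes b: "\<And>l. 0 < b l" and B: "filterlim (\<lambda>N. \<Sum>l<N. b l) at_top sequentially" and x: "x \<longlonglongrightarrow> L"
  shows "(\<lambda>N. (\<Sum>l<N. b l * x l) / (\<Sum>l<N. b l)) \<longlonglongrightarrow> L"
proof (rule LIMSEQ_I)
  fix e :: real assume e: "e > 0"
  let ?B = "\<lambda>N. \<Sum>l<N. b l"
  from LIMSEQ_D[OF x, of "e / 2"] e obtain N0 where N0: "\<And>l. l \<ge> N0 \<Longrightarrow> \<bar>x l - L\<bar> < e / 2" by auto
  define K where "K = (\<Sum>l<N0. b l * \<bar>x l - L\<bar>)"
  have "(\<lambda>N. K / ?B N) \<longlonglongrightarrow> 0"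
    by (rule real_tendsto_divide_at_top[OF tendsto_const B])
  from order_tendstoD(2)[OF this, of "e / 2"] e have ev: "eventually (\<lambda>N. K / ?B N < e / 2) sequentially" by simp
  have "eventually (\<lambda>N. norm ((\<Sum>l<N. b l * x l) / ?B N - L) < e) sequentially"
    using ev eventually_gt_at_top[of N0]
  proof eventually_elim
    case (elim N)
    have BN: "?B N > 0" using elim b by (intro sum_pos) (auto simp: lessThan_empty_iff)
    have "\<bar>\<Sum>l<N. b l * (x l - L)\<bar> \<le> (\<Sum>l<N. \<bar>b l * (x l - L)\<bar>)" by (rule sum_abs)
    also have "\<dots> = (\<Sum>l<N. b l * \<bar>x l - L\<bar>)" using b by (simp add: abs_mult less_imp_le)
    also have "\<dots> = K + (\<Sum>l=N0..<N. b l * \<bar>x l - L\<bar>)"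
      using sum.atLeastLessThan_concat[of 0 N0 N "\<lambda>l. b l * \<bar>x l - L\<bar>"] elim
      by (simp add: K_def atLeast0LessThan)
    also have "(\<Sum>l=N0..<N. b l * \<bar>x l - L\<bar>) \<le> (\<Sum>l=N0..<N. b l * (e / 2))"
      using b N0 by (intro sum_mono mult_left_mono) (auto simp: less_imp_le)
    also have "\<dots> \<le> (\<Sum>l<N. b l * (e / 2))"
      using b e by (intro sum_mono2) (auto simp: less_imp_le)
    also have "\<dots> = ?B N * (e / 2)" by (simp add: sum_distrib_right)
    finally have "\<bar>\<Sum>l<N. b l * (x l - L)\<bar> \<le> K + ?B N * (e / 2)" by simp
    also have "\<dots> < ?B N * (e / 2) + ?B N * (e / 2)"
      using elim BN by (simp add: field_simps)
    finally have 1: "\<bar>\<Sum>l<N. b l * (x l - L)\<bar> < ?B N * e" by (simp add: mult.commute)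
    have "(\<Sum>l<N. b l * x l) / ?B N - L = (\<Sum>l<N. b l * (x l - L)) / ?B N"
      using BN by (simp add: field_simps sum_subtractf sum_distrib_left right_diff_distrib)
    hence "norm ((\<Sum>l<N. b l * x l) / ?B N - L) = \<bar>\<Sum>l<N. b l * (x l - L)\<bar> / ?B N" using BN by simp
    also have "\<dots> < e" using 1 BN by (simp add: field_simps)
    finally show ?case .
  qed
  thus "\<exists>N. \<forall>n\<ge>N. norm ((\<Sum>l<n. b l * x l) / ?B n - L) < e" by (simp add: eventually_sequentially)
qed

text \<open>The weights (l + 1)^\<alpha> - l^\<alpha> telescope to N^\<alpha> and are asymptotic to
  \<alpha> l^(\<alpha> - 1), so q / b tends to C / \<alpha> and so does its weighted mean.\<close>

lemma partial_sum_powr_asymp: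
  fixes q :: "nat \<Rightarrow> real"
  assumes al: "\<alpha> > 0" and q: "(\<lambda>n. q n * real n powr (1 - \<alpha>)) \<longlonglongrightarrow> C"
  shows "(\<lambda>N. (\<Sum>l<N. q l) / real N powr \<alpha>) \<longlonglongrightarrow> C / \<alpha>"
proof -
  define b where "b l = real (Suc l) powr \<alpha> - real l powr \<alpha>" for l
  have b: "b l > 0" for l using al by (simp add: b_def powr_less_mono2)
  have B: "(\<Sum>l<N. b l) = real N powr \<alpha>" for N
    by (induction N) (use al in \<open>auto simp: b_def\<close>)
  have "(\<lambda>l. ((real l + 1) powr \<alpha> - real l powr \<alpha>) * real l powr (1 - \<alpha>)) \<longlonglongrightarrow> \<alpha>"
    using al by real_asymp
  hence "(\<lambda>l. (q l * real l powr (1 - \<alpha>)) / (b l * real l powr (1 - \<alpha>))) \<longlonglongrightarrow> C / \<alpha>"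
    using al by (intro tendsto_divide q) (auto simp: b_def add.commute)
  moreover have "eventually (\<lambda>l. (q l * real l powr (1 - \<alpha>)) / (b l * real l powr (1 - \<alpha>)) = q l / b l) sequentially"
    using eventually_gt_at_top[of 0] by eventually_elim simp
  ultimately have "(\<lambda>l. q l / b l) \<longlonglongrightarrow> C / \<alpha>" by (rule Lim_transform_eventually)
  moreover have "filterlim (\<lambda>N. \<Sum>l<N. b l) at_top sequentially"
    unfolding B using al by real_asymp
  ultimately have "(\<lambda>N. (\<Sum>l<N. b l * (q l / b l)) / (\<Sum>l<N. b l)) \<longlonglongrightarrow> C / \<alpha>"
    using b by (intro weighted_cesaro)
  moreover have "b l * (q l / b l) = q l" for l using b[of l] by simp
  ultimately show ?thesis by (simp add: B)
qed

text \<open>Above k n the index of a is large, so a counts as \<alpha> and the tail is about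
  \<alpha> A (n - k n) / (n q n), with A the partial sums of q. Since A N is asymptotic to (C /
  \<alpha>) N^\<alpha> and n q n to C n^\<alpha>, only the ratio ((n - k n) / n)^\<alpha>
  survives.\<close>

lemma tail_weight_tendsto:
  fixes a q :: "nat \<Rightarrow> real"
  assumes al: "\<alpha> > 0" and C: "C > 0" and a: "a \<longlonglongrightarrow> \<alpha>" and qpos: "\<And>n. q n > 0"
    and q: "(\<lambda>n. q n * real n powr (1 - \<alpha>)) \<longlonglongrightarrow> C"
    and w: "\<And>n i. i \<in> {1..n} \<Longrightarrow> w n i = a i * q (n - i) / (real n * q n)"
    and k: "(\<lambda>n. real (k n) / real n) \<longlonglongrightarrow> x" and x: "0 < x" "x < 1"
  shows "(\<lambda>n. tail_weight w n (k n)) \<longlonglongrightarrow> (1 - x) powr \<alpha>"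
proof -
  define A where "A N = (\<Sum>l<N. q l)" for N
  \<comment> \<open>A weighted mean of values of \<open>a\<close> at indices n - l above k n, so it
    inherits the limit of \<open>a\<close>.\<close>
  define r where "r n = (\<Sum>l<n - k n. a (n - l) * q l) / A (n - k n)" for n
  have "eventually (\<lambda>n. real (k n) / real n < 1) sequentially"
    using order_tendstoD(2)[OF k x(2)] .
  hence kn: "eventually (\<lambda>n. k n < n \<and> 0 < n) sequentially"
    using eventually_gt_at_top[of 0] by eventually_elim (auto simp: field_simps)
  have k_inf: "filterlim k at_top sequentially"
  proof -
    have "filterlim (\<lambda>n. real (k n) / real n * real n) at_top sequentially"
      by (rule filterlim_tendsto_pos_mult_at_top[OF k x(1) filterlim_real_sequentially])
    moreover have "eventually (\<lambda>n. real (k n) / real n * real n = real (k n)) sequentially"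
      using eventually_gt_at_top[of 0] by eventually_elim simp
    ultimately have "filterlim (\<lambda>n. real (k n)) at_top sequentially"
      by (simp add: filterlim_cong)
    thus ?thesis by (simp add: filterlim_sequentially_iff_filterlim_real)
  qed
  have nk: "(\<lambda>n. real (n - k n) / real n) \<longlonglongrightarrow> 1 - x"
  proof (rule Lim_transform_eventually)
    show "(\<lambda>n. 1 - real (k n) / real n) \<longlonglongrightarrow> 1 - x" by (intro tendsto_intros k)
    show "eventually (\<lambda>n. 1 - real (k n) / real n = real (n - k n) / real n) sequentially"
      using kn by eventually_elim (auto simp: of_nat_diff field_simps)
  qed
  have nk_inf: "filterlim (\<lambda>n. n - k n) at_top sequentially"
  proof -
    have "filterlim (\<lambda>n. real (n - k n) / real n * real n) at_top sequentially"
      by (rule filterlim_tendsto_pos_mult_at_top[OF nk _ filterlim_real_sequentially]) (use x in simp)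
    moreover have "eventually (\<lambda>n. real (n - k n) / real n * real n = real (n - k n)) sequentially"
      using eventually_gt_at_top[of 0] by eventually_elim simp
    ultimately have "filterlim (\<lambda>n. real (n - k n)) at_top sequentially"
      by (simp add: filterlim_cong)
    thus ?thesis by (simp add: filterlim_sequentially_iff_filterlim_real)
  qed
  have r: "r \<longlonglongrightarrow> \<alpha>"
  proof (rule LIMSEQ_I)
    fix e :: real assume e: "e > 0"
    from LIMSEQ_D[OF a, of "e / 2"] e obtain N0 where N0: "\<And>i. i \<ge> N0 \<Longrightarrow> \<bar>a i - \<alpha>\<bar> < e / 2" by auto
    have "eventually (\<lambda>n. k n \<ge> N0) sequentially" using k_inf by (simp add: filterlim_at_top)
    with kn have "eventually (\<lambda>n. norm (r n - \<alpha>) < e) sequentially"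
    proof eventually_elim
      case (elim n)
      have Apos: "A (n - k n) > 0" unfolding A_def using elim qpos by (intro sum_pos) (auto simp: lessThan_empty_iff)
      have "r n - \<alpha> = (\<Sum>l<n - k n. (a (n - l) - \<alpha>) * q l) / A (n - k n)"
        using Apos by (simp add: r_def field_simps sum_subtractf A_def sum_distrib_left left_diff_distrib)
      hence "norm (r n - \<alpha>) = \<bar>\<Sum>l<n - k n. (a (n - l) - \<alpha>) * q l\<bar> / A (n - k n)" using Apos by simp
      also have "\<bar>\<Sum>l<n - k n. (a (n - l) - \<alpha>) * q l\<bar> \<le> (\<Sum>l<n - k n. (e / 2) * q l)"
      proof (rule order_trans[OF sum_abs], rule sum_mono)
        fix l assume "l \<in> {..<n - k n}"
        hence "n - l \<ge> N0" using elim by auto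
        thus "\<bar>(a (n - l) - \<alpha>) * q l\<bar> \<le> (e / 2) * q l"
          using N0[of "n - l"] qpos[of l] by (auto simp: abs_mult intro!: mult_right_mono)
      qed
      also have "\<dots> = (e / 2) * A (n - k n)" by (simp add: A_def sum_distrib_left)
      finally have "norm (r n - \<alpha>) \<le> (e / 2) * A (n - k n) / A (n - k n)"
        using Apos by (simp add: divide_right_mono)
      thus ?case using Apos e by simp
    qed
    thus "\<exists>N. \<forall>n\<ge>N. norm (r n - \<alpha>) < e" by (simp add: eventually_sequentially)
  qed
  have A: "(\<lambda>n. A (n - k n) / real (n - k n) powr \<alpha>) \<longlonglongrightarrow> C / \<alpha>"
    using filterlim_compose[OF partial_sum_powr_asymp[OF al q] nk_inf] by (simp add: A_def)
  have "(\<lambda>n. r n * ((A (n - k n) / real (n - k n) powr \<alpha>) * (real (n - k n) / real n) powr \<alpha> / (q n * real n powr (1 - \<alpha>))))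
      \<longlonglongrightarrow> \<alpha> * ((C / \<alpha>) * (1 - x) powr \<alpha> / C)"
    by (intro tendsto_intros r A nk q) (use x C in auto)
  hence lim: "(\<lambda>n. r n * ((A (n - k n) / real (n - k n) powr \<alpha>) * (real (n - k n) / real n) powr \<alpha> / (q n * real n powr (1 - \<alpha>))))
      \<longlonglongrightarrow> (1 - x) powr \<alpha>"
    using al C by simp
  show ?thesis
  proof (rule Lim_transform_eventually[OF lim])
    show "eventually (\<lambda>n. r n * ((A (n - k n) / real (n - k n) powr \<alpha>) * (real (n - k n) / real n) powr \<alpha> / (q n * real n powr (1 - \<alpha>)))
       = tail_weight w n (k n)) sequentially"
      using kn
    proof eventually_elim
      case (elim n)
      have Apos: "A (n - k n) > 0" unfolding A_def using elim qpos by (intro sum_pos) (auto simp: lessThan_empty_iff)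
      have "tail_weight w n (k n) = (\<Sum>i\<in>{k n<..n}. a i * q (n - i) / (real n * q n))"
        unfolding tail_weight_def by (intro sum.cong) (auto simp: w)
      also have "\<dots> = (\<Sum>l<n - k n. a (n - l) * q l / (real n * q n))"
        by (rule sum.reindex_bij_witness[of _ "\<lambda>l. n - l" "\<lambda>i. n - i"]) auto
      also have "\<dots> = r n * A (n - k n) / (real n * q n)"
        using Apos by (simp add: r_def flip: sum_divide_distrib)
      finally have 1: "tail_weight w n (k n) = r n * (A (n - k n) / (real n * q n))" by simp
      have "A (n - k n) / real (n - k n) powr \<alpha> * (real (n - k n) / real n) powr \<alpha> / (q n * real n powr (1 - \<alpha>))
          = A (n - k n) / (real n powr \<alpha> * (q n * real n powr (1 - \<alpha>)))"
        using elim by (simp add: powr_divide)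
      also have "real n powr \<alpha> * (q n * real n powr (1 - \<alpha>)) = real n * q n"
        using elim by (simp add: powr_diff)
      finally show ?case using 1 by simp
    qed
  qed
qed

text \<open>Whether the pick is at most k is read off from the tail at k = floor (x n). The limiting
  tail (1 - x)^\<alpha> lies above u = v^\<alpha> for x < 1 - v and below it for x > 1 - v, which
  traps the pick from both sides.\<close>

lemma first_size_tendsto:
  assumes al: "\<alpha> > 0" and w: "\<And>n i. 0 \<le> w n i"
    and tail: "\<And>x k. 0 < x \<Longrightarrow> x < 1 \<Longrightarrow> (\<lambda>n. real (k n) / real n) \<longlonglongrightarrow> x \<Longrightarrow>
       (\<lambda>n. tail_weight w n (k n)) \<longlonglongrightarrow> (1 - x) powr \<alpha>"
    and u: "0 < u" "u < 1"
  shows "(\<lambda>n. real (first_size w n u) / real n) \<longlonglongrightarrow> 1 - u powr (1 / \<alpha>)"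
proof -
  define v where "v = u powr (1 / \<alpha>)"
  have v: "0 < v" "v < 1" using u al powr_less_mono2[of "1 / \<alpha>" u 1] by (auto simp: v_def)
  have uv: "u = v powr \<alpha>" using al u by (simp add: v_def powr_powr)
  have fl: "(\<lambda>n. real (nat \<lfloor>x * real n\<rfloor>) / real n) \<longlonglongrightarrow> x" if "0 < x" for x :: real
    using that by real_asymp
  show ?thesis
    unfolding v_def[symmetric]
  proof (rule order_tendstoI)
    fix y assume y: "y < 1 - v"
    \<comment> \<open>The midpoint between y and 1 - v, with a negative y raised to 0 so that x > 0;
      in the other half y is capped at 1 to keep x < 1.\<close>
    define x where "x = (max y 0 + (1 - v)) / 2"
    have x: "0 < x" "x < 1 - v" "y < x" using y v by (auto simp: x_def)
    let ?k = "\<lambda>n. nat \<lfloor>x * real n\<rfloor>"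
    have "(\<lambda>n. tail_weight w n (?k n)) \<longlonglongrightarrow> (1 - x) powr \<alpha>"
      using x v by (intro tail fl) auto
    moreover have "u < (1 - x) powr \<alpha>" unfolding uv using x v al by (intro powr_less_mono2) auto
    ultimately have ev1: "eventually (\<lambda>n. u < tail_weight w n (?k n)) sequentially"
      by (rule order_tendstoD(1))
    have ev2: "eventually (\<lambda>n. y < real (?k n) / real n) sequentially"
      using order_tendstoD(1)[OF fl[OF x(1)] x(3)] .
    have ev3: "eventually (\<lambda>n. real (?k n) / real n < 1) sequentially"
      using order_tendstoD(2)[OF fl[OF x(1)], of 1] x v by simp
    show "eventually (\<lambda>n. y < real (first_size w n u) / real n) sequentially"
      using ev1 ev2 ev3 eventually_gt_at_top[of 0]
    proof eventually_elim
      case (elim n)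
      have "\<not> first_size w n u \<le> ?k n"
        using first_size_le_iff[of w n u "?k n", OF w] elim by (auto simp: field_simps)
      hence "real (?k n) / real n \<le> real (first_size w n u) / real n"
        by (intro divide_right_mono) auto
      thus ?case using elim by linarith
    qed
  next
    fix y assume y: "1 - v < y"
    define x where "x = (min y 1 + (1 - v)) / 2"
    have x: "0 < x" "x < 1" "1 - v < x" "x < y" using y v by (auto simp: x_def min_def split: if_splits)
    let ?k = "\<lambda>n. nat \<lfloor>x * real n\<rfloor>"
    have "(\<lambda>n. tail_weight w n (?k n)) \<longlonglongrightarrow> (1 - x) powr \<alpha>"
      using x v by (intro tail fl) auto
    moreover have "(1 - x) powr \<alpha> < u" unfolding uv using x v al by (intro powr_less_mono2) auto
    ultimately have ev1: "eventually (\<lambda>n. tail_weight w n (?k n) < u) sequentially"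
      by (rule order_tendstoD(2))
    have ev2: "eventually (\<lambda>n. real (?k n) / real n < y) sequentially"
      using order_tendstoD(2)[OF fl[OF x(1)] x(4)] .
    have ev3: "eventually (\<lambda>n. 0 < real (?k n) / real n) sequentially"
      using order_tendstoD(1)[OF fl[OF x(1)] x(1)] .
    show "eventually (\<lambda>n. real (first_size w n u) / real n < y) sequentially"
      using ev1 ev2 ev3 eventually_gt_at_top[of 0]
    proof eventually_elim
      case (elim n)
      have "0 < ?k n" using elim(3) by (rule contrapos_pp) simp
      hence "1 \<le> ?k n" by linarith
      with elim(1) have "first_size w n u \<le> ?k n"
        unfolding first_size_le_iff[of w n u "?k n", OF w elim(4)] by (simp only: less_imp_le simp_thms)
      hence "real (first_size w n u) / real n \<le> real (?k n) / real n"
        by (intro divide_right_mono) auto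
      thus ?case using elim by linarith
    qed
  qed
qed

lemma stick_breaking_Suc:
  "stick_breaking \<alpha> u (Suc i) = u 0 powr (1 / \<alpha>) * stick_breaking \<alpha> (shift u) i"
  by (simp add: stick_breaking_def shift_def prod.lessThan_Suc_shift mult.assoc del: prod.lessThan_Suc)

text \<open>Induction on i for all u: the remainder r n after the first pick tends to infinity and r
  n / n tends to u 0 powr (1 / \<alpha>), so the limit for \<open>shift u\<close> may be taken along
  r and rescaled. Convergence at each fixed u is what allows this composition.\<close>

lemma chain_tendsto:
  assumes fs: "\<And>u. 0 < u \<Longrightarrow> u < 1 \<Longrightarrow> (\<lambda>n. real (first_size w n u) / real n) \<longlonglongrightarrow> 1 - u powr (1 / \<alpha>)"
    and u: "\<And>i. 0 < u i \<and> u i < 1"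
  shows "(\<lambda>n. real (chain w n u i) / real n) \<longlonglongrightarrow> stick_breaking \<alpha> u i"
  using u
proof (induction i arbitrary: u)
  case 0
  thus ?case using fs[of "u 0"] by (simp add: stick_breaking_def)
next
  case (Suc i)
  define r where "r n = n - first_size w n (u 0)" for n
  have r: "(\<lambda>n. real (r n) / real n) \<longlonglongrightarrow> u 0 powr (1 / \<alpha>)"
  proof (rule Lim_transform_eventually)
    show "(\<lambda>n. 1 - real (first_size w n (u 0)) / real n) \<longlonglongrightarrow> u 0 powr (1 / \<alpha>)"
      using tendsto_diff[OF tendsto_const[of 1] fs[of "u 0"]] Suc.prems[of 0] by simp
    show "eventually (\<lambda>n. 1 - real (first_size w n (u 0)) / real n = real (r n) / real n) sequentially"
      using eventually_gt_at_top[of 0]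
      by eventually_elim (auto simp: r_def of_nat_diff first_size_le field_simps)
  qed
  have "filterlim (\<lambda>n. real (r n) / real n * real n) at_top sequentially"
    by (rule filterlim_tendsto_pos_mult_at_top[OF r _ filterlim_real_sequentially]) (use Suc.prems[of 0] in simp)
  moreover have "eventually (\<lambda>n. real (r n) / real n * real n = real (r n)) sequentially"
    using eventually_gt_at_top[of 0] by eventually_elim simp
  ultimately have "filterlim (\<lambda>n. real (r n)) at_top sequentially"
    by (simp add: filterlim_cong)
  hence r_inf: "filterlim r at_top sequentially" by (simp add: filterlim_sequentially_iff_filterlim_real)
  have "(\<lambda>n. real (chain w n (shift u) i) / real n) \<longlonglongrightarrow> stick_breaking \<alpha> (shift u) i"
    by (rule Suc.IH) (use Suc.prems in \<open>simp add: shift_def\<close>)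
  from filterlim_compose[OF this r_inf]
  have "(\<lambda>n. real (r n) / real n * (real (chain w (r n) (shift u) i) / real (r n)))
      \<longlonglongrightarrow> u 0 powr (1 / \<alpha>) * stick_breaking \<alpha> (shift u) i"
    by (intro tendsto_intros r)
  moreover have "eventually (\<lambda>n. real (r n) / real n * (real (chain w (r n) (shift u) i) / real (r n))
      = real (chain w n u (Suc i)) / real n) sequentially"
    using eventually_compose_filterlim[OF eventually_gt_at_top[of 0] r_inf]
    by eventually_elim (simp add: r_def)
  ultimately show ?case unfolding stick_breaking_Suc by (rule Lim_transform_eventually)
qed

section \<open>Ranking\<close>

lemma nth_sorted_desc_iff_length_filter:
  assumes "sorted_wrt (\<ge>) ys" and P: "\<And>x y. P x \<Longrightarrow> x \<le> y \<Longrightarrow> P y"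
  shows "j < length ys \<and> P (ys ! j) \<longleftrightarrow> j < length (filter P ys)"
  using assms(1)
proof (induction ys arbitrary: j)
  case (Cons y ys)
  show ?case
  proof (cases "P y")
    case True
    thus ?thesis using Cons by (cases j) auto
  next
    case False
    hence *: "\<not> P x" if "x \<in> set (y # ys)" for x using Cons.prems P that by auto
    hence "filter P (y # ys) = []" by (subst filter_empty_conv) blast
    thus ?thesis using *[OF nth_mem[of j "y # ys"]] by auto
  qed
qed simp

text \<open>\<open>rel_size\<close> as a function of the multiset alone, so that it also applies to
  the chain, which yields sizes but no blocks.\<close>

definition ranked_size :: "nat \<Rightarrow> nat multiset \<Rightarrow> nat \<Rightarrow> real" where
  "ranked_size n M j =
     (if j < size M then real (rev (sorted_list_of_multiset M) ! j) / real n else 0)"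

lemma rel_size_eq_ranked_size: "rel_size n a = ranked_size n (image_mset card (mset_set (fst a)))"
proof -
  have "length (sorted_list_of_multiset M) = size M" for M :: "nat multiset"
    by (metis mset_sorted_list_of_multiset size_mset)
  thus ?thesis by (simp add: fun_eq_iff rel_size_def ranked_size_def component_sizes_def)
qed

text \<open>In a decreasing list the entries above t form an initial segment, so ranking reduces to
  counting. For t < 0 the padding zeros would exceed t too and spoil the count.\<close>

lemma ranked_size_gt_iff:
  assumes "t \<ge> 0"
  shows "t < ranked_size n M j \<longleftrightarrow> j < size (filter_mset (\<lambda>x. t < real x / real n) M)"
proof -
  define ys where "ys = rev (sorted_list_of_multiset M)"
  have M: "M = mset ys" by (simp add: ys_def)
  have "sorted_wrt (\<ge>) ys" unfolding ys_def sorted_wrt_rev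
    using sorted_sorted_list_of_multiset[of M] by simp
  from nth_sorted_desc_iff_length_filter[OF this, of "\<lambda>x. t < real x / real n" j]
  have "j < length ys \<and> t < real (ys ! j) / real n \<longleftrightarrow> j < length (filter (\<lambda>x. t < real x / real n) ys)"
    by (meson divide_right_mono less_le_trans of_nat_0_le_iff of_nat_mono)
  moreover have "length (filter (\<lambda>x. t < real x / real n) ys) = size (filter_mset (\<lambda>x. t < real x / real n) M)"
    unfolding M by (metis mset_filter size_mset)
  moreover have "size M = length ys" by (simp add: M)
  ultimately show ?thesis
    using assms by (cases "j < length ys") (simp_all add: ranked_size_def ys_def[symmetric])
qed

text \<open>Because the limit has total mass \<open>1\<close>, no mass can escape to late indices.\<close>
lemma sort_desc_tendsto:
  fixes X :: "nat \<Rightarrow> nat \<Rightarrow> real" and Y :: "nat \<Rightarrow> real"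
  assumes Y: "\<And>n t. 0 \<le> t \<Longrightarrow> t < Y n \<longleftrightarrow> j < card {i. t < X n i}"
    and fin: "\<And>n t. 0 \<le> t \<Longrightarrow> finite {i. t < X n i}"
    and X0: "\<And>n i. 0 \<le> X n i" and X1: "\<And>n r. (\<Sum>i\<le>r. X n i) \<le> 1"
    and XG: "\<And>i. (\<lambda>n. X n i) \<longlonglongrightarrow> G i"
    and G: "\<And>i. 0 < G i" "G \<longlonglongrightarrow> 0" "(\<lambda>r. \<Sum>i<r. G i) \<longlonglongrightarrow> 1"
  shows "Y \<longlonglongrightarrow> sort_desc G j"
proof (rule order_tendstoI)
  fix y assume y: "y < sort_desc G j"
  obtain p where "sort_desc G = G \<circ> p" using sort_desc_rearrangement(2)[OF G(1,2)] by blast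
  hence "0 < sort_desc G j" using G(1) by simp
  \<comment> \<open>The counting criterion holds for thresholds \<ge> 0 only; a negative y may be
    raised to 0 because the limit is positive.\<close>
  hence "max y 0 < sort_desc G j" using y by simp
  then obtain S where S: "finite S" "card S = Suc j" "\<forall>i\<in>S. max y 0 < G i"
    using sort_desc_gt_iff[OF G(1,2)] by blast
  have "eventually (\<lambda>n. \<forall>i\<in>S. max y 0 < X n i) sequentially"
    using S by (intro eventually_ball_finite ballI order_tendstoD(1)[OF XG]) auto
  thus "eventually (\<lambda>n. y < Y n) sequentially"
  proof eventually_elim
    case (elim n)
    have "card S \<le> card {i. max y 0 < X n i}"
      using elim by (intro card_mono fin) auto
    hence "max y 0 < Y n" using Y[of "max y 0" n] S(2) by simp
    thus ?case by simp
  qed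
next
  fix y assume y: "sort_desc G j < y"
  obtain p where "sort_desc G = G \<circ> p" using sort_desc_rearrangement(2)[OF G(1,2)] by blast
  hence pos: "0 < sort_desc G j" using G(1) by simp
  obtain t where t: "sort_desc G j < t" "t < y" using y dense by blast
  \<comment> \<open>Once the first r entries carry more than 1 - t, no later entry can exceed t, as
    the total is at most 1. Only finitely many indices then matter for the ranking.\<close>
  have "eventually (\<lambda>r. 1 - t < (\<Sum>i<r. G i)) sequentially"
    using order_tendstoD(1)[OF G(3), of "1 - t"] t pos by simp
  then obtain r where r: "1 - t < (\<Sum>i<r. G i)" by (auto simp: eventually_sequentially)
  define T where "T = {i. i < r \<and> t \<le> G i}"
  have T: "card T \<le> j"
  proof (rule ccontr)
    assume "\<not> card T \<le> j"
    then obtain S where S: "S \<subseteq> T" "card S = Suc j" "finite S"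
      using obtain_subset_with_card_n[of "Suc j" T] by auto
    have "\<forall>i\<in>S. sort_desc G j < G i" using S(1) t(1) by (auto simp: T_def)
    hence "sort_desc G j < sort_desc G j"
      unfolding sort_desc_gt_iff[OF G(1,2)] using S by blast
    thus False by simp
  qed
  have "(\<lambda>n. \<Sum>i<r. X n i) \<longlonglongrightarrow> (\<Sum>i<r. G i)" by (intro tendsto_intros XG)
  hence ev1: "eventually (\<lambda>n. 1 - t < (\<Sum>i<r. X n i)) sequentially"
    using r by (rule order_tendstoD(1))
  \<comment> \<open>Among the first r entries, those with limit below t stay below t;
    \<open>T\<close> collects the at most j others.\<close>
  have ev2: "eventually (\<lambda>n. \<forall>i\<in>{i. i < r \<and> G i < t}. X n i < t) sequentially"
    by (intro eventually_ball_finite ballI order_tendstoD(2)[OF XG]) auto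
  show "eventually (\<lambda>n. Y n < y) sequentially"
    using ev1 ev2
  proof eventually_elim
    case (elim n)
    have "{i. t < X n i} \<subseteq> T"
    proof
      fix i assume i: "i \<in> {i. t < X n i}"
      have "i < r"
      proof (rule ccontr)
        assume "\<not> i < r"
        hence "(\<Sum>l<r. X n l) + X n i = (\<Sum>l\<in>insert i {..<r}. X n l)" by simp
        also have "\<dots> \<le> (\<Sum>l\<le>i. X n l)"
          using \<open>\<not> i < r\<close> X0 by (intro sum_mono2) auto
        also have "\<dots> \<le> 1" by (rule X1)
        finally show False using elim(1) i by simp
      qed
      moreover have "t \<le> G i"
      proof (rule ccontr)
        assume "\<not> t \<le> G i"
        hence "X n i < t" using elim(2) \<open>i < r\<close> by simp
        thus False using i by simp
      qed
      ultimately show "i \<in> T" by (simp add: T_def)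
    qed
    moreover have "finite T" by (simp add: T_def)
    ultimately have "card {i. t < X n i} \<le> j" using T card_mono le_trans by blast
    hence "\<not> t < Y n" using Y[of t n] t pos by simp
    thus ?case using t by simp
  qed
qed

section \<open>Total mass of the stick-breaking sequence\<close>

lemma sum_stick_breaking: "(\<Sum>i<r. stick_breaking \<alpha> u i) = 1 - (\<Prod>i<r. u i powr (1 / \<alpha>))"
  by (induction r) (auto simp: stick_breaking_def algebra_simps)

lemma nn_integral_prod_iid_uniform:
  fixes f :: "real \<Rightarrow> ennreal"
  assumes [measurable]: "f \<in> borel_measurable borel"
  shows "(\<integral>\<^sup>+u. (\<Prod>i<r. f (u i)) \<partial>iid_uniform) = (\<integral>\<^sup>+s. f s \<partial>unif) ^ r"
proof (induction r)
  case 0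
  interpret prob_space iid_uniform by (rule prob_space_iid_uniform)
  show ?case by (simp add: emeasure_space_1)
next
  case (Suc r)
  have [measurable]: "(\<lambda>u. u i) \<in> borel_measurable (\<Pi>\<^sub>M i\<in>(UNIV::nat set). (borel :: real measure))" for i
    by (rule measurable_component_singleton) simp
  have m: "(\<lambda>u. \<Prod>i<r. f (u i)) \<in> borel_measurable iid_uniform" for r
    by (simp cong: measurable_cong_sets add: sets_iid_uniform)
  have "(\<integral>\<^sup>+u. (\<Prod>i<Suc r. f (u i)) \<partial>iid_uniform)
      = (\<integral>\<^sup>+s. \<integral>\<^sup>+\<omega>. (\<Prod>i<Suc r. f (case_nat s \<omega> i)) \<partial>iid_uniform \<partial>unif)"
    by (rule nn_integral_iid_uniform_case_nat) measurable
  also have "\<dots> = (\<integral>\<^sup>+s. f s * (\<integral>\<^sup>+u. (\<Prod>i<r. f (u i)) \<partial>iid_uniform) \<partial>unif)"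
    by (intro nn_integral_cong)
       (simp add: prod.lessThan_Suc_shift nn_integral_cmult[OF m] del: prod.lessThan_Suc)
  also have "\<dots> = (\<integral>\<^sup>+s. f s \<partial>unif) * (\<integral>\<^sup>+u. (\<Prod>i<r. f (u i)) \<partial>iid_uniform)"
    by (intro nn_integral_multc) (use assms in \<open>simp cong: measurable_cong_sets\<close>)
  finally show ?case unfolding Suc by simp
qed

lemma AE_iid_uniform_pos: "AE u in iid_uniform. \<forall>i. 0 < u i \<and> u i < 1"
proof -
  have "AE x in lborel. x \<noteq> (0::real) \<and> x \<noteq> 1"
    by (intro AE_conjI AE_lborel_singleton)
  hence U: "AE x in unif. 0 < x \<and> x < 1"
    by (intro AE_uniform_measureI) (force elim: eventually_mono)+
  have "AE u in iid_uniform. 0 < u i \<and> u i < 1" for i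
    unfolding iid_uniform_def
    using AE_PiM_component[of "UNIV :: nat set" "\<lambda>_. unif" i "\<lambda>x. 0 < x \<and> x < 1"] U
    by (simp add: prob_space_uniform_measure)
  thus ?thesis by (simp add: AE_all_countable)
qed

text \<open>Each factor is at most b < 1 or 1, according to whether u i < 1 / 2, and this bound has
  mean c < 1. The infimum over r of the products of the bounds has mean at most c^r for every r, so
  it vanishes almost surely; since the original products decrease, they converge to 0. This is why
  the sticks have total mass 1.\<close>

lemma AE_prod_powr_tendsto_0:
  assumes al: "\<alpha> > 0"
  shows "AE u in iid_uniform. (\<lambda>r. \<Prod>i<r. u i powr (1 / \<alpha>)) \<longlonglongrightarrow> 0"
proof -
  define b :: real where "b = (1 / 2) powr (1 / \<alpha>)"
  have b: "0 < b" "b < 1" using al powr_less_mono2[of "1 / \<alpha>" "1/2" 1] by (auto simp: b_def)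
  define f :: "real \<Rightarrow> ennreal" where "f s = ennreal (if s < 1 / 2 then b else 1)" for s
  have [measurable]: "f \<in> borel_measurable borel" unfolding f_def by measurable
  define c where "c = (b + 1) / 2"
  have c: "0 < c" "c < 1" using b by (auto simp: c_def)
  have half: "emeasure unif {..<1/2} = ennreal (1 / 2)"
  proof -
    have "{0..1} \<inter> {..<1/2} = {0..<1/2::real}" by auto
    thus ?thesis by (subst emeasure_uniform_measure) (auto simp: divide_ennreal_def)
  qed
  have half': "emeasure unif {1/2..} = ennreal (1 / 2)"
  proof -
    have "{0..1} \<inter> {1/2..} = {1/2..1::real}" by auto
    thus ?thesis by (subst emeasure_uniform_measure) (auto simp: divide_ennreal_def)
  qed
  have "(\<integral>\<^sup>+s. f s \<partial>unif) = (\<integral>\<^sup>+s. ennreal b * indicator {..<1/2} s + 1 * indicator {1/2..} s \<partial>unif)"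
    by (intro nn_integral_cong) (auto simp: f_def indicator_def)
  also have "\<dots> = ennreal b * emeasure unif {..<1/2} + 1 * emeasure unif {1/2..}"
    by (subst nn_integral_add) (simp_all add: nn_integral_cmult_indicator del: emeasure_uniform_measure)
  also have "\<dots> = ennreal (b * (1 / 2)) + ennreal (1 / 2)"
    unfolding half half' using b by (subst ennreal_mult) auto
  also have "\<dots> = ennreal c"
    using b by (subst ennreal_plus[symmetric]) (auto simp: c_def field_simps)
  finally have fc: "(\<integral>\<^sup>+s. f s \<partial>unif) = ennreal c" .
  have [measurable]: "(\<lambda>u. u i) \<in> borel_measurable iid_uniform" for i
  proof -
    have "(\<lambda>u. u i) \<in> borel_measurable (\<Pi>\<^sub>M i\<in>(UNIV::nat set). (borel :: real measure))"
      by (rule measurable_component_singleton) simp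
    thus ?thesis by (simp cong: measurable_cong_sets add: sets_iid_uniform)
  qed
  define Z :: "(nat \<Rightarrow> real) \<Rightarrow> ennreal" where "Z u = (INF r. \<Prod>i<r. f (u i))" for u
  have Zm: "Z \<in> borel_measurable iid_uniform" unfolding Z_def by measurable
  have "(\<integral>\<^sup>+u. Z u \<partial>iid_uniform) \<le> ennreal (c ^ r)" for r
  proof -
    have "(\<integral>\<^sup>+u. Z u \<partial>iid_uniform) \<le> (\<integral>\<^sup>+u. (\<Prod>i<r. f (u i)) \<partial>iid_uniform)"
      unfolding Z_def by (intro nn_integral_mono INF_lower) auto
    thus ?thesis using c by (simp add: nn_integral_prod_iid_uniform fc ennreal_power)
  qed
  moreover have "(\<lambda>r. ennreal (c ^ r)) \<longlonglongrightarrow> ennreal 0"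
    using c by (intro tendsto_ennrealI LIMSEQ_realpow_zero) auto
  ultimately have "(\<integral>\<^sup>+u. Z u \<partial>iid_uniform) \<le> ennreal 0"
    by (intro LIMSEQ_le_const) auto
  hence "(\<integral>\<^sup>+u. Z u \<partial>iid_uniform) = 0" by simp
  hence "AE u in iid_uniform. Z u = 0" using nn_integral_0_iff_AE[OF Zm] by simp
  with AE_iid_uniform_pos show ?thesis
  proof eventually_elim
    case (elim u)
    define P where "P r = (\<Prod>i<r. u i powr (1 / \<alpha>))" for r
    have le1: "u i powr (1 / \<alpha>) \<le> 1" for i
      using elim(1) al powr_mono2[of "1 / \<alpha>" "u i" 1] by (auto simp: less_imp_le)
    have P0: "P r \<ge> 0" for r unfolding P_def by (intro prod_nonneg) auto
    have dec: "P s \<le> P r" if "r \<le> s" for r s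
      using that
    proof (induction s rule: dec_induct)
      case (step s)
      have "P (Suc s) \<le> P s * 1" unfolding P_def prod.lessThan_Suc
        using le1 P0[of s] by (intro mult_left_mono) (auto simp: P_def)
      with step show ?case by simp
    qed simp
    have Pf: "ennreal (P r) \<le> (\<Prod>i<r. f (u i))" for r
    proof -
      have "u i powr (1 / \<alpha>) \<le> b" if "u i < 1 / 2" for i
        unfolding b_def by (rule powr_mono2) (use elim(1) al that in \<open>auto simp: less_imp_le\<close>)
      hence "u i powr (1 / \<alpha>) \<le> (if u i < 1 / 2 then b else 1)" for i
        using le1[of i] by simp
      hence "P r \<le> (\<Prod>i<r. if u i < 1 / 2 then b else 1)"
        unfolding P_def by (intro prod_mono) auto
      hence "ennreal (P r) \<le> ennreal (\<Prod>i<r. if u i < 1 / 2 then b else 1)" by (rule ennreal_leI)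
      also have "\<dots> = (\<Prod>i<r. f (u i))"
        unfolding f_def using b by (subst prod_ennreal) auto
      finally show ?thesis .
    qed
    show ?case
      unfolding P_def[symmetric]
    proof (rule LIMSEQ_I)
      fix e :: real assume e: "e > 0"
      have "(INF r. \<Prod>i<r. f (u i)) < ennreal e" using elim(2) e by (simp add: Z_def)
      then obtain r where "(\<Prod>i<r. f (u i)) < ennreal e" by (auto simp: INF_less_iff)
      with Pf[of r] have "ennreal (P r) < ennreal e" by (rule le_less_trans)
      hence "P r < e" using P0[of r] e by (simp add: ennreal_less_iff)
      hence "\<forall>s\<ge>r. norm (P s - 0) < e" using dec P0 by (force intro: le_less_trans)
      thus "\<exists>r. \<forall>s\<ge>r. norm (P s - 0) < e" by blast
    qed
  qed
qed

lemma ranked_chain_tendsto: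
  assumes al: "\<alpha> > 0"
    and chain: "\<And>u i. (\<And>i. 0 < u i \<and> u i < 1) \<Longrightarrow> (\<lambda>n. real (chain w n u i) / real n) \<longlonglongrightarrow> stick_breaking \<alpha> u i"
  shows "AE u in iid_uniform. \<forall>j. (\<lambda>n. ranked_size n (chain_mset w n u) j) \<longlonglongrightarrow> sort_desc (stick_breaking \<alpha> u) j"
  using AE_iid_uniform_pos AE_prod_powr_tendsto_0[OF al] AE_stick_breaking[OF al]
proof eventually_elim
  case (elim u)
  show ?case
  proof
    fix j
    let ?X = "\<lambda>n i. real (chain w n u i) / real n"
    show "(\<lambda>n. ranked_size n (chain_mset w n u) j) \<longlonglongrightarrow> sort_desc (stick_breaking \<alpha> u) j"
    proof (rule sort_desc_tendsto[where X = ?X])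
      fix n and t :: real assume t: "0 \<le> t"
      show "t < ranked_size n (chain_mset w n u) j \<longleftrightarrow> j < card {i. t < ?X n i}"
        unfolding ranked_size_gt_iff[OF t] using t
        by (subst size_filter_chain_mset(2)) auto
      show "finite {i. t < ?X n i}"
        using t by (intro size_filter_chain_mset(1)[where P = "\<lambda>x. t < real x / real n"]) auto
    next
      fix n r
      have "(\<Sum>i\<le>r. ?X n i) = real (\<Sum>i\<le>r. chain w n u i) / real n"
        by (simp add: sum_divide_distrib)
      also have "\<dots> \<le> 1" using sum_chain_le[of w n u r] by (cases "n = 0") (auto simp: field_simps simp del: of_nat_sum)
      finally show "(\<Sum>i\<le>r. ?X n i) \<le> 1" .
    next
      fix i show "(\<lambda>n. ?X n i) \<longlonglongrightarrow> stick_breaking \<alpha> u i" using elim(1) by (intro chain) auto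
    next
      have "(\<lambda>r. 1 - (\<Prod>i<r. u i powr (1 / \<alpha>))) \<longlonglongrightarrow> 1 - 0"
        by (intro tendsto_intros elim(2))
      thus "(\<lambda>r. \<Sum>i<r. stick_breaking \<alpha> u i) \<longlonglongrightarrow> 1" by (simp add: sum_stick_breaking)
    qed (use elim(3) in auto)
  qed
qed

section \<open>Component sizes of tilted assemblies\<close>

lemma chain_mset_measurable_iid: "chain_mset w n \<in> iid_uniform \<rightarrow>\<^sub>M count_space UNIV"
  unfolding measurable_cong_sets[OF sets_iid_uniform refl] by (rule chain_mset_measurable)

text \<open>By the exponential formula, n! times the coefficient of z^n in exp (\<phi> M(z)); it is
  the normalising constant of the tilted distribution.\<close>

definition total_weight :: "(nat \<Rightarrow> nat) \<Rightarrow> real \<Rightarrow> nat \<Rightarrow> real" where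
  "total_weight m \<phi> n = partition_sum (\<lambda>i. \<phi> * real (m i)) {1..n} (\<lambda>_. 1)"

lemma total_weight_0 [simp]: "total_weight m \<phi> 0 = 1"
  by (simp add: total_weight_def partition_sum_empty)

lemma total_weight_Suc:
  "total_weight m \<phi> (Suc n) =
     (\<Sum>i\<le>n. real (n choose i) * (\<phi> * real (m (Suc i)) * total_weight m \<phi> (n - i)))"
  unfolding total_weight_def by (subst partition_sum_Suc) simp

lemma total_weight_pos:
  assumes m: "\<And>i. i \<ge> 1 \<Longrightarrow> m i > 0" and phi: "\<phi> > 0"
  shows "total_weight m \<phi> n > 0"
proof (induction n rule: less_induct)
  case (less n)
  show ?case
  proof (cases n)
    case (Suc k)
    show ?thesis unfolding Suc total_weight_Suc
      using m phi less Suc by (intro sum_pos) (auto intro!: mult_pos_pos)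
  qed simp
qed

lemma nn_integral_tilted_assembly:
  assumes m: "\<And>i. i \<ge> 1 \<Longrightarrow> m i > 0" and phi: "\<phi> > 0"
  shows "(\<integral>\<^sup>+a. h (image_mset card (mset_set (fst a))) \<partial>measure_pmf (tilted_assembly m \<phi> n))
    = ennreal (1 / total_weight m \<phi> n) *
      partition_sum (\<lambda>i. ennreal \<phi> * of_nat (m i)) {1..n} h"
proof -
  let ?A = "assemblies m n"
  let ?t = "\<lambda>a. image_mset card (mset_set (fst a))"
  define Z where "Z = (\<Sum>b\<in>?A. \<phi> ^ num_components b)"
  have Z: "Z = total_weight m \<phi> n"
    using sum_assemblies[where m = m and n = n and \<phi> = \<phi> and h = "\<lambda>_. 1"] by (simp add: Z_def total_weight_def)
  have Z0: "Z \<ge> 0" unfolding Z_def using phi by (intro sum_nonneg) auto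
  note pmf = pmf_tilted_assembly[of m \<phi> n, OF m phi, folded Z_def]
  have "(\<integral>\<^sup>+a. h (?t a) \<partial>measure_pmf (tilted_assembly m \<phi> n))
      = (\<integral>\<^sup>+a. ennreal (pmf (tilted_assembly m \<phi> n) a) * h (?t a) \<partial>count_space UNIV)"
    by (rule nn_integral_measure_pmf)
  also have "\<dots> = (\<Sum>a\<in>?A. ennreal (pmf (tilted_assembly m \<phi> n) a) * h (?t a))"
    by (rule nn_integral_count_space'[OF finite_assemblies]) (auto simp: pmf)
  also have "\<dots> = (\<Sum>a\<in>?A. ennreal (1 / Z) * (ennreal \<phi> ^ num_components a * h (?t a)))"
  proof (rule sum.cong[OF refl])
    fix a assume a: "a \<in> ?A"
    have "ennreal (\<phi> ^ num_components a / Z) = ennreal (1 / Z) * ennreal (\<phi> ^ num_components a)"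
      using Z0 phi by (subst ennreal_mult[symmetric]) auto
    thus "ennreal (pmf (tilted_assembly m \<phi> n) a) * h (?t a) = ennreal (1 / Z) * (ennreal \<phi> ^ num_components a * h (?t a))"
      using a phi by (simp add: pmf ennreal_power mult.assoc)
  qed
  also have "\<dots> = ennreal (1 / Z) * partition_sum (\<lambda>i. ennreal \<phi> * of_nat (m i)) {1..n} h"
    by (simp add: sum_assemblies flip: sum_distrib_left)
  finally show ?thesis unfolding Z .
qed

text \<open>The sequence q of the overview. The powers of \<rho> cancel in the pick probabilities
  and only place the dominant singularity at 1.\<close>

definition scaled_weight :: "(nat \<Rightarrow> nat) \<Rightarrow> real \<Rightarrow> real \<Rightarrow> nat \<Rightarrow> real" where
  "scaled_weight m \<phi> \<rho> n = \<rho> ^ n * total_weight m \<phi> n / fact n"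

definition scaled_irred :: "(nat \<Rightarrow> nat) \<Rightarrow> real \<Rightarrow> real \<Rightarrow> nat \<Rightarrow> real" where
  "scaled_irred m \<phi> \<rho> i = \<phi> * real (m i) * \<rho> ^ i / fact (i - 1)"

lemma scaled_weight_step:
  assumes "i \<le> n"
  shows "scaled_irred m \<phi> \<rho> (Suc i) * scaled_weight m \<phi> \<rho> (n - i)
    = \<rho> ^ Suc n / fact n * (real (n choose i) * (\<phi> * real (m (Suc i)) * total_weight m \<phi> (n - i)))"
proof -
  have *: "\<rho> ^ Suc n = \<rho> ^ Suc i * \<rho> ^ (n - i)" using assms by (simp flip: power_add)
  show ?thesis
    unfolding * by (simp add: scaled_irred_def scaled_weight_def binomial_fact[OF assms] del: power_Suc)
qed

lemma scaled_weight_rec: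
  "real (Suc n) * scaled_weight m \<phi> \<rho> (Suc n)
    = (\<Sum>i\<le>n. scaled_irred m \<phi> \<rho> (Suc i) * scaled_weight m \<phi> \<rho> (n - i))"
proof -
  have "real (Suc n) * scaled_weight m \<phi> \<rho> (Suc n) = \<rho> ^ Suc n / fact n * total_weight m \<phi> (Suc n)"
    by (simp add: scaled_weight_def del: of_nat_Suc)
  thus ?thesis by (simp add: scaled_weight_step total_weight_Suc sum_distrib_left)
qed

text \<open>Zero outside \<open>{1..n}\<close>, so that it is nonnegative at all arguments, as the
  quantile lemmas require.\<close>

definition first_block_prob :: "(nat \<Rightarrow> nat) \<Rightarrow> real \<Rightarrow> real \<Rightarrow> nat \<Rightarrow> nat \<Rightarrow> real" where
  "first_block_prob m \<phi> \<rho> n i = (if i \<in> {1..n} then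
     scaled_irred m \<phi> \<rho> i * scaled_weight m \<phi> \<rho> (n - i) / (real n * scaled_weight m \<phi> \<rho> n) else 0)"

lemma sum_1_to_Suc: "(\<Sum>i=1..Suc n. f i) = (\<Sum>i\<le>n. f (Suc i))"
  by (rule sum.reindex_bij_witness[of _ Suc "\<lambda>i. i - 1"]) auto

context
  fixes m :: "nat \<Rightarrow> nat" and \<rho> \<phi> :: real
  assumes m: "\<And>i. i \<ge> 1 \<Longrightarrow> m i > 0" and rho: "\<rho> > 0" and phi: "\<phi> > 0"
begin

lemma scaled_weight_pos: "scaled_weight m \<phi> \<rho> n > 0"
  using total_weight_pos[OF m phi] rho by (simp add: scaled_weight_def)

lemma first_block_prob_nonneg: "first_block_prob m \<phi> \<rho> n i \<ge> 0"
proof -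
  have "0 \<le> scaled_irred m \<phi> \<rho> i" using rho phi by (simp add: scaled_irred_def)
  moreover have "0 \<le> scaled_weight m \<phi> \<rho> j" for j using scaled_weight_pos[of j] by simp
  ultimately show ?thesis by (simp add: first_block_prob_def)
qed

lemma sum_first_block_prob:
  assumes "n > 0"
  shows "(\<Sum>i=1..n. first_block_prob m \<phi> \<rho> n i) = 1"
proof -
  obtain k where n: "n = Suc k" using assms by (cases n) auto
  have "(\<Sum>i=1..n. first_block_prob m \<phi> \<rho> n i)
      = (\<Sum>i\<le>k. scaled_irred m \<phi> \<rho> (Suc i) * scaled_weight m \<phi> \<rho> (k - i) / (real n * scaled_weight m \<phi> \<rho> n))"
    unfolding n sum_1_to_Suc by (intro sum.cong) (auto simp: first_block_prob_def)
  also have "\<dots> = 1"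
    unfolding sum_divide_distrib[symmetric] n scaled_weight_rec[symmetric]
    using scaled_weight_pos[of "Suc k"] by (simp del: of_nat_Suc)
  finally show ?thesis .
qed

lemma first_block_prob_Suc:
  assumes "i \<le> n"
  shows "first_block_prob m \<phi> \<rho> (Suc n) (Suc i)
    = 1 / total_weight m \<phi> (Suc n) * (real (n choose i) * (\<phi> * real (m (Suc i)) * total_weight m \<phi> (n - i)))"
proof -
  have "real (Suc n) * scaled_weight m \<phi> \<rho> (Suc n) = \<rho> ^ Suc n / fact n * total_weight m \<phi> (Suc n)"
    by (simp add: scaled_weight_def del: of_nat_Suc)
  moreover have "\<rho> ^ Suc n / fact n \<noteq> 0" using rho by simp
  ultimately show ?thesis
    using assms by (simp add: first_block_prob_def scaled_weight_step del: power_Suc)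
qed

text \<open>Splits off the block of one point by \<open>partition_sum_Suc\<close>. Normalising each
  inner sum by its own \<open>total_weight\<close> turns it into an expectation, and the factor left
  over is the pick probability.\<close>

lemma nn_integral_tilted_assembly_rec:
  fixes h :: "nat multiset \<Rightarrow> ennreal"
  defines "L \<equiv> \<lambda>n h. \<integral>\<^sup>+a. h (image_mset card (mset_set (fst a))) \<partial>measure_pmf (tilted_assembly m \<phi> n)"
  assumes "n > 0"
  shows "L n h = (\<Sum>i=1..n. ennreal (first_block_prob m \<phi> \<rho> n i) * L (n - i) (\<lambda>M. h (add_mset i M)))"
proof -
  obtain k where n: "n = Suc k" using assms by (cases n) auto
  let ?S = "\<lambda>n h. partition_sum (\<lambda>i. ennreal \<phi> * of_nat (m i)) {1..n} h"
  let ?Z = "total_weight m \<phi>"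
  have Z: "?Z n > 0" for n by (rule total_weight_pos[OF m phi])
  have L: "L n h = ennreal (1 / ?Z n) * ?S n h" for n h
    unfolding L_def by (rule nn_integral_tilted_assembly[OF m phi])
  have S: "?S n h = ennreal (?Z n) * L n h" for n h
  proof -
    have "ennreal (?Z n) * ennreal (1 / ?Z n) = 1"
      using Z[of n] by (subst ennreal_mult[symmetric]) auto
    thus ?thesis unfolding L mult.assoc[symmetric] by simp
  qed
  have "L n h = ennreal (1 / ?Z (Suc k)) * (\<Sum>i\<le>k. of_nat (k choose i) *
      (ennreal \<phi> * of_nat (m (Suc i)) * (ennreal (?Z (k - i)) * L (k - i) (\<lambda>M. h (add_mset (Suc i) M)))))"
    unfolding n L[of "Suc k"] partition_sum_Suc by (simp only: S)
  also have "\<dots> = (\<Sum>i\<le>k. ennreal (first_block_prob m \<phi> \<rho> (Suc k) (Suc i)) * L (k - i) (\<lambda>M. h (add_mset (Suc i) M)))"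
    unfolding sum_distrib_left
  proof (rule sum.cong[OF refl])
    fix i assume i: "i \<in> {..k}"
    have "ennreal (first_block_prob m \<phi> \<rho> (Suc k) (Suc i))
        = ennreal (1 / ?Z (Suc k)) * (ennreal (real (k choose i)) * (ennreal \<phi> * ennreal (real (m (Suc i))) * ennreal (?Z (k - i))))"
    proof -
      have nn: "0 \<le> real (k choose i)" "0 \<le> \<phi>" "0 \<le> real (m (Suc i))" "0 \<le> ?Z (k - i)" "0 \<le> 1 / ?Z (Suc k)"
        using Z[of "k - i"] Z[of "Suc k"] phi by simp_all
      have "first_block_prob m \<phi> \<rho> (Suc k) (Suc i)
          = 1 / ?Z (Suc k) * (real (k choose i) * (\<phi> * real (m (Suc i)) * ?Z (k - i)))"
        using i by (intro first_block_prob_Suc) simp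
      thus ?thesis by (simp only: ennreal_mult nn mult_nonneg_nonneg)
    qed
    thus "ennreal (1 / ?Z (Suc k)) * (of_nat (k choose i) *
      (ennreal \<phi> * of_nat (m (Suc i)) * (ennreal (?Z (k - i)) * L (k - i) (\<lambda>M. h (add_mset (Suc i) M)))))
      = ennreal (first_block_prob m \<phi> \<rho> (Suc k) (Suc i)) * L (k - i) (\<lambda>M. h (add_mset (Suc i) M))"
      by (simp add: ennreal_of_nat_eq_real_of_nat mult.assoc)
  qed
  also have "\<dots> = (\<Sum>i=1..n. ennreal (first_block_prob m \<phi> \<rho> n i) * L (n - i) (\<lambda>M. h (add_mset i M)))"
    unfolding n sum_1_to_Suc by simp
  finally show ?thesis .
qed

text \<open>Both sides obey the same one-step recursion for every test function; indicators then
  give equality of laws.\<close>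

lemma distr_chain_mset_eq:
  "distr iid_uniform (count_space UNIV) (chain_mset (first_block_prob m \<phi> \<rho>) n)
    = distr (measure_pmf (tilted_assembly m \<phi> n)) (count_space UNIV) (\<lambda>a. image_mset card (mset_set (fst a)))"
proof (rule measure_eqI)
  fix A :: "nat multiset set"
  let ?w = "first_block_prob m \<phi> \<rho>"
  let ?L = "\<lambda>n h. \<integral>\<^sup>+a. h (image_mset card (mset_set (fst a))) \<partial>measure_pmf (tilted_assembly m \<phi> n)"
  have cm [measurable]: "chain_mset ?w n \<in> iid_uniform \<rightarrow>\<^sub>M count_space UNIV"
    by (rule chain_mset_measurable_iid)
  have L0: "?L 0 h = h {#}" for h
    by (subst nn_integral_tilted_assembly[OF m phi]) (simp_all add: partition_sum_empty)
  have "emeasure (distr iid_uniform (count_space UNIV) (chain_mset ?w n)) A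
      = (\<integral>\<^sup>+x. indicator A x \<partial>distr iid_uniform (count_space UNIV) (chain_mset ?w n))"
    by simp
  also have "\<dots> = (\<integral>\<^sup>+u. indicator A (chain_mset ?w n u) \<partial>iid_uniform)"
    by (rule nn_integral_distr[OF cm]) simp
  also have "\<dots> = ?L n (indicator A)"
  proof (rule nn_integral_chain_mset[where L = ?L and h = "indicator A"])
    fix n h assume "n > (0::nat)"
    thus "?L n h = (\<Sum>i=1..n. ennreal (?w n i) * ?L (n - i) (\<lambda>M. h (add_mset i M)))"
      by (rule nn_integral_tilted_assembly_rec)
  qed (rule first_block_prob_nonneg sum_first_block_prob L0; assumption?)+
  also have "\<dots> = (\<integral>\<^sup>+x. indicator A x \<partial>distr (measure_pmf (tilted_assembly m \<phi> n)) (count_space UNIV) (\<lambda>a. image_mset card (mset_set (fst a))))"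
    by (rule nn_integral_distr[symmetric]) simp_all
  also have "\<dots> = emeasure (distr (measure_pmf (tilted_assembly m \<phi> n)) (count_space UNIV) (\<lambda>a. image_mset card (mset_set (fst a)))) A"
    by simp
  finally show "emeasure (distr iid_uniform (count_space UNIV) (chain_mset ?w n)) A
      = emeasure (distr (measure_pmf (tilted_assembly m \<phi> n)) (count_space UNIV) (\<lambda>a. image_mset card (mset_set (fst a)))) A" .
qed simp

end

lemma integral_tilted_assembly_eq:
  fixes g :: "nat multiset \<Rightarrow> real"
  assumes "\<And>i. i \<ge> 1 \<Longrightarrow> m i > 0" "\<rho> > 0" "\<phi> > 0"
  shows "(\<integral>a. g (image_mset card (mset_set (fst a))) \<partial>measure_pmf (tilted_assembly m \<phi> n))
    = (\<integral>u. g (chain_mset (first_block_prob m \<phi> \<rho>) n u) \<partial>iid_uniform)"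
proof -
  let ?w = "first_block_prob m \<phi> \<rho>"
  have cm: "chain_mset ?w n \<in> iid_uniform \<rightarrow>\<^sub>M count_space UNIV"
    by (rule chain_mset_measurable_iid)
  have "(\<integral>a. g (image_mset card (mset_set (fst a))) \<partial>measure_pmf (tilted_assembly m \<phi> n))
      = (\<integral>x. g x \<partial>distr (measure_pmf (tilted_assembly m \<phi> n)) (count_space UNIV) (\<lambda>a. image_mset card (mset_set (fst a))))"
    by (rule integral_distr[symmetric]) simp_all
  also have "\<dots> = (\<integral>x. g x \<partial>distr iid_uniform (count_space UNIV) (chain_mset ?w n))"
    using distr_chain_mset_eq[of m \<rho> \<phi> n] assms by simp
  also have "\<dots> = (\<integral>u. g (chain_mset ?w n u) \<partial>iid_uniform)"
    by (rule integral_distr[OF cm]) simp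
  finally show ?thesis .
qed

text \<open>The test function f is controlled only on functions that are \<open>undefined\<close>
  beyond k, so continuity is asked of its composition with \<open>restrict\<close>. That composition
  is Borel on the space of all sequences and agrees with f on the finite product.\<close>

lemma first_coords_integral:
  fixes f :: "(nat \<Rightarrow> real) \<Rightarrow> real"
  assumes X: "X \<in> M \<rightarrow>\<^sub>M (\<Pi>\<^sub>M i\<in>UNIV. borel)"
    and f: "continuous_on UNIV (\<lambda>x. f (restrict x {..<k}))"
  shows "(\<integral>x. f x \<partial>first_coords k M X) = (\<integral>\<omega>. f (restrict (X \<omega>) {..<k}) \<partial>M)"
proof -
  let ?P = "\<Pi>\<^sub>M i\<in>{..<k}. (borel :: real measure)"
  have "(\<lambda>x. f (restrict x {..<k})) \<in> borel_measurable borel"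
    using f by (rule borel_measurable_continuous_onI)
  hence fm: "(\<lambda>x. f (restrict x {..<k})) \<in> borel_measurable (\<Pi>\<^sub>M i\<in>UNIV. (borel :: real measure))"
    unfolding measurable_cong_sets[OF sets_PiM_equal_borel refl] .
  \<comment> \<open>Maps the finite product into the full one; beyond k each coordinate is the
    constant \<open>undefined\<close>.\<close>
  have id: "(\<lambda>x. x) \<in> ?P \<rightarrow>\<^sub>M (\<Pi>\<^sub>M i\<in>UNIV. (borel :: real measure))"
  proof (rule measurable_PiM_single')
    fix i :: nat
    show "(\<lambda>x. x i) \<in> borel_measurable ?P"
    proof (cases "i < k")
      case True
      thus ?thesis by (intro measurable_component_singleton) simp
    next
      case False
      hence "x i = undefined" if "x \<in> space ?P" for x
        using that by (auto simp: space_PiM PiE_def extensional_def)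
      thus ?thesis by (subst measurable_cong[where g = "\<lambda>_. undefined"]) auto
    qed
  qed auto
  have "f \<in> borel_measurable ?P"
  proof (subst measurable_cong)
    fix x assume "x \<in> space ?P"
    hence "restrict x {..<k} = x" by (auto simp: space_PiM PiE_def extensional_restrict)
    thus "f x = f (restrict x {..<k})" by simp
  next
    show "(\<lambda>x. f (restrict x {..<k})) \<in> borel_measurable ?P"
      by (rule measurable_compose[OF id fm])
  qed
  moreover have "(\<lambda>\<omega>. restrict (X \<omega>) {..<k}) \<in> M \<rightarrow>\<^sub>M ?P"
    by (rule measurable_compose[OF X measurable_restrict_subset]) simp
  ultimately show ?thesis
    unfolding first_coords_def by (intro integral_distr)
qed

theorem theorem4:
  fixes m :: "nat \<Rightarrow> nat" and \<rho> \<theta> lam \<phi> :: real and k :: nat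
  assumes "\<And>i. i \<ge> 1 \<Longrightarrow> m i > 0"
    and "flajolet_soria (egf m) \<rho> \<theta> lam"
    and "\<phi> > 0"
    and "k > 0"
  shows "weak_conv_in (product_topology (\<lambda>_. euclideanreal) {..<k})
           (\<lambda>n. first_coords k (measure_pmf (tilted_assembly m \<phi> n)) (rel_size n))
           (first_coords k (PD (\<phi> * \<theta>)) (\<lambda>x. x))"
  unfolding weak_conv_in_def
proof (intro allI impI)
  fix f :: "(nat \<Rightarrow> real) \<Rightarrow> real"
  assume cont: "continuous_map (product_topology (\<lambda>_. euclideanreal) {..<k}) euclideanreal f"
    and bdd: "bounded (f ` topspace (product_topology (\<lambda>_. euclideanreal) {..<k}))"
  define \<alpha> where "\<alpha> = \<phi> * \<theta>"
  have rho: "\<rho> > 0" and theta: "\<theta> > 0" using assms(2) by (auto simp: flajolet_soria_def)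
  have al: "\<alpha> > 0" using theta assms(3) by (simp add: \<alpha>_def)
  let ?w = "first_block_prob m \<phi> \<rho>"
  \<comment> \<open>Extends the test function to all sequences, so that ranked chains and sorted
    sticks can be compared on one space.\<close>
  define F where "F x = f (restrict x {..<k})" for x
  have "continuous_map (product_topology (\<lambda>_. euclideanreal) UNIV) (product_topology (\<lambda>_. euclideanreal) {..<k})
      (\<lambda>x. restrict x {..<k})"
    by (rule continuous_on_restrict) simp
  from continuous_map_compose[OF this cont] have "continuous_map euclidean euclidean F"
    unfolding euclidean_product_topology o_def F_def[abs_def] .
  hence contF: "continuous_on UNIV F" by simp
  obtain B where "\<forall>y\<in>f ` topspace (product_topology (\<lambda>_. euclideanreal) {..<k}). norm y \<le> B"
    using bdd by (auto simp: bounded_iff)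
  moreover have "restrict x {..<k} \<in> topspace (product_topology (\<lambda>_. euclideanreal) {..<k})" for x :: "nat \<Rightarrow> real"
    by simp
  ultimately have B: "norm (F x) \<le> B" for x unfolding F_def by blast
  have w: "?w n i \<ge> 0" for n i by (rule first_block_prob_nonneg[OF assms(1) rho assms(3)])
  have q0: "scaled_weight m \<phi> \<rho> 0 = 1" by (simp add: scaled_weight_def)
  note asymp = tilted_coeff_asymp[of m \<rho> \<theta> lam \<phi> "scaled_irred m \<phi> \<rho>" "scaled_weight m \<phi> \<rho>",
      OF assms(2,3) scaled_irred_def q0 scaled_weight_rec, folded \<alpha>_def]
  have C: "0 < exp (\<phi> * lam) * rGamma \<alpha>" using al by (simp add: rGamma_inverse_Gamma Gamma_real_pos)
  \<comment> \<open>Here \<open>k\<close> is a bound sequence of thresholds and hides the number of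
    coordinates.\<close>
  have tail: "(\<lambda>n. tail_weight ?w n (k n)) \<longlonglongrightarrow> (1 - x) powr \<alpha>"
    if "0 < x" "x < 1" "(\<lambda>n. real (k n) / real n) \<longlonglongrightarrow> x" for x k
    by (rule tail_weight_tendsto[OF al C asymp(1) _ asymp(2) _ that(3,1,2)])
       (auto simp: first_block_prob_def intro: scaled_weight_pos[OF assms(1) rho assms(3)])
  have fs: "(\<lambda>n. real (first_size ?w n u) / real n) \<longlonglongrightarrow> 1 - u powr (1 / \<alpha>)" if "0 < u" "u < 1" for u
    by (rule first_size_tendsto[OF al w tail that])
  have AE: "AE u in iid_uniform. \<forall>j. (\<lambda>n. ranked_size n (chain_mset ?w n u) j) \<longlonglongrightarrow> sort_desc (stick_breaking \<alpha> u) j"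
    by (rule ranked_chain_tendsto[OF al chain_tendsto[OF fs]])
  have ssm: "(\<lambda>u. sort_desc (stick_breaking \<alpha> u)) \<in> iid_uniform \<rightarrow>\<^sub>M (\<Pi>\<^sub>M i\<in>UNIV. borel)"
    by (rule measurable_compose[OF stick_breaking_measurable sort_desc_measurable])
  have Fm: "F \<in> borel_measurable (\<Pi>\<^sub>M i\<in>UNIV. (borel :: real measure))"
    unfolding measurable_cong_sets[OF sets_PiM_equal_borel refl]
    by (rule borel_measurable_continuous_onI[OF contF])
  interpret prob_space iid_uniform by (rule prob_space_iid_uniform)
  \<comment> \<open>The coupling reduces weak convergence to almost sure convergence of bounded
    variables, as F is continuous for coordinatewise limits.\<close>
  have "(\<lambda>n. \<integral>u. F (ranked_size n (chain_mset ?w n u)) \<partial>iid_uniform) \<longlonglongrightarrow> (\<integral>u. F (sort_desc (stick_breaking \<alpha> u)) \<partial>iid_uniform)"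
  proof (rule integral_dominated_convergence[where w = "\<lambda>_. B"])
    show "(\<lambda>u. F (sort_desc (stick_breaking \<alpha> u))) \<in> borel_measurable iid_uniform"
      by (rule measurable_compose[OF ssm Fm])
    show "(\<lambda>u. F (ranked_size n (chain_mset ?w n u))) \<in> borel_measurable iid_uniform" for n
    proof -
      have "chain_mset ?w n \<in> iid_uniform \<rightarrow>\<^sub>M count_space UNIV"
        by (rule chain_mset_measurable_iid)
      from measurable_compose[OF this, of "\<lambda>M. F (ranked_size n M)" borel] show ?thesis by simp
    qed
    show "AE u in iid_uniform. (\<lambda>n. F (ranked_size n (chain_mset ?w n u))) \<longlonglongrightarrow> F (sort_desc (stick_breaking \<alpha> u))"
      using AE
    proof eventually_elim
      case (elim u)
      have "limitin (product_topology (\<lambda>_. euclidean) UNIV) (\<lambda>n. ranked_size n (chain_mset ?w n u))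
          (sort_desc (stick_breaking \<alpha> u)) sequentially"
        unfolding limitin_componentwise using elim by simp
      hence "(\<lambda>n. ranked_size n (chain_mset ?w n u)) \<longlonglongrightarrow> sort_desc (stick_breaking \<alpha> u)"
        unfolding euclidean_product_topology by simp
      moreover have "isCont F (sort_desc (stick_breaking \<alpha> u))"
        using continuous_on_interior[OF contF] by simp
      ultimately show ?case by (rule isCont_tendsto_compose[rotated])
    qed
  qed (use B in auto)
  moreover have "(\<integral>x. f x \<partial>first_coords k (measure_pmf (tilted_assembly m \<phi> n)) (rel_size n))
      = (\<integral>u. F (ranked_size n (chain_mset ?w n u)) \<partial>iid_uniform)" for n
  proof -
    have "(\<integral>x. f x \<partial>first_coords k (measure_pmf (tilted_assembly m \<phi> n)) (rel_size n))
        = (\<integral>a. F (rel_size n a) \<partial>measure_pmf (tilted_assembly m \<phi> n))"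
      unfolding F_def
    proof (rule first_coords_integral)
      show "rel_size n \<in> measure_pmf (tilted_assembly m \<phi> n) \<rightarrow>\<^sub>M (\<Pi>\<^sub>M i\<in>UNIV. borel)"
        by (simp add: space_PiM)
    qed (rule contF[unfolded F_def[abs_def]])
    also have "\<dots> = (\<integral>u. F (ranked_size n (chain_mset ?w n u)) \<partial>iid_uniform)"
      unfolding rel_size_eq_ranked_size
      by (rule integral_tilted_assembly_eq[OF assms(1) rho assms(3), where g = "\<lambda>M. F (ranked_size n M)"])
    finally show ?thesis .
  qed
  moreover have "(\<integral>x. f x \<partial>first_coords k (PD (\<phi> * \<theta>)) (\<lambda>x. x)) = (\<integral>u. F (sort_desc (stick_breaking \<alpha> u)) \<partial>iid_uniform)"
  proof -
    have "(\<integral>x. f x \<partial>first_coords k (PD \<alpha>) (\<lambda>x. x)) = (\<integral>x. F x \<partial>PD \<alpha>)"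
      unfolding F_def
    proof (rule first_coords_integral)
      show "(\<lambda>x. x) \<in> PD \<alpha> \<rightarrow>\<^sub>M (\<Pi>\<^sub>M i\<in>UNIV. borel)"
        by (simp add: PD_def)
    qed (rule contF[unfolded F_def[abs_def]])
    also have "\<dots> = (\<integral>u. F (sort_desc (stick_breaking \<alpha> u)) \<partial>iid_uniform)"
      unfolding PD_def by (rule integral_distr[OF ssm Fm])
    finally show ?thesis by (simp add: \<alpha>_def)
  qed
  ultimately show "(\<lambda>n. \<integral>x. f x \<partial>first_coords k (measure_pmf (tilted_assembly m \<phi> n)) (rel_size n))
      \<longlonglongrightarrow> (\<integral>x. f x \<partial>first_coords k (PD (\<phi> * \<theta>)) (\<lambda>x. x))"
    by simp
qed

end
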